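(* Let $R$ be a trinomial algebra of Type $2$ over an algebraically closed field $\Bbbk$ of characteristic zero. Then $R$ is semirigid if and only if either $R$ is rigid, or there is exactly one free variable $S_1$ (i.e. $d=1$) and the algebra $R_1$ is rigid, where $R_1$ is the trinomial algebra obtained from $R$ by removing $S_1$ from the set of generators.
   Context: Trinomial algebra of Type $2$: fix integers $r\ge2$, $d\ge0$, $n_i\ge1$ ($i=0,\dots,r$), positive integers $l_{ij}$ ($1\le j\le n_i$), and pairwise linearly independent column vectors $a_0,\dots,a_r\in\Bbbk^2$. Put $T_i^{l_i}=\prod_{j=1}^{n_i}T_{ij}^{l_{ij}}$. Then $R$ is the quotient of $\Bbbk[T_{ij},S_k\mid 0\le i\le r,\,1\le j\le n_i,\,1\le k\le d]$ by the ideal generated by $\det\begin{pmatrix}T_i^{l_i}&T_{i+1}^{l_{i+1}}&T_{i+2}^{l_{i+2}}\\ a_i&a_{i+1}&a_{i+2}\end{pmatrix}$, $i=0,\dots,r-2$. (It is a normal domain.) A derivation $\delta$ of $R$ is locally nilpotent (an LND) if for each $f\in R$ there is $n>0$ with $\delta^n(f)=0$. An algebra is rigid if it admits no nonzero LND. Two LNDs are equivalent if their kernels coincide; an algebra is semirigid if all its nonzero LNDs are equivalent to each other. *)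

theory Defs
  imports
    "HOL-Library.Poly_Mapping"
    "HOL-Computational_Algebra.Polynomial"
    "HOL-Analysis.Determinants"
    "HOL-Algebra.QuotRing"
    "HOL-Algebra.Module"
begin

section \<open>Derivations, rigid and semirigid algebras\<close>

text \<open>
  An algebra over a field is a record of type \<open>('k, 'b) module\<close>, carrying both the ring operations
  and the scalar multiplication. The ground field is the type \<open>'k\<close> itself, so scalars are not
  relativised to a carrier.
\<close>

definition derivation :: "('k, 'b, 'm) module_scheme \<Rightarrow> ('b \<Rightarrow> 'b) \<Rightarrow> bool" where
  "derivation A \<delta> \<longleftrightarrow>
     \<delta> \<in> carrier A \<rightarrow> carrier A \<and>
     (\<forall>x\<in>carrier A. \<forall>y\<in>carrier A. \<delta> (x \<oplus>\<^bsub>A\<^esub> y) = \<delta> x \<oplus>\<^bsub>A\<^esub> \<delta> y) \<and>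
     (\<forall>c. \<forall>x\<in>carrier A. \<delta> (c \<odot>\<^bsub>A\<^esub> x) = c \<odot>\<^bsub>A\<^esub> \<delta> x) \<and>
     (\<forall>x\<in>carrier A. \<forall>y\<in>carrier A.
        \<delta> (x \<otimes>\<^bsub>A\<^esub> y) = (\<delta> x \<otimes>\<^bsub>A\<^esub> y) \<oplus>\<^bsub>A\<^esub> (x \<otimes>\<^bsub>A\<^esub> \<delta> y))"

definition LND :: "('k, 'b, 'm) module_scheme \<Rightarrow> ('b \<Rightarrow> 'b) \<Rightarrow> bool" where
  "LND A \<delta> \<longleftrightarrow>
     derivation A \<delta> \<and> (\<forall>f\<in>carrier A. \<exists>n>0. (\<delta> ^^ n) f = \<zero>\<^bsub>A\<^esub>)"

definition nonzero_LND :: "('k, 'b, 'm) module_scheme \<Rightarrow> ('b \<Rightarrow> 'b) \<Rightarrow> bool" where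
  "nonzero_LND A \<delta> \<longleftrightarrow> LND A \<delta> \<and> (\<exists>f\<in>carrier A. \<delta> f \<noteq> \<zero>\<^bsub>A\<^esub>)"

definition equivalent_LND ::
    "('k, 'b, 'm) module_scheme \<Rightarrow> ('b \<Rightarrow> 'b) \<Rightarrow> ('b \<Rightarrow> 'b) \<Rightarrow> bool" where
  "equivalent_LND A \<delta> \<delta>' \<longleftrightarrow> a_kernel A A \<delta> = a_kernel A A \<delta>'"

definition rigid :: "('k, 'b, 'm) module_scheme \<Rightarrow> bool" where
  "rigid A \<longleftrightarrow> \<not> (\<exists>\<delta>. nonzero_LND A \<delta>)"

definition semirigid :: "('k, 'b, 'm) module_scheme \<Rightarrow> bool" where
  "semirigid A \<longleftrightarrow>
     (\<forall>\<delta> \<delta>'. nonzero_LND A \<delta> \<longrightarrow> nonzero_LND A \<delta>' \<longrightarrow> equivalent_LND A \<delta> \<delta>')"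

section \<open>Polynomial rings\<close>

text \<open>
  A monomial is a finitely supported exponent vector, and a polynomial a finitely supported family
  of coefficients indexed by monomials; the product of such families is convolution.
\<close>

type_synonym ('v, 'k) mpoly = "('v \<Rightarrow>\<^sub>0 nat) \<Rightarrow>\<^sub>0 'k"

definition Var :: "'v \<Rightarrow> ('v, 'k::comm_ring_1) mpoly" where
  "Var v = Poly_Mapping.single (Poly_Mapping.single v 1) 1"

definition Const :: "'k::comm_ring_1 \<Rightarrow> ('v, 'k) mpoly" where
  "Const c = Poly_Mapping.single 0 c"

text \<open>
  The polynomial ring in the variables \<open>V\<close>, inside the ring of polynomials in all variables of
  type \<open>'v\<close>.
\<close>

definition polynomial_ring :: "'v set \<Rightarrow> ('v, 'k::comm_ring_1) mpoly ring" where
  "polynomial_ring V =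
     \<lparr>carrier = {p. \<forall>m\<in>Poly_Mapping.keys p. Poly_Mapping.keys m \<subseteq> V},
      mult = (*), one = 1, zero = 0, add = (+)\<rparr>"

section \<open>Trinomial algebras of Type 2\<close>

datatype generator = T nat nat | S nat

definition generators :: "nat \<Rightarrow> nat \<Rightarrow> (nat \<Rightarrow> nat) \<Rightarrow> generator set" where
  "generators r d n = {T i j | i j. i \<le> r \<and> 1 \<le> j \<and> j \<le> n i} \<union> {S k | k. 1 \<le> k \<and> k \<le> d}"

definition T_monomial ::
    "(nat \<Rightarrow> nat) \<Rightarrow> (nat \<Rightarrow> nat \<Rightarrow> nat) \<Rightarrow> nat \<Rightarrow> (generator, 'k::comm_ring_1) mpoly" where
  "T_monomial n l i = (\<Prod>j = 1..n i. Var (T i j) ^ l i j)"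

definition trinomial ::
    "(nat \<Rightarrow> nat) \<Rightarrow> (nat \<Rightarrow> nat \<Rightarrow> nat) \<Rightarrow> (nat \<Rightarrow> 'k::comm_ring_1 ^ 2) \<Rightarrow> nat
      \<Rightarrow> (generator, 'k) mpoly" where
  "trinomial n l a i = det (vector
     [vector [T_monomial n l i, T_monomial n l (i + 1), T_monomial n l (i + 2)],
      vector [Const (a i $ 1),  Const (a (i + 1) $ 1),  Const (a (i + 2) $ 1)],
      vector [Const (a i $ 2),  Const (a (i + 1) $ 2),  Const (a (i + 2) $ 2)]]
     :: (generator, 'k) mpoly ^ 3 ^ 3)"

definition trinomial_ideal ::
    "nat \<Rightarrow> nat \<Rightarrow> (nat \<Rightarrow> nat) \<Rightarrow> (nat \<Rightarrow> nat \<Rightarrow> nat) \<Rightarrow> (nat \<Rightarrow> 'k::comm_ring_1 ^ 2)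
      \<Rightarrow> (generator, 'k) mpoly set" where
  "trinomial_ideal r d n l a =
     Idl\<^bsub>polynomial_ring (generators r d n)\<^esub> {trinomial n l a i | i. i + 2 \<le> r}"

text \<open>
  The quotient ring, with scalars acting through multiplication by the cosets of constants.
\<close>

definition trinomial_algebra ::
    "nat \<Rightarrow> nat \<Rightarrow> (nat \<Rightarrow> nat) \<Rightarrow> (nat \<Rightarrow> nat \<Rightarrow> nat) \<Rightarrow> (nat \<Rightarrow> 'k::comm_ring_1 ^ 2)
      \<Rightarrow> ('k, (generator, 'k) mpoly set) module" where
  "trinomial_algebra r d n l a =
     (let P = polynomial_ring (generators r d n);
          I = trinomial_ideal r d n l a;
          R = P Quot I
      in \<lparr>carrier = carrier R, mult = mult R, one = one R, zero = zero R, add = add R,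
          smult = (\<lambda>c x. (I +>\<^bsub>P\<^esub> Const c) \<otimes>\<^bsub>R\<^esub> x)\<rparr>)"

end

(*
  For d >= 2 the partial derivatives with respect to two free variables are inequivalent. For
  d = 1 the algebra is R_0[S], where R_0 has no free variable. If R_0 is rigid, the top-degree part
  of a locally nilpotent derivation (LND) shows that every nonzero LND is a multiple of d/dS; if
  R_0 has a nonzero LND, its extension to R_0[S] is not equivalent to d/dS.

  For d = 0 assume that R_0 is semirigid with a nonzero LND, and let K be its kernel, which is then
  stable under all automorphisms, in particular under the quasitorus that scales the T_ij. So K is
  graded, and as K is factorially closed it is generated by the T_ij and the linear forms in
  T_0^{l_0}, T_1^{l_1} that it contains. A derivation that kills K is proportional to the LND, and
  applying this to Euler derivations shows that for every i at most one T_ij(i) is outside K and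
  that K contains a nonzero linear form. A Mason-Stothers argument now gives l_ij(i) = 1 for all
  but at most one of the i with T_i^{l_i} outside K. These equalities allow an explicit LND whose
  kernel contains some T_ij(i) outside K: a contradiction.

  All this needs that R_0 is a domain. It is embedded into a group algebra over power series by
  sending T_i1 to a monomial times an l_i1-th root of a linear polynomial; the injectivity is the
  linear independence of products of such roots over the polynomials.
*)

theory Submission
  imports Defs "HOL-Computational_Algebra.Polynomial_FPS" "HOL-Library.Nat_Bijection"
begin

section \<open>Transport along isomorphisms\<close>

definition module_iso :: "('b \<Rightarrow> 'c) \<Rightarrow> ('k, 'b, 'm) module_scheme \<Rightarrow> ('k, 'c, 'n) module_scheme \<Rightarrow> bool" where
  "module_iso f A B \<longleftrightarrow> bij_betw f (carrier A) (carrier B) \<and> f \<zero>\<^bsub>A\<^esub> = \<zero>\<^bsub>B\<^esub> \<and>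
     \<zero>\<^bsub>A\<^esub> \<in> carrier A \<and>
     (\<forall>x\<in>carrier A. \<forall>y\<in>carrier A. x \<oplus>\<^bsub>A\<^esub> y \<in> carrier A \<and> f (x \<oplus>\<^bsub>A\<^esub> y) = f x \<oplus>\<^bsub>B\<^esub> f y) \<and>
     (\<forall>x\<in>carrier A. \<forall>y\<in>carrier A. x \<otimes>\<^bsub>A\<^esub> y \<in> carrier A \<and> f (x \<otimes>\<^bsub>A\<^esub> y) = f x \<otimes>\<^bsub>B\<^esub> f y) \<and>
     (\<forall>c. \<forall>x\<in>carrier A. c \<odot>\<^bsub>A\<^esub> x \<in> carrier A \<and> f (c \<odot>\<^bsub>A\<^esub> x) = c \<odot>\<^bsub>B\<^esub> f x)"

lemma module_iso_sym:
  assumes "module_iso f A B" shows "module_iso (inv_into (carrier A) f) B A"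
proof -
  define g where "g = inv_into (carrier A) f"
  have b: "bij_betw f (carrier A) (carrier B)" using assms by (simp add: module_iso_def)
  have gf: "g (f x) = x" if "x \<in> carrier A" for x
    using b that by (simp add: g_def bij_betw_inv_into_left)
  have 1: "\<exists>y\<in>carrier A. f y = x" if "x \<in> carrier B" for x
    using b that unfolding bij_betw_def by (metis image_iff)
  have 2: "f y \<in> carrier B" if "y \<in> carrier A" for y
    using b that by (auto simp: bij_betw_def)
  have H: "x \<oplus>\<^bsub>B\<^esub> y \<in> carrier B \<and> g (x \<oplus>\<^bsub>B\<^esub> y) = g x \<oplus>\<^bsub>A\<^esub> g y"
    "x \<otimes>\<^bsub>B\<^esub> y \<in> carrier B \<and> g (x \<otimes>\<^bsub>B\<^esub> y) = g x \<otimes>\<^bsub>A\<^esub> g y"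
    "c \<odot>\<^bsub>B\<^esub> x \<in> carrier B \<and> g (c \<odot>\<^bsub>B\<^esub> x) = c \<odot>\<^bsub>A\<^esub> g x"
    if xy: "x \<in> carrier B" "y \<in> carrier B" for x y c
  proof -
    obtain x' y' where x': "x' \<in> carrier A" "f x' = x" "y' \<in> carrier A" "f y' = y"
      using 1 xy by meson
    show "x \<oplus>\<^bsub>B\<^esub> y \<in> carrier B \<and> g (x \<oplus>\<^bsub>B\<^esub> y) = g x \<oplus>\<^bsub>A\<^esub> g y"
      using assms x' 2 gf unfolding module_iso_def by metis
    show "x \<otimes>\<^bsub>B\<^esub> y \<in> carrier B \<and> g (x \<otimes>\<^bsub>B\<^esub> y) = g x \<otimes>\<^bsub>A\<^esub> g y"
      using assms x' 2 gf unfolding module_iso_def by metis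
    show "c \<odot>\<^bsub>B\<^esub> x \<in> carrier B \<and> g (c \<odot>\<^bsub>B\<^esub> x) = c \<odot>\<^bsub>A\<^esub> g x"
      using assms x' 2 gf unfolding module_iso_def by metis
  qed
  have bg: "bij_betw g (carrier B) (carrier A)" using b by (simp add: g_def bij_betw_inv_into)
  have z: "g \<zero>\<^bsub>B\<^esub> = \<zero>\<^bsub>A\<^esub>" "\<zero>\<^bsub>B\<^esub> \<in> carrier B"
    using assms gf 2 unfolding module_iso_def by metis+
  show ?thesis unfolding module_iso_def g_def[symmetric]
    by (intro conjI ballI allI bg z) (simp_all only: H)
qed

lemma nonzero_LND_transport:
  assumes iso: "module_iso f A B" and \<delta>: "nonzero_LND A \<delta>"
  defines "g \<equiv> inv_into (carrier A) f"
  shows "nonzero_LND B (f \<circ> \<delta> \<circ> g)"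
    and "a_kernel B B (f \<circ> \<delta> \<circ> g) = f ` a_kernel A A \<delta>"
proof -
  let ?\<delta> = "f \<circ> \<delta> \<circ> g"
  have b: "bij_betw f (carrier A) (carrier B)" using iso by (simp add: module_iso_def)
  have gf: "g (f x) = x" if "x \<in> carrier A" for x
    using b that by (simp add: g_def bij_betw_inv_into_left)
  have fg: "f (g x) = x" if "x \<in> carrier B" for x
    using b that by (simp add: g_def bij_betw_inv_into_right)
  have gA: "g x \<in> carrier A" if "x \<in> carrier B" for x
    using module_iso_sym[OF iso] that unfolding g_def[symmetric] module_iso_def bij_betw_def by auto
  have fB: "f x \<in> carrier B" if "x \<in> carrier A" for x
    using b that by (auto simp: bij_betw_def)
  have dA: "\<delta> x \<in> carrier A" if "x \<in> carrier A" for x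
    using \<delta> that unfolding nonzero_LND_def LND_def derivation_def by auto
  have f0: "f x = \<zero>\<^bsub>B\<^esub> \<longleftrightarrow> x = \<zero>\<^bsub>A\<^esub>" if "x \<in> carrier A" for x
    using b that iso gf unfolding module_iso_def by metis
  have der: "derivation A \<delta>" and ln: "\<And>x. x \<in> carrier A \<Longrightarrow> \<exists>n>0. (\<delta> ^^ n) x = \<zero>\<^bsub>A\<^esub>"
    using \<delta> unfolding nonzero_LND_def LND_def by auto
  have i1: "f (x \<oplus>\<^bsub>A\<^esub> y) = f x \<oplus>\<^bsub>B\<^esub> f y" "f (x \<otimes>\<^bsub>A\<^esub> y) = f x \<otimes>\<^bsub>B\<^esub> f y"
      "f (c \<odot>\<^bsub>A\<^esub> x) = c \<odot>\<^bsub>B\<^esub> f x" "x \<otimes>\<^bsub>A\<^esub> y \<in> carrier A"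
    if "x \<in> carrier A" "y \<in> carrier A" for x y c
    using iso that unfolding module_iso_def by blast+
  have i2: "g (x \<oplus>\<^bsub>B\<^esub> y) = g x \<oplus>\<^bsub>A\<^esub> g y" "g (x \<otimes>\<^bsub>B\<^esub> y) = g x \<otimes>\<^bsub>A\<^esub> g y"
      "g (c \<odot>\<^bsub>B\<^esub> x) = c \<odot>\<^bsub>A\<^esub> g x"
    if "x \<in> carrier B" "y \<in> carrier B" for x y c
    using module_iso_sym[OF iso] that unfolding g_def[symmetric] module_iso_def by blast+
  have d: "\<delta> (x \<oplus>\<^bsub>A\<^esub> y) = \<delta> x \<oplus>\<^bsub>A\<^esub> \<delta> y" "\<delta> (c \<odot>\<^bsub>A\<^esub> x) = c \<odot>\<^bsub>A\<^esub> \<delta> x"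
      "\<delta> (x \<otimes>\<^bsub>A\<^esub> y) = (\<delta> x \<otimes>\<^bsub>A\<^esub> y) \<oplus>\<^bsub>A\<^esub> (x \<otimes>\<^bsub>A\<^esub> \<delta> y)"
    if "x \<in> carrier A" "y \<in> carrier A" for x y c
    using der that unfolding derivation_def by blast+
  have "derivation B ?\<delta>"
    unfolding derivation_def
  proof (intro conjI ballI allI)
    show "?\<delta> \<in> carrier B \<rightarrow> carrier B" using gA fB dA by auto
  next
    fix x y assume "x \<in> carrier B" "y \<in> carrier B"
    then show "?\<delta> (x \<oplus>\<^bsub>B\<^esub> y) = ?\<delta> x \<oplus>\<^bsub>B\<^esub> ?\<delta> y"
      by (simp add: i2 i1 d gA dA)
  next
    fix c x assume "x \<in> carrier B"
    then show "?\<delta> (c \<odot>\<^bsub>B\<^esub> x) = c \<odot>\<^bsub>B\<^esub> ?\<delta> x"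
      using i2(3)[of x x] i1(3) d(2) gA dA by (metis comp_apply)
  next
    fix x y assume "x \<in> carrier B" "y \<in> carrier B"
    then show "?\<delta> (x \<otimes>\<^bsub>B\<^esub> y) = (?\<delta> x \<otimes>\<^bsub>B\<^esub> y) \<oplus>\<^bsub>B\<^esub> (x \<otimes>\<^bsub>B\<^esub> ?\<delta> y)"
      by (simp add: i2 i1 d gA dA fg)
  qed
  moreover have it: "(?\<delta> ^^ n) x = f ((\<delta> ^^ n) (g x)) \<and> (\<delta> ^^ n) (g x) \<in> carrier A"
    if "x \<in> carrier B" for n x
    by (induction n) (use that in \<open>auto simp: fg gA gf dA\<close>)
  ultimately have "LND B ?\<delta>"
    unfolding LND_def using ln gA f0 by metis
  moreover obtain x where "x \<in> carrier A" "\<delta> x \<noteq> \<zero>\<^bsub>A\<^esub>"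
    using \<delta> unfolding nonzero_LND_def by auto
  then have "f x \<in> carrier B" "?\<delta> (f x) \<noteq> \<zero>\<^bsub>B\<^esub>" by (auto simp: fB gf f0 dA)
  ultimately show "nonzero_LND B ?\<delta>" unfolding nonzero_LND_def by blast
  have "x \<in> a_kernel B B ?\<delta> \<longleftrightarrow> x \<in> f ` a_kernel A A \<delta>" for x
  proof
    assume "x \<in> a_kernel B B ?\<delta>"
    then have "x \<in> carrier B" "f (\<delta> (g x)) = \<zero>\<^bsub>B\<^esub>" by (auto simp: a_kernel_def')
    then have "g x \<in> a_kernel A A \<delta>" "x = f (g x)" by (auto simp: a_kernel_def' f0 gA dA fg)
    then show "x \<in> f ` a_kernel A A \<delta>" by blast
  next
    assume "x \<in> f ` a_kernel A A \<delta>"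
    then obtain y where "y \<in> carrier A" "\<delta> y = \<zero>\<^bsub>A\<^esub>" "x = f y" by (auto simp: a_kernel_def')
    then show "x \<in> a_kernel B B ?\<delta>" using f0[of "\<delta> y"] dA[of y] by (simp add: a_kernel_def' fB gf)
  qed
  then show "a_kernel B B ?\<delta> = f ` a_kernel A A \<delta>" by blast
qed

lemma rigid_iso:
  assumes "module_iso f A B" shows "rigid A \<longleftrightarrow> rigid B"
  using nonzero_LND_transport(1)[OF assms] nonzero_LND_transport(1)[OF module_iso_sym[OF assms]]
  unfolding rigid_def by blast

lemma semirigid_iso_imp:
  assumes iso: "module_iso f A B" and s: "semirigid B" shows "semirigid A"
  unfolding semirigid_def equivalent_LND_def
proof (intro allI impI)
  fix \<delta> \<delta>' assume "nonzero_LND A \<delta>" "nonzero_LND A \<delta>'"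
  note t = nonzero_LND_transport[OF iso this(1)] nonzero_LND_transport[OF iso this(2)]
  have "f ` a_kernel A A \<delta> = f ` a_kernel A A \<delta>'"
    using s t unfolding semirigid_def equivalent_LND_def by metis
  moreover have "inj_on f (carrier A)" using iso by (simp add: module_iso_def bij_betw_def)
  moreover have "a_kernel A A \<delta> \<subseteq> carrier A" "a_kernel A A \<delta>' \<subseteq> carrier A" by (auto simp: a_kernel_def')
  ultimately show "a_kernel A A \<delta> = a_kernel A A \<delta>'" by (meson inj_on_image_eq_iff)
qed

lemma semirigid_iso:
  assumes "module_iso f A B" shows "semirigid A \<longleftrightarrow> semirigid B"
  using semirigid_iso_imp[OF assms] semirigid_iso_imp[OF module_iso_sym[OF assms]] by blast

section \<open>Subalgebras of commutative rings\<close>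

definition subalg_module :: "('k \<Rightarrow> 'b::comm_ring_1) \<Rightarrow> 'b set \<Rightarrow> ('k, 'b) module" where
  "subalg_module c A = \<lparr>carrier = A, mult = (*), one = 1, zero = 0, add = (+), smult = (\<lambda>k x. c k * x)\<rparr>"

lemma subalg_module_simps [simp]:
  "carrier (subalg_module c A) = A" "mult (subalg_module c A) = (*)" "one (subalg_module c A) = 1"
  "zero (subalg_module c A) = 0" "add (subalg_module c A) = (+)" "smult (subalg_module c A) k x = c k * x"
  by (simp_all add: subalg_module_def)

lemma a_kernel_subalg_module: "a_kernel (subalg_module c A) (subalg_module c A) \<delta> = {x \<in> A. \<delta> x = 0}"
  by (simp add: a_kernel_def')

locale scalar_hom =
  fixes c :: "'k::field_char_0 \<Rightarrow> 'b::comm_ring_1"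
  assumes c_1 [simp]: "c 1 = 1" and c_add: "c (x + y) = c x + c y" and c_mult: "c (x * y) = c x * c y"
begin

lemma c_0 [simp]: "c 0 = 0"
  using c_add[of 0 0] by simp

lemma c_minus: "c (- x) = - c x"
  using c_add[of x "- x"] by (simp add: eq_neg_iff_add_eq_0 add.commute)

lemma c_diff: "c (x - y) = c x - c y"
  using c_add[of x "- y"] by (simp add: c_minus)

lemma c_power: "c (x ^ n) = c x ^ n"
  by (induction n) (auto simp: c_mult)

lemma c_of_nat [simp]: "c (of_nat n) = of_nat n"
  by (induction n) (auto simp: c_add)

lemma c_sum: "c (sum f I) = (\<Sum>i\<in>I. c (f i))"
  by (induction I rule: infinite_finite_induct) (auto simp: c_add)

lemma c_inverse: "x \<noteq> 0 \<Longrightarrow> c x * c (inverse x) = 1"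
  by (simp flip: c_mult)

end

locale subalgebra = scalar_hom c for c :: "'k::field_char_0 \<Rightarrow> 'b::comm_ring_1" +
  fixes A :: "'b set"
  assumes c_mem [simp]: "c k \<in> A" and add_mem: "x \<in> A \<Longrightarrow> y \<in> A \<Longrightarrow> x + y \<in> A"
    and mult_mem: "x \<in> A \<Longrightarrow> y \<in> A \<Longrightarrow> x * y \<in> A"
begin

lemma one_mem [simp]: "1 \<in> A" using c_mem[of 1] by simp
lemma zero_mem [simp]: "0 \<in> A" using c_mem[of 0] by simp
lemma of_nat_mem [simp]: "of_nat n \<in> A" using c_mem[of "of_nat n"] by simp
lemma minus_mem: "x \<in> A \<Longrightarrow> - x \<in> A" using mult_mem[OF c_mem[of "-1"], of x] by (simp add: c_minus)
lemma diff_mem: "x \<in> A \<Longrightarrow> y \<in> A \<Longrightarrow> x - y \<in> A" using add_mem[OF _ minus_mem, of x y] by simp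
lemma power_mem: "x \<in> A \<Longrightarrow> x ^ n \<in> A" by (induction n) (auto intro: mult_mem)
lemma sum_mem: "(\<And>i. i \<in> I \<Longrightarrow> f i \<in> A) \<Longrightarrow> sum f I \<in> A"
  by (induction I rule: infinite_finite_induct) (auto intro: add_mem)
lemma prod_mem: "(\<And>i. i \<in> I \<Longrightarrow> f i \<in> A) \<Longrightarrow> prod f I \<in> A"
  by (induction I rule: infinite_finite_induct) (auto intro: mult_mem)

abbreviation "M \<equiv> subalg_module c A"

lemma derivation_subalg:
  "derivation M \<delta> \<longleftrightarrow> (\<forall>x\<in>A. \<delta> x \<in> A) \<and> (\<forall>x\<in>A. \<forall>y\<in>A. \<delta> (x + y) = \<delta> x + \<delta> y) \<and>
     (\<forall>k. \<forall>x\<in>A. \<delta> (c k * x) = c k * \<delta> x) \<and> (\<forall>x\<in>A. \<forall>y\<in>A. \<delta> (x * y) = \<delta> x * y + x * \<delta> y)"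
  unfolding derivation_def by auto

end

locale subalg_derivation = subalgebra +
  fixes \<delta> assumes der: "derivation (subalg_module c A) \<delta>"
begin

lemma d_mem: "x \<in> A \<Longrightarrow> \<delta> x \<in> A"
  and d_add: "x \<in> A \<Longrightarrow> y \<in> A \<Longrightarrow> \<delta> (x + y) = \<delta> x + \<delta> y"
  and d_scale: "x \<in> A \<Longrightarrow> \<delta> (c k * x) = c k * \<delta> x"
  and d_mult: "x \<in> A \<Longrightarrow> y \<in> A \<Longrightarrow> \<delta> (x * y) = \<delta> x * y + x * \<delta> y"
  using der unfolding derivation_subalg by blast+

lemma d_0 [simp]: "\<delta> 0 = 0" using d_add[of 0 0] by simp
lemma d_1 [simp]: "\<delta> 1 = 0" using d_mult[of 1 1] by simp
lemma d_c [simp]: "\<delta> (c k) = 0" using d_scale[of 1 k] by simp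
lemma d_minus: "x \<in> A \<Longrightarrow> \<delta> (- x) = - \<delta> x" using d_scale[of x "-1"] by (simp add: c_minus)
lemma d_diff: "x \<in> A \<Longrightarrow> y \<in> A \<Longrightarrow> \<delta> (x - y) = \<delta> x - \<delta> y"
  using d_add[OF _ minus_mem, of x y] by (simp add: d_minus)
lemma d_sum: "(\<And>i. i \<in> I \<Longrightarrow> f i \<in> A) \<Longrightarrow> \<delta> (sum f I) = (\<Sum>i\<in>I. \<delta> (f i))"
  by (induction I rule: infinite_finite_induct) (auto simp: d_add sum_mem)
lemma d_power: "x \<in> A \<Longrightarrow> \<delta> (x ^ n) = of_nat n * x ^ (n - 1) * \<delta> x"
proof (induction n)
  case (Suc n)
  then have "\<delta> (x ^ Suc n) = \<delta> x * x ^ n + x * (of_nat n * x ^ (n - 1) * \<delta> x)"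
    by (simp add: d_mult power_mem)
  then show ?case by (cases n) (auto simp: algebra_simps)
qed simp

lemma dn_mem: "x \<in> A \<Longrightarrow> (\<delta> ^^ n) x \<in> A"
  by (induction n) (auto intro: d_mem)
lemma dn_0 [simp]: "(\<delta> ^^ n) 0 = 0"
  by (induction n) auto
lemma dn_add: "x \<in> A \<Longrightarrow> y \<in> A \<Longrightarrow> (\<delta> ^^ n) (x + y) = (\<delta> ^^ n) x + (\<delta> ^^ n) y"
  by (induction n) (auto simp: d_add dn_mem)
lemma dn_zero_mono: "(\<delta> ^^ n) x = 0 \<Longrightarrow> n \<le> m \<Longrightarrow> (\<delta> ^^ m) x = 0"
  by (metis dn_0 funpow_add comp_apply le_iff_add add.commute)

lemma dn_mult:
  assumes "x \<in> A" "y \<in> A"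
  shows "(\<delta> ^^ n) (x * y) = (\<Sum>k\<le>n. of_nat (n choose k) * ((\<delta> ^^ k) x * (\<delta> ^^ (n - k)) y))"
proof (induction n)
  case (Suc n)
  let ?f = "\<lambda>k. of_nat (n choose k) * ((\<delta> ^^ k) x * (\<delta> ^^ (n - k)) y)"
  have "(\<delta> ^^ Suc n) (x * y) = (\<Sum>k\<le>n. \<delta> (?f k))"
    using assms by (simp add: Suc d_sum mult_mem dn_mem)
  also have "\<dots> = (\<Sum>k\<le>n. of_nat (n choose k) * ((\<delta> ^^ Suc k) x * (\<delta> ^^ (n - k)) y) +
                          of_nat (n choose k) * ((\<delta> ^^ k) x * (\<delta> ^^ (Suc n - k)) y))"
  proof (rule sum.cong[OF refl])
    fix k assume "k \<in> {..n}"
    then have "(\<delta> ^^ (Suc n - k)) y = \<delta> ((\<delta> ^^ (n - k)) y)" by (simp add: Suc_diff_le)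
    moreover have "\<delta> (?f k) = of_nat (n choose k) * \<delta> ((\<delta> ^^ k) x * (\<delta> ^^ (n - k)) y)"
      using d_scale[of _ "of_nat (n choose k)"] assms by (simp add: mult_mem dn_mem)
    ultimately show "\<delta> (?f k) = of_nat (n choose k) * ((\<delta> ^^ Suc k) x * (\<delta> ^^ (n - k)) y) +
                          of_nat (n choose k) * ((\<delta> ^^ k) x * (\<delta> ^^ (Suc n - k)) y)"
      using assms by (simp add: d_mult dn_mem algebra_simps)
  qed
  also have "\<dots> = (\<Sum>k\<le>n. of_nat (n choose k) * ((\<delta> ^^ Suc k) x * (\<delta> ^^ (n - k)) y)) +
                  (\<Sum>k\<le>Suc n. of_nat (n choose k) * ((\<delta> ^^ k) x * (\<delta> ^^ (Suc n - k)) y))"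
    by (simp add: sum.distrib binomial_eq_0)
  also have "(\<Sum>k\<le>n. of_nat (n choose k) * ((\<delta> ^^ Suc k) x * (\<delta> ^^ (n - k)) y)) =
      (\<Sum>k\<le>Suc n. if k = 0 then 0 else of_nat (n choose (k - 1)) * ((\<delta> ^^ k) x * (\<delta> ^^ (Suc n - k)) y))"
    by (subst sum.atMost_Suc_shift) simp
  also have "\<dots> + (\<Sum>k\<le>Suc n. of_nat (n choose k) * ((\<delta> ^^ k) x * (\<delta> ^^ (Suc n - k)) y)) =
      (\<Sum>k\<le>Suc n. of_nat (Suc n choose k) * ((\<delta> ^^ k) x * (\<delta> ^^ (Suc n - k)) y))"
    unfolding sum.distrib[symmetric]
    by (intro sum.cong[OF refl]) (auto simp: algebra_simps choose_reduce_nat)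
  finally show ?case .
qed simp

lemma dn_mult_zero:
  assumes "x \<in> A" "y \<in> A" "(\<delta> ^^ Suc a) x = 0" "(\<delta> ^^ Suc b) y = 0"
  shows "(\<delta> ^^ (a + b)) (x * y) = of_nat ((a + b) choose a) * ((\<delta> ^^ a) x * (\<delta> ^^ b) y)"
    and "(\<delta> ^^ Suc (a + b)) (x * y) = 0"
proof -
  have z: "(\<delta> ^^ k) x * (\<delta> ^^ (n - k)) y = 0" if "k \<noteq> a \<or> n \<noteq> a + b" "n \<ge> a + b" for k n
  proof (cases "k > a")
    case True
    then show ?thesis using dn_zero_mono[OF assms(3), of k] by simp
  next
    case False
    then have "Suc b \<le> n - k" using that by linarith
    then show ?thesis using dn_zero_mono[OF assms(4), of "n - k"] by simp
  qed
  have "(\<delta> ^^ (a + b)) (x * y) = (\<Sum>k\<le>a + b. if k = a then of_nat ((a + b) choose a) * ((\<delta> ^^ a) x * (\<delta> ^^ b) y) else 0)"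
    unfolding dn_mult[OF assms(1,2)] by (rule sum.cong) (auto simp: z)
  then show "(\<delta> ^^ (a + b)) (x * y) = of_nat ((a + b) choose a) * ((\<delta> ^^ a) x * (\<delta> ^^ b) y)" by simp
  show "(\<delta> ^^ Suc (a + b)) (x * y) = 0"
    unfolding dn_mult[OF assms(1,2)] by (intro sum.neutral) (auto simp: z)
qed

definition nil_set where "nil_set = {x \<in> A. \<exists>n. (\<delta> ^^ n) x = 0}"

lemma nil_set_subalgebra: "subalgebra c nil_set"
proof
  fix x y assume "x \<in> nil_set" "y \<in> nil_set"
  then obtain a b where ab: "x \<in> A" "y \<in> A" "(\<delta> ^^ a) x = 0" "(\<delta> ^^ b) y = 0" by (auto simp: nil_set_def)
  then have "(\<delta> ^^ max a b) (x + y) = 0"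
    using dn_zero_mono[of a x "max a b"] dn_zero_mono[of b y "max a b"] by (simp add: dn_add)
  then show "x + y \<in> nil_set" using ab by (auto simp: nil_set_def add_mem)
  have "(\<delta> ^^ Suc (a + b)) (x * y) = 0"
    using dn_mult_zero(2)[of x y a b] ab by simp
  then have "\<exists>n. (\<delta> ^^ n) (x * y) = 0" by blast
  then show "x * y \<in> nil_set" using ab unfolding nil_set_def by (simp add: mult_mem)
next
  fix k
  have "(\<delta> ^^ 1) (c k) = 0" by simp
  then show "c k \<in> nil_set" unfolding nil_set_def using c_mem by blast
qed

lemma LND_iff_nil_set: "LND M \<delta> \<longleftrightarrow> A \<subseteq> nil_set"
proof
  assume "A \<subseteq> nil_set"
  have "\<exists>n>0. (\<delta> ^^ n) f = 0" if "f \<in> A" for f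
  proof -
    have "f \<in> nil_set" using \<open>A \<subseteq> nil_set\<close> that by blast
    then obtain n where "(\<delta> ^^ n) f = 0" unfolding nil_set_def by blast
    then have "(\<delta> ^^ Suc n) f = 0" by simp
    then show ?thesis by blast
  qed
  then show "LND M \<delta>" unfolding LND_def using der by simp
qed (auto simp: LND_def nil_set_def)

end

section \<open>Locally nilpotent derivations of domains\<close>

locale subalg_LND = subalg_derivation c A \<delta> for c :: "'k::field_char_0 \<Rightarrow> 'b::idom" and A \<delta> +
  assumes lnd: "LND (subalg_module c A) \<delta>"
begin

lemma c_eq_0_iff [simp]: "c x = 0 \<longleftrightarrow> x = 0"
  using c_inverse[of x] by (metis c_0 mult_zero_left zero_neq_one)

lemma of_nat_eq_0_b [simp]: "(of_nat n :: 'b) = 0 \<longleftrightarrow> n = 0"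
  using c_eq_0_iff[of "of_nat n"] by simp

definition dg where "dg x = (LEAST n. (\<delta> ^^ Suc n) x = 0)"

abbreviation "Ker \<equiv> {x \<in> A. \<delta> x = 0}"

lemma dg_zero: "x \<in> A \<Longrightarrow> (\<delta> ^^ Suc (dg x)) x = 0"
proof -
  assume "x \<in> A"
  then obtain n where "n > 0" "(\<delta> ^^ n) x = 0" using lnd unfolding LND_def by auto
  then have "(\<delta> ^^ Suc (n - 1)) x = 0" by simp
  then show ?thesis unfolding dg_def by (rule LeastI)
qed

lemma dg_nonzero:
  assumes "x \<noteq> 0" shows "(\<delta> ^^ dg x) x \<noteq> 0"
proof (cases "dg x")
  case (Suc n)
  then show ?thesis
    using not_less_Least[of n "\<lambda>n. (\<delta> ^^ Suc n) x = 0"] by (simp add: dg_def[symmetric] del: funpow.simps)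
qed (use assms in simp)

lemma dg_eqI: "x \<in> A \<Longrightarrow> (\<delta> ^^ n) x \<noteq> 0 \<Longrightarrow> (\<delta> ^^ Suc n) x = 0 \<Longrightarrow> dg x = n"
  unfolding dg_def
  by (rule Least_equality) (use dn_zero_mono in \<open>metis not_less_eq_eq\<close>)+

lemma dg_mult: "x \<in> A \<Longrightarrow> y \<in> A \<Longrightarrow> x \<noteq> 0 \<Longrightarrow> y \<noteq> 0 \<Longrightarrow> dg (x * y) = dg x + dg y"
  using dn_mult_zero[of x y "dg x" "dg y"] dg_zero dg_nonzero
  by (intro dg_eqI) (auto simp del: funpow.simps simp: mult_mem)

lemma dg_1 [simp]: "dg 1 = 0" by (rule dg_eqI) auto

lemma dg_power: "x \<in> A \<Longrightarrow> x \<noteq> 0 \<Longrightarrow> dg (x ^ n) = n * dg x"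
  by (induction n) (auto simp: dg_mult power_mem)

lemma dg_d: "x \<in> A \<Longrightarrow> \<delta> x \<noteq> 0 \<Longrightarrow> dg x = Suc (dg (\<delta> x))"
  using dg_zero[OF d_mem] dg_nonzero[of "\<delta> x"]
  by (intro dg_eqI) (auto simp: funpow_Suc_right simp del: funpow.simps)

lemma dg_eq_0_iff: "x \<in> A \<Longrightarrow> dg x = 0 \<longleftrightarrow> \<delta> x = 0"
  using dg_d[of x] dg_zero[of x] by (cases "\<delta> x = 0") (auto intro!: dg_eqI simp: dg_def)

lemma Ker_factorial:
  assumes "x \<in> A" "y \<in> A" "x * y \<noteq> 0" "\<delta> (x * y) = 0"
  shows "\<delta> x = 0" "\<delta> y = 0"
proof -
  have "dg x + dg y = 0" using assms dg_mult[of x y] dg_eq_0_iff[OF mult_mem[OF assms(1,2)]] by auto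
  then show "\<delta> x = 0" "\<delta> y = 0" using assms by (auto simp: dg_eq_0_iff)
qed

lemma Ker_power:
  assumes "x \<in> A" "n > 0" "\<delta> (x ^ n) = 0" shows "\<delta> x = 0"
proof (cases "x = 0")
  case False
  obtain m where "n = Suc m" using assms(2) gr0_implies_Suc by blast
  then show ?thesis using Ker_factorial(1)[of x "x ^ m"] power_mem[OF assms(1), of m] assms False by simp
qed simp

lemma Ker_prod:
  assumes "finite I" "\<And>i. i \<in> I \<Longrightarrow> f i \<in> A" "prod f I \<noteq> 0" "\<delta> (prod f I) = 0" "i \<in> I"
  shows "\<delta> (f i) = 0"
proof -
  have "prod f I = f i * prod f (I - {i})" using assms by (simp add: prod.remove)
  then show ?thesis using Ker_factorial(1)[of "f i" "prod f (I - {i})"] assms by (auto intro: prod_mem)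
qed

lemma dvd_imp_Ker:
  assumes "x \<in> A" "y \<in> A" "\<delta> x = x * y" shows "\<delta> x = 0"
proof (rule ccontr)
  assume "\<delta> x \<noteq> 0"
  then have "dg x = Suc (dg x + dg y)" using assms dg_d[of x] dg_mult[of x y] by auto
  then show False by simp
qed

lemma Ker_subalgebra: "subalgebra c Ker"
  by unfold_locales (auto simp: add_mem mult_mem d_add d_mult)

lemma obtains_slice:
  assumes "x \<in> A" "\<delta> x \<noteq> 0"
  obtains s where "s \<in> A" "\<delta> s \<noteq> 0" "\<delta> (\<delta> s) = 0"
proof -
  obtain m where m: "dg x = Suc m" using dg_d[OF assms] by blast
  then have "(\<delta> ^^ Suc m) x \<noteq> 0" "(\<delta> ^^ Suc (Suc m)) x = 0"
    using dg_zero[of x] dg_nonzero[of x] assms d_0 by metis+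
  then show ?thesis using that[of "(\<delta> ^^ m) x"] dn_mem[OF assms(1)] by simp
qed

lemma dn_Ker_mult: "x \<in> A \<Longrightarrow> k \<in> Ker \<Longrightarrow> (\<delta> ^^ n) (k * x) = k * (\<delta> ^^ n) x"
  by (induction n) (auto simp: d_mult dn_mem)

lemma dn_slice_power:
  assumes "s \<in> A" "\<delta> (\<delta> s) = 0" 
  shows "(\<delta> ^^ n) (s ^ n) = of_nat (fact n) * \<delta> s ^ n \<and> (\<delta> ^^ Suc n) (s ^ n) = 0"
proof (induction n)
  case (Suc n)
  have "(\<delta> ^^ Suc 1) s = 0" "(\<delta> ^^ 1) s = \<delta> s" using assms by auto
  then show ?case using dn_mult_zero[of s "s ^ n" 1 n] Suc assms
    by (simp add: power_mem algebra_simps del: funpow.simps)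
qed simp

text \<open>A derivation killing the kernel and a local slice \<open>s\<close> vanishes: by induction on the degree,
  subtracting from a multiple of \<open>x\<close> the right multiple of a power of \<open>s\<close>.\<close>

lemma derivation_zeroI:
  assumes D: "derivation M D" and K: "\<And>x. x \<in> Ker \<Longrightarrow> D x = 0"
    and s: "s \<in> A" "\<delta> s \<noteq> 0" "\<delta> (\<delta> s) = 0" "D s = 0" and x: "x \<in> A"
  shows "D x = 0"
  using x
proof (induction "dg x" arbitrary: x rule: less_induct)
  case less
  interpret D: subalg_derivation c A D by unfold_locales (rule D)
  show ?case
  proof (cases "\<delta> x = 0")
    case True then show ?thesis using K less by simp
  next
    case False
    define m where "m = dg x"
    define a where "a = (\<delta> ^^ m) x"
    have a: "a \<in> Ker" using dg_zero[OF less(2)] less by (simp add: a_def m_def dn_mem)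
    define k where "k = of_nat (fact m) * \<delta> s ^ m"
    have k: "k \<in> Ker" unfolding k_def
      using subalgebra.mult_mem[OF Ker_subalgebra] subalgebra.power_mem[OF Ker_subalgebra, of "\<delta> s"]
        subalgebra.of_nat_mem[OF Ker_subalgebra] s(1,3) d_mem by blast
    define y where "y = k * x - a * s ^ m"
    have y: "y \<in> A" using k a less s by (auto simp: y_def intro!: diff_mem mult_mem power_mem)
    have "(\<delta> ^^ m) y = (\<delta> ^^ m) (k * x) - (\<delta> ^^ m) (a * s ^ m)"
      using dn_add[of "k * x" "(- a) * s ^ m" m] dn_Ker_mult[of "s ^ m" "- a" m] dn_Ker_mult[of "s ^ m" a m]
        a k less s
      by (auto simp: y_def mult_mem minus_mem power_mem d_minus)
    also have "\<dots> = 0"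
      using dn_Ker_mult[of x k m] dn_Ker_mult[of "s ^ m" a m] dn_slice_power[of s m] a k s less
      by (simp add: k_def a_def power_mem del: funpow.simps)
    finally have y0: "(\<delta> ^^ m) y = 0" .
    have "m > 0" using False less by (metis dg_eq_0_iff gr0I m_def)
    have "y = 0 \<or> dg y < m" using y0 dg_nonzero[of y] dn_zero_mono[of m y "dg y"] by force
    then have "D y = 0" using less(1)[of y] y by (auto simp: m_def)
    moreover have "D y = k * D x"
      using a k s less K[OF a] K[OF k] by (simp add: y_def D.d_diff D.d_mult D.d_power mult_mem power_mem)
    ultimately show ?thesis using s by (simp add: k_def)
  qed
qed

lemma derivation_wronskian:
  assumes E: "derivation M E" and K: "\<And>x. x \<in> Ker \<Longrightarrow> E x = 0" and xy: "x \<in> A" "y \<in> A"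
  shows "E x * \<delta> y = E y * \<delta> x"
proof (cases "\<delta> x = 0 \<and> \<delta> y = 0")
  case False
  then obtain s where s: "s \<in> A" "\<delta> s \<noteq> 0" "\<delta> (\<delta> s) = 0" using obtains_slice xy by metis
  interpret E: subalg_derivation c A E by unfold_locales (rule E)
  define D where "D = (\<lambda>x. \<delta> s * E x - E s * \<delta> x)"
  have "derivation M D"
    unfolding derivation_subalg D_def
    by (auto simp: diff_mem mult_mem d_mem E.d_mem d_add E.d_add d_mult E.d_mult d_scale E.d_scale s algebra_simps)
  then have "D x = 0" "D y = 0"
    using derivation_zeroI[of D s] s K xy by (auto simp: D_def)
  then have *: "\<delta> s * E x = E s * \<delta> x" "\<delta> s * E y = E s * \<delta> y" by (simp_all add: D_def)
  have "\<delta> s * (E x * \<delta> y) = (\<delta> s * E x) * \<delta> y" "\<delta> s * (E y * \<delta> x) = (\<delta> s * E y) * \<delta> x"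
    by (simp_all only: ac_simps)
  then have "\<delta> s * (E x * \<delta> y) = \<delta> s * (E y * \<delta> x)" unfolding * by (simp only: ac_simps)
  then show ?thesis using s by simp
qed simp

text \<open>An elementary case of the Mason--Stothers inequality for the degree function \<open>dg\<close>.\<close>

lemma dg_two_term_bound:
  assumes pq: "p \<in> A" "q \<in> A" "\<delta> p \<noteq> 0" "\<delta> q \<noteq> 0" and K: "a \<in> Ker" "b \<in> Ker" "w \<in> Ker"
    and nz: "b \<noteq> 0" "w \<noteq> 0" and w: "a * p ^ Suc \<alpha> + b * q ^ Suc \<beta> = w"
  shows "\<beta> * dg q < dg p"
proof -
  have "\<delta> w = 0" using K by simp
  then have 0: "a * (of_nat (Suc \<alpha>) * p ^ \<alpha> * \<delta> p) + b * (of_nat (Suc \<beta>) * q ^ \<beta> * \<delta> q) = 0"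
    using K pq d_power[of p "Suc \<alpha>"] d_power[of q "Suc \<beta>"] unfolding w[symmetric]
    by (simp add: d_add d_mult mult_mem power_mem del: power_Suc of_nat_Suc)
  let ?z = "b * (of_nat (Suc \<alpha>) * q * \<delta> p - of_nat (Suc \<beta>) * p * \<delta> q)"
  have "of_nat (Suc \<alpha>) * w * \<delta> p = of_nat (Suc \<alpha>) * (a * p ^ Suc \<alpha> + b * q ^ Suc \<beta>) * \<delta> p
      - p * (a * (of_nat (Suc \<alpha>) * p ^ \<alpha> * \<delta> p) + b * (of_nat (Suc \<beta>) * q ^ \<beta> * \<delta> q))"
    unfolding 0 w by simp
  also have "\<dots> = q ^ \<beta> * ?z" by (simp add: algebra_simps)
  finally have eq: "of_nat (Suc \<alpha>) * w * \<delta> p = q ^ \<beta> * ?z" .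
  have ne: "of_nat (Suc \<alpha>) * w * \<delta> p \<noteq> 0" using nz pq of_nat_eq_0_b[of "Suc \<alpha>"] by (simp del: of_nat_Suc)
  have z: "?z \<in> A" using pq K by (intro mult_mem diff_mem d_mem of_nat_mem) simp_all
  have "dg (of_nat (Suc \<alpha>) * w * \<delta> p) = dg (\<delta> p)"
  proof -
    have "of_nat (Suc \<alpha>) * w \<in> Ker" using K d_scale[of w "of_nat (Suc \<alpha>)"] by (auto simp: mult_mem simp del: of_nat_Suc)
    then show ?thesis using ne dg_mult[of "of_nat (Suc \<alpha>) * w" "\<delta> p"] pq dg_eq_0_iff d_mem
      by (auto simp del: of_nat_Suc)
  qed
  moreover have "dg (q ^ \<beta> * ?z) = \<beta> * dg q + dg ?z"
    using ne z dg_mult[of "q ^ \<beta>" ?z] dg_power[of q \<beta>] pq unfolding eq by (auto simp: power_mem)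
  ultimately have "\<beta> * dg q \<le> dg (\<delta> p)" using eq by simp
  then show ?thesis using dg_d[of p] pq by simp
qed

lemma two_term_exponent:
  assumes pq: "p \<in> A" "q \<in> A" "\<delta> p \<noteq> 0" "\<delta> q \<noteq> 0" and K: "a \<in> Ker" "b \<in> Ker" "w \<in> Ker"
    and nz: "a \<noteq> 0" "b \<noteq> 0" "w \<noteq> 0" and w: "a * p ^ \<alpha> + b * q ^ \<beta> = w"
  shows "\<alpha> \<le> 1 \<or> \<beta> \<le> 1"
proof (rule ccontr)
  assume "\<not> ?thesis"
  then obtain \<alpha>' \<beta>' where ab: "\<alpha> = Suc (Suc \<alpha>')" "\<beta> = Suc (Suc \<beta>')"
    by (metis Suc_le_mono le0 not_less_eq_eq One_nat_def old.nat.exhaust)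
  have "Suc \<beta>' * dg q < dg p" using dg_two_term_bound[of p q a b w "Suc \<alpha>'" "Suc \<beta>'"] assms ab by simp
  moreover have "Suc \<alpha>' * dg p < dg q"
    using dg_two_term_bound[of q p b a w "Suc \<beta>'" "Suc \<alpha>'"] assms ab by (simp add: add.commute)
  ultimately show False by auto
qed

end

section \<open>Evaluation of polynomials\<close>

abbreviation keys :: "('a \<Rightarrow>\<^sub>0 'b::zero) \<Rightarrow> 'a set" where
  "keys \<equiv> Poly_Mapping.keys"

abbreviation single :: "'a \<Rightarrow> 'b::zero \<Rightarrow> 'a \<Rightarrow>\<^sub>0 'b" where
  "single \<equiv> Poly_Mapping.single"

abbreviation lookup :: "('a \<Rightarrow>\<^sub>0 'b::zero) \<Rightarrow> 'a \<Rightarrow> 'b" where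
  "lookup \<equiv> Poly_Mapping.lookup"

definition mon :: "('v \<Rightarrow> 'b) \<Rightarrow> ('v \<Rightarrow>\<^sub>0 nat) \<Rightarrow> 'b::comm_ring_1" where
  "mon g m = (\<Prod>v\<in>keys m. g v ^ lookup m v)"

definition meval :: "('k::comm_ring_1 \<Rightarrow> 'b::comm_ring_1) \<Rightarrow> ('v \<Rightarrow> 'b) \<Rightarrow> ('v, 'k) mpoly \<Rightarrow> 'b" where
  "meval c g p = (\<Sum>m\<in>keys p. c (lookup p m) * mon g m)"

lemma mon_superset:
  "finite W \<Longrightarrow> keys m \<subseteq> W \<Longrightarrow> mon g m = (\<Prod>v\<in>W. g v ^ lookup m v)"
  unfolding mon_def by (rule prod.mono_neutral_left) (auto simp: in_keys_iff)

lemma mon_0 [simp]: "mon g 0 = 1"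
  by (simp add: mon_def)

lemma mon_add: "mon g (m + m') = mon g m * mon g m'"
proof -
  let ?S = "keys m \<union> keys m'"
  have "mon g (m + m') = (\<Prod>v\<in>?S. g v ^ lookup (m + m') v)"
    by (rule mon_superset) (auto simp: keys_add)
  moreover have "mon g m = (\<Prod>v\<in>?S. g v ^ lookup m v)" "mon g m' = (\<Prod>v\<in>?S. g v ^ lookup m' v)"
    by (rule mon_superset; auto)+
  ultimately show ?thesis by (simp add: lookup_add power_add prod.distrib)
qed

lemma mon_single: "mon g (single v n) = g v ^ n"
  by (cases "n = 0") (auto simp: mon_def)

lemma mon_sum: "mon g (sum f I) = (\<Prod>i\<in>I. mon g (f i))"
  by (induction I rule: infinite_finite_induct) (auto simp: mon_add)

lemma mon_mult: "mon (\<lambda>v. g v * h v) m = mon g m * mon h m"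
  by (simp add: mon_def power_mult_distrib prod.distrib)

lemma poly_mapping_sum_single: "p = (\<Sum>m\<in>keys p. single m (lookup p m))"
proof (rule poly_mapping_eqI)
  fix k
  have "lookup (\<Sum>m\<in>keys p. single m (lookup p m)) k =
    (\<Sum>m\<in>keys p. if m = k then lookup p k else 0)"
    unfolding lookup_sum by (rule sum.cong) (auto simp: lookup_single)
  then show "lookup p k = lookup (\<Sum>m\<in>keys p. single m (lookup p m)) k"
    by (auto simp: in_keys_iff)
qed

lemma keys_nat_add: "keys (m + m' :: 'v \<Rightarrow>\<^sub>0 nat) = keys m \<union> keys m'"
  by (auto simp: in_keys_iff lookup_add)

interpretation Const: scalar_hom "Const :: 'k::field_char_0 \<Rightarrow> ('v, 'k) mpoly"
  by unfold_locales (auto simp: Const_def single_add mult_single)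

context scalar_hom
begin

lemma meval_superset:
  "finite W \<Longrightarrow> keys p \<subseteq> W \<Longrightarrow> meval c g p = (\<Sum>m\<in>W. c (lookup p m) * mon g m)"
  unfolding meval_def by (rule sum.mono_neutral_left) (auto simp: in_keys_iff)

lemma meval_0 [simp]: "meval c g 0 = 0"
  by (simp add: meval_def)

lemma meval_add: "meval c g (p + q) = meval c g p + meval c g q"
proof -
  let ?S = "keys p \<union> keys q"
  have "meval c g (p + q) = (\<Sum>m\<in>?S. c (lookup (p + q) m) * mon g m)"
    by (rule meval_superset) (auto simp: keys_add)
  moreover have "meval c g p = (\<Sum>m\<in>?S. c (lookup p m) * mon g m)" "meval c g q = (\<Sum>m\<in>?S. c (lookup q m) * mon g m)"
    by (rule meval_superset; auto)+
  ultimately show ?thesis by (simp add: lookup_add c_add algebra_simps sum.distrib)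
qed

lemma meval_sum: "meval c g (sum f I) = (\<Sum>i\<in>I. meval c g (f i))"
  by (induction I rule: infinite_finite_induct) (auto simp: meval_add)

lemma meval_single: "meval c g (single m k) = c k * mon g m"
  by (cases "k = 0") (auto simp: meval_def)

lemma meval_Const [simp]: "meval c g (Const k) = c k"
  by (simp add: Const_def meval_single)

lemma meval_Var [simp]: "meval c g (Var v) = g v"
  by (simp add: Var_def meval_single mon_single)

lemma meval_mult: "meval c g (p * q) = meval c g p * meval c g q"
proof -
  have "p * q = (\<Sum>m\<in>keys p. \<Sum>m'\<in>keys q.
      single (m + m') (lookup p m * lookup q m'))"
    using arg_cong2[OF poly_mapping_sum_single[of p] poly_mapping_sum_single[of q], of "(*)"]
    by (simp add: sum_product mult_single)
  then have "meval c g (p * q) = (\<Sum>m\<in>keys p. \<Sum>m'\<in>keys q.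
      (c (lookup p m) * mon g m) * (c (lookup q m') * mon g m'))"
    by (simp add: meval_sum meval_single mon_add c_mult ac_simps)
  then show ?thesis by (simp add: meval_def sum_product)
qed

lemma meval_1 [simp]: "meval c g 1 = 1"
  using meval_Const[of g 1] by simp

lemma meval_minus: "meval c g (- p) = - meval c g p"
  using meval_add[of g p "- p"] by (simp add: eq_neg_iff_add_eq_0 add.commute)

lemma meval_diff: "meval c g (p - q) = meval c g p - meval c g q"
  using meval_add[of g p "- q"] by (simp add: meval_minus)

lemma meval_power: "meval c g (p ^ n) = meval c g p ^ n"
  by (induction n) (auto simp: meval_mult)

lemma meval_prod: "meval c g (prod f I) = (\<Prod>i\<in>I. meval c g (f i))"
  by (induction I rule: infinite_finite_induct) (auto simp: meval_mult)

end

abbreviation "PV V \<equiv> carrier (polynomial_ring V)"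

lemma PV_iff: "p \<in> PV V \<longleftrightarrow> (\<forall>m\<in>keys p. keys m \<subseteq> V)"
  by (simp add: polynomial_ring_def)

lemma polynomial_ring_simps [simp]:
  "mult (polynomial_ring V) = (*)" "one (polynomial_ring V) = 1" "zero (polynomial_ring V) = 0"
  "add (polynomial_ring V) = (+)"
  by (simp_all add: polynomial_ring_def)

lemma single_PV: "keys m \<subseteq> V \<Longrightarrow> single m k \<in> PV V"
  by (simp add: PV_iff)

lemma Const_PV [simp]: "Const k \<in> PV V"
  by (simp add: Const_def single_PV)

lemma Var_PV [simp]: "v \<in> V \<Longrightarrow> Var v \<in> PV V"
  by (simp add: Var_def single_PV)

interpretation PV: subalgebra "Const :: 'k::field_char_0 \<Rightarrow> ('v, 'k) mpoly" "PV V"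
proof
  fix p q :: "('v, 'k) mpoly" assume pq: "p \<in> PV V" "q \<in> PV V"
  then show "p + q \<in> PV V" using keys_add[of p q] by (auto simp: PV_iff)
  show "p * q \<in> PV V"
    unfolding PV_iff
  proof
    fix m assume "m \<in> keys (p * q)"
    then obtain m1 m2 where "m = m1 + m2" "m1 \<in> keys p" "m2 \<in> keys q"
      using keys_mult[of p q] by blast
    then show "keys m \<subseteq> V" using pq by (auto simp: PV_iff keys_nat_add)
  qed
qed simp

lemma cring_polynomial_ring: "cring (polynomial_ring V :: ('v, 'k::field_char_0) mpoly ring)"
proof (rule cringI)
  show "abelian_group (polynomial_ring V :: ('v, 'k) mpoly ring)"
  proof (rule abelian_groupI)
    fix x :: "('v, 'k) mpoly" assume "x \<in> PV V"
    then show "\<exists>y\<in>PV V. y \<oplus>\<^bsub>polynomial_ring V\<^esub> x = \<zero>\<^bsub>polynomial_ring V\<^esub>"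
      by (intro bexI[of _ "- x"]) (auto simp: PV.minus_mem)
  qed (auto simp: PV.add_mem algebra_simps)
  show "comm_monoid (polynomial_ring V :: ('v, 'k) mpoly ring)"
    by (rule comm_monoidI) (auto simp: PV.mult_mem algebra_simps)
qed (auto simp: algebra_simps)

lemma single_eq_Const_mult: "single m k = Const k * single m 1"
  by (simp add: Const_def mult_single)

lemma Var_power: "(Var v :: ('v, 'k::comm_ring_1) mpoly) ^ n = single (single v n) 1"
  by (induction n) (auto simp: Var_def mult_single single_add[symmetric])

lemma single_sum_1: "single (sum f I) (1::'k::comm_ring_1) = (\<Prod>i\<in>I. single (f i) 1)"
proof (induction I rule: infinite_finite_induct)
  case (insert x F)
  have "single (f x + sum f F) (1::'k) = single (f x) 1 * single (sum f F) 1"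
    by (simp add: mult_single)
  then show ?case using insert by simp
qed auto

lemma single_1_eq_prod: "single m 1 = (\<Prod>v\<in>keys m. Var v ^ lookup m v :: ('v, 'k::comm_ring_1) mpoly)"
  by (subst poly_mapping_sum_single[of m]) (simp add: single_sum_1 Var_power)

lemma PV_induct [consumes 1, case_names Const Var add mult]:
  fixes p :: "('v, 'k::field_char_0) mpoly"
  assumes p: "p \<in> PV V" and Q: "\<And>k. Q (Const k)" "\<And>v. v \<in> V \<Longrightarrow> Q (Var v)"
    "\<And>p q. p \<in> PV V \<Longrightarrow> q \<in> PV V \<Longrightarrow> Q p \<Longrightarrow> Q q \<Longrightarrow> Q (p + q)"
    "\<And>p q. p \<in> PV V \<Longrightarrow> q \<in> PV V \<Longrightarrow> Q p \<Longrightarrow> Q q \<Longrightarrow> Q (p * q)"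
  shows "Q p"
proof -
  interpret B: subalgebra "Const :: 'k \<Rightarrow> ('v, 'k) mpoly" "{p \<in> PV V. Q p}"
    by unfold_locales (auto intro: Q PV.add_mem PV.mult_mem)
  have "p \<in> {p \<in> PV V. Q p}"
  proof (subst poly_mapping_sum_single[of p], rule B.sum_mem)
    fix m assume "m \<in> keys p"
    then have "keys m \<subseteq> V" using p by (simp add: PV_iff)
    then have "Var v \<in> {p \<in> PV V. Q p}" if "v \<in> keys m" for v
      using that Q(2) Var_PV[of v V] by blast
    then show "single m (lookup p m) \<in> {p \<in> PV V. Q p}"
      unfolding single_eq_Const_mult[of _ "lookup p m"] single_1_eq_prod
      by (intro B.mult_mem B.c_mem B.prod_mem B.power_mem)
  qed
  then show ?thesis by simp
qed

locale polynomial_image = scalar_hom c for c :: "'k::field_char_0 \<Rightarrow> 'b::comm_ring_1" +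
  fixes V :: "'v set" and g :: "'v \<Rightarrow> 'b"
begin

abbreviation "\<phi> \<equiv> meval c g"
abbreviation "A \<equiv> meval c g ` PV V"

sublocale A: subalgebra c A
proof
  fix x y assume "x \<in> A" "y \<in> A"
  then obtain p q where "p \<in> PV V" "q \<in> PV V" "x = \<phi> p" "y = \<phi> q" by blast
  then show "x + y \<in> A" "x * y \<in> A"
    using PV.add_mem[of p V q] PV.mult_mem[of p V q] meval_add[of g p q] meval_mult[of g p q] by (metis image_eqI)+
next
  fix k show "c k \<in> A" using meval_Const[of g k] Const_PV[of k V] by (metis image_eqI)
qed

lemma g_mem: "v \<in> V \<Longrightarrow> g v \<in> A"
  using meval_Var[of g v] Var_PV[of v V] by (metis image_eqI)

lemma A_least:
  assumes "subalgebra c B" "\<And>v. v \<in> V \<Longrightarrow> g v \<in> B" shows "A \<subseteq> B"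
proof -
  interpret B: subalgebra c B by fact
  have "\<phi> p \<in> B" if "p \<in> PV V" for p
    using that by (induction rule: PV_induct) (auto simp: assms meval_add meval_mult B.add_mem B.mult_mem)
  then show ?thesis by blast
qed

lemma LND_generators:
  assumes "derivation (subalg_module c A) \<delta>" "\<And>v. v \<in> V \<Longrightarrow> \<exists>n. (\<delta> ^^ n) (g v) = 0"
  shows "LND (subalg_module c A) \<delta>"
proof -
  interpret d: subalg_derivation c A \<delta> by unfold_locales fact
  show ?thesis unfolding d.LND_iff_nil_set
    by (rule A_least[OF d.nil_set_subalgebra]) (use assms g_mem in \<open>auto simp: d.nil_set_def\<close>)
qed

lemma derivation_eq_0:
  assumes "derivation (subalg_module c A) \<delta>" "\<And>v. v \<in> V \<Longrightarrow> \<delta> (g v) = 0" "x \<in> A"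
  shows "\<delta> x = 0"
proof -
  interpret d: subalg_derivation c A \<delta> by unfold_locales fact
  have "subalgebra c {x \<in> A. \<delta> x = 0}"
    by unfold_locales (auto simp: A.add_mem A.mult_mem d.d_add d.d_mult)
  then show ?thesis using A_least[of "{x \<in> A. \<delta> x = 0}"] assms g_mem by blast
qed

end

section \<open>Models of trinomial algebras\<close>

locale trinomial_data =
  fixes r :: nat and n :: "nat \<Rightarrow> nat" and l :: "nat \<Rightarrow> nat \<Rightarrow> nat" and a :: "nat \<Rightarrow> 'k::field_char_0 ^ 2"
  assumes r2: "r \<ge> 2" and n1: "\<And>i. i \<le> r \<Longrightarrow> n i \<ge> 1"
    and l1: "\<And>i j. i \<le> r \<Longrightarrow> 1 \<le> j \<Longrightarrow> j \<le> n i \<Longrightarrow> l i j \<ge> 1"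
    and dt_ne: "\<And>i j. i \<le> r \<Longrightarrow> j \<le> r \<Longrightarrow> i \<noteq> j \<Longrightarrow> a i $ 1 * a j $ 2 - a j $ 1 * a i $ 2 \<noteq> 0"
begin

definition dt where "dt i j = a i $ 1 * a j $ 2 - a j $ 1 * a i $ 2"

lemma dt_nz: "i \<le> r \<Longrightarrow> j \<le> r \<Longrightarrow> i \<noteq> j \<Longrightarrow> dt i j \<noteq> 0"
  using dt_ne by (simp add: dt_def)

abbreviation Y :: "nat \<Rightarrow> (generator, 'k) mpoly" where "Y \<equiv> T_monomial n l"

definition lmono :: "nat \<Rightarrow> generator \<Rightarrow>\<^sub>0 nat" where
  "lmono i = (\<Sum>j = 1..n i. single (T i j) (l i j))"

lemma lookup_lmono: "lookup (lmono i) (T i' j) = (if i = i' \<and> 1 \<le> j \<and> j \<le> n i then l i j else 0)"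
proof -
  have "lookup (lmono i) (T i' j) = (\<Sum>j' = 1..n i. if j' = j then (if i = i' then l i j else 0) else 0)"
    unfolding lmono_def lookup_sum by (rule sum.cong) (auto simp: lookup_single when_def)
  then show ?thesis by auto
qed

lemma lookup_lmono_S: "lookup (lmono i) (S k) = 0"
  unfolding lmono_def lookup_sum by (auto simp: lookup_single when_def)

lemma Y_eq_single: "Y i = single (lmono i) 1"
  by (simp add: T_monomial_def lmono_def single_sum_1 Var_power)

lemma trinomial_eq: "trinomial n l a i =
    Const (dt (i + 1) (i + 2)) * Y i - Const (dt i (i + 2)) * Y (i + 1) + Const (dt i (i + 1)) * Y (i + 2)"
  unfolding trinomial_def det_3 dt_def
  by (simp add: vector_3 Const.c_diff Const.c_mult algebra_simps)

abbreviation "gens \<equiv> \<lambda>d. generators r d n"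

lemma gens_T: "T i j \<in> gens d \<longleftrightarrow> i \<le> r \<and> 1 \<le> j \<and> j \<le> n i"
  by (auto simp: generators_def)

lemma gens_S: "S k \<in> gens d \<longleftrightarrow> 1 \<le> k \<and> k \<le> d"
  by (auto simp: generators_def)

lemma keys_lmono: "i \<le> r \<Longrightarrow> keys (lmono i) \<subseteq> gens d"
proof
  fix v assume "i \<le> r" "v \<in> keys (lmono i)"
  then show "v \<in> gens d"
    by (cases v) (auto simp: in_keys_iff lookup_lmono lookup_lmono_S gens_T split: if_splits)
qed

lemma Y_PV: "i \<le> r \<Longrightarrow> Y i \<in> PV (gens d)"
  unfolding Y_eq_single by (rule single_PV[OF keys_lmono])

lemma trinomial_PV: "i + 2 \<le> r \<Longrightarrow> trinomial n l a i \<in> PV (gens d)"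
  unfolding trinomial_eq by (intro PV.add_mem PV.diff_mem PV.mult_mem Const_PV Y_PV) auto

lemma ideal_trinomial_ideal: "ideal (trinomial_ideal r d n l a) (polynomial_ring (gens d))"
proof -
  interpret cring "polynomial_ring (gens d) :: (generator, 'k) mpoly ring" by (rule cring_polynomial_ring)
  show ?thesis unfolding trinomial_ideal_def
    by (rule genideal_ideal) (auto intro: trinomial_PV)
qed

lemma trinomial_mem_ideal: "i + 2 \<le> r \<Longrightarrow> trinomial n l a i \<in> trinomial_ideal r d n l a"
  unfolding trinomial_ideal_def genideal_def by auto

lemma polynomial_ring_ideal_iff:
  "ideal J (polynomial_ring (V :: 'v set) :: ('v, 'k) mpoly ring) \<longleftrightarrow>
    J \<subseteq> PV V \<and> 0 \<in> J \<and> (\<forall>x\<in>J. \<forall>y\<in>J. x + y \<in> J) \<and> (\<forall>x\<in>J. \<forall>p\<in>PV V. p * x \<in> J)"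
    (is "?L \<longleftrightarrow> ?R")
proof
  assume ?L
  then interpret ideal J "polynomial_ring V :: ('v, 'k) mpoly ring" .
  have "J \<subseteq> PV V" "0 \<in> J" using a_subset additive_subgroup.zero_closed[OF is_additive_subgroup] by auto
  moreover have "x + y \<in> J" if "x \<in> J" "y \<in> J" for x y
    using additive_subgroup.a_closed[OF is_additive_subgroup that] by simp
  moreover have "p * x \<in> J" if "x \<in> J" "p \<in> PV V" for x p
    using I_l_closed[OF that] by simp
  ultimately show ?R by blast
next
  interpret cring "polynomial_ring V :: ('v, 'k) mpoly ring" by (rule cring_polynomial_ring)
  assume R: ?R
  have um: "- x \<in> J" if "x \<in> J" for x
  proof -
    have "Const (- 1) * x \<in> J" using R that by simp
    then show ?thesis by (simp add: Const.c_minus)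
  qed
  show ?L
  proof (rule idealI)
    show "ring (polynomial_ring V :: ('v, 'k) mpoly ring)" by (rule ring_axioms)
    have inv: "inv\<^bsub>add_monoid (polynomial_ring V)\<^esub> x = - x" if "x \<in> PV V" for x :: "('v, 'k) mpoly"
      using that minus_equality[of "- x" x] PV.minus_mem[of x V] by (simp add: a_inv_def)
    show "subgroup J (add_monoid (polynomial_ring V))"
    proof (rule subgroup.intro)
      fix x assume "x \<in> J"
      then have "x \<in> PV V" using R by blast
      show "inv\<^bsub>add_monoid (polynomial_ring V)\<^esub> x \<in> J"
        unfolding inv[OF \<open>x \<in> PV V\<close>] by (rule um) fact
    qed (use R in auto)
  qed (use R in \<open>auto simp: mult.commute\<close>)
qed

lemma trinomial_ideal_least:
  assumes "ideal J (polynomial_ring (gens d))" "\<And>i. i + 2 \<le> r \<Longrightarrow> trinomial n l a i \<in> J"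
  shows "trinomial_ideal r d n l a \<subseteq> J"
  using assms unfolding trinomial_ideal_def genideal_def by auto

definition al where "al i = dt i 1 / dt 0 1"
definition be where "be i = dt 0 i / dt 0 1"

lemma Y_mod_ideal:
  "i \<le> r \<Longrightarrow> Y i - (Const (al i) * Y 0 + Const (be i) * Y 1) \<in> trinomial_ideal r d n l a"
proof (induction i rule: less_induct)
  case (less i)
  let ?I = "trinomial_ideal r d n l a"
  have I: "?I \<subseteq> PV (gens d)" "0 \<in> ?I" "\<And>x y. x \<in> ?I \<Longrightarrow> y \<in> ?I \<Longrightarrow> x + y \<in> ?I"
      "\<And>x p. x \<in> ?I \<Longrightarrow> p \<in> PV (gens d) \<Longrightarrow> p * x \<in> ?I"
    using ideal_trinomial_ideal[of d] unfolding polynomial_ring_ideal_iff by auto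
  have nz: "dt 0 (Suc 0) \<noteq> 0" using dt_nz[of 0 1] r2 by simp
  define z where "z i = Y i - (Const (al i) * Y 0 + Const (be i) * Y 1)" for i
  consider "i = 0" | "i = 1" | j where "i = j + 2" by (metis add_2_eq_Suc' not0_implies_Suc One_nat_def)
  then have "z i \<in> ?I"
  proof cases
    case 1 then show ?thesis using nz I(2) by (simp add: z_def al_def be_def dt_def)
  next
    case 2 then show ?thesis using nz I(2) by (simp add: z_def al_def be_def dt_def)
  next
    case 3
    have zj: "z j \<in> ?I" "z (j + 1) \<in> ?I" using less 3 by (auto simp: z_def)
    have t: "trinomial n l a j \<in> ?I" using trinomial_mem_ideal less 3 by simp
    let ?w = "Const (inverse (dt j (j + 1)))"
    have ab: "dt j (j + 1) * al (j + 2) = dt j (j + 2) * al (j + 1) - dt (j + 1) (j + 2) * al j"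
      "dt j (j + 1) * be (j + 2) = dt j (j + 2) * be (j + 1) - dt (j + 1) (j + 2) * be j"
      unfolding al_def be_def by (simp_all add: diff_divide_distrib[symmetric]) (simp_all add: dt_def algebra_simps)
    have "Const (dt j (j + 1)) * z (j + 2) = trinomial n l a j + Const (dt j (j + 2)) * z (j + 1) + Const (- dt (j + 1) (j + 2)) * z j
       - (Const (dt j (j + 1) * al (j + 2) - dt j (j + 2) * al (j + 1) + dt (j + 1) (j + 2) * al j) * Y 0
        + Const (dt j (j + 1) * be (j + 2) - dt j (j + 2) * be (j + 1) + dt (j + 1) (j + 2) * be j) * Y 1)"
      unfolding trinomial_eq z_def Const.c_mult Const.c_diff Const.c_add Const.c_minus by (simp add: algebra_simps)
    also have "\<dots> = trinomial n l a j + Const (dt j (j + 2)) * z (j + 1) + Const (- dt (j + 1) (j + 2)) * z j"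
    proof -
      have "dt j (j + 1) * al (j + 2) - dt j (j + 2) * al (j + 1) + dt (j + 1) (j + 2) * al j = 0"
        "dt j (j + 1) * be (j + 2) - dt j (j + 2) * be (j + 1) + dt (j + 1) (j + 2) * be j = 0"
        unfolding ab by simp_all
      then show ?thesis by (simp only: Const.c_0 mult_zero_left diff_0_right add_0_left)
    qed
    also have "\<dots> \<in> ?I" by (intro I(3,4) t zj Const_PV)
    finally have "?w * (Const (dt j (j + 1)) * z (j + 2)) \<in> ?I" by (rule I(4)) simp
    moreover have "?w * (Const (dt j (j + 1)) * z (j + 2)) = z (j + 2)"
      using dt_nz[of j "j + 1"] less 3 by (simp add: mult.assoc[symmetric] flip: Const.c_mult)
    ultimately show ?thesis using 3 by simp
  qed
  then show ?case by (simp add: z_def)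
qed

text \<open>The monomials that survive when \<open>T_i^{l_i}\<close>, \<open>i \<ge> 2\<close>, is replaced by a linear combination
  of \<open>T_0^{l_0}\<close> and \<open>T_1^{l_1}\<close>.\<close>

definition std :: "(generator \<Rightarrow>\<^sub>0 nat) \<Rightarrow> bool" where
  "std m \<longleftrightarrow> (\<forall>i\<in>{2..r}. \<exists>j\<in>{1..n i}. lookup m (T i j) < l i j)"

lemma std_reduction:
  assumes "p \<in> PV (gens d)"
  shows "\<exists>q\<in>PV (gens d). (\<forall>m\<in>keys q. std m) \<and> p - q \<in> trinomial_ideal r d n l a"
proof -
  let ?I = "trinomial_ideal r d n l a"
  have I: "?I \<subseteq> PV (gens d)" "0 \<in> ?I" "\<And>x y. x \<in> ?I \<Longrightarrow> y \<in> ?I \<Longrightarrow> x + y \<in> ?I"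
      "\<And>x p. x \<in> ?I \<Longrightarrow> p \<in> PV (gens d) \<Longrightarrow> p * x \<in> ?I"
    using ideal_trinomial_ideal[of d] unfolding polynomial_ring_ideal_iff by auto
  define Q where "Q p \<longleftrightarrow> (\<exists>q\<in>PV (gens d). (\<forall>m\<in>keys q. std m) \<and> p - q \<in> ?I)" for p
  have Q0: "Q 0" unfolding Q_def using I by (intro bexI[of _ 0]) auto
  have Qadd: "Q (p + p')" if "Q p" "Q p'" for p p'
  proof -
    obtain q q' where "q \<in> PV (gens d)" "q' \<in> PV (gens d)" "\<forall>m\<in>keys q. std m"
        "\<forall>m\<in>keys q'. std m" "p - q \<in> ?I" "p' - q' \<in> ?I" using \<open>Q p\<close> \<open>Q p'\<close> unfolding Q_def by blast
    moreover from this have "p + p' - (q + q') \<in> ?I" using I(3)[of "p - q" "p' - q'"] by (simp add: algebra_simps)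
    ultimately show ?thesis unfolding Q_def using keys_add[of q q']
      by (intro bexI[of _ "q + q'"]) (auto intro: PV.add_mem)
  qed
  have QI: "Q p" if "p - p' \<in> ?I" "Q p'" for p p'
  proof -
    obtain q where q: "q \<in> PV (gens d)" "\<forall>m\<in>keys q. std m" "p' - q \<in> ?I" using \<open>Q p'\<close> unfolding Q_def by blast
    then have "p - q \<in> ?I" using I(3)[of "p - p'" "p' - q"] that by simp
    then show ?thesis using q unfolding Q_def by blast
  qed
  define w where "w m = (\<Sum>i=2..r. \<Sum>j=1..n i. lookup m (T i j))" for m :: "generator \<Rightarrow>\<^sub>0 nat"
  have wadd: "w (m + m') = w m + w m'" for m m' by (simp add: w_def lookup_add sum.distrib)
  have Qs: "Q (single m k)" if "keys m \<subseteq> gens d" for m k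
    using that
  proof (induction "w m" arbitrary: m k rule: less_induct)
    case less
    show ?case
    proof (cases "std m")
      case True
      then show ?thesis unfolding Q_def using less I(2)
        by (intro bexI[of _ "single m k"]) (auto intro: single_PV)
    next
      case False
      then obtain i where i: "2 \<le> i" "i \<le> r" "\<And>j. 1 \<le> j \<Longrightarrow> j \<le> n i \<Longrightarrow> l i j \<le> lookup m (T i j)"
        unfolding std_def by (meson atLeastAtMost_iff not_le)
      define m' where "m' = m - lmono i"
      have m: "m = lmono i + m'"
      proof (rule poly_mapping_eqI)
        fix v show "lookup m v = lookup (lmono i + m') v"
          by (cases v) (auto simp: m'_def lookup_add lookup_minus lookup_lmono lookup_lmono_S i)
      qed
      have km': "keys m' \<subseteq> gens d" using less(2) unfolding m keys_nat_add by simp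
      have "w (lmono i) \<ge> (\<Sum>j=1..n i. lookup (lmono i) (T i j))"
        unfolding w_def using i by (intro member_le_sum[of i "{2..r}" "\<lambda>i'. \<Sum>j=1..n i'. lookup (lmono i) (T i' j)"]) auto
      also have "(\<Sum>j=1..n i. lookup (lmono i) (T i j)) \<ge> lookup (lmono i) (T i 1)"
        using n1[of i] i by (intro member_le_sum) auto
      ultimately have "w (lmono i) > 0" using l1[of i 1] n1[of i] i by (auto simp: lookup_lmono)
      then have lt: "w m' < w m" by (simp add: m wadd)
      have w01: "w (lmono 0 + m') = w m'" "w (lmono 1 + m') = w m'"
        by (auto simp: wadd) (auto simp: w_def lookup_lmono)
      have Q01: "Q (single (lmono 0 + m') k')" "Q (single (lmono 1 + m') k')" for k'
        using less(1)[of "lmono 0 + m'" k'] less(1)[of "lmono 1 + m'" k'] lt w01 km' r2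
          keys_lmono[of 0 d] keys_lmono[of 1 d] unfolding keys_nat_add by auto
      have "single m' k * (Y i - (Const (al i) * Y 0 + Const (be i) * Y 1)) \<in> ?I"
        by (intro I(4) Y_mod_ideal i single_PV km')
      moreover have "single m' k * (Y i - (Const (al i) * Y 0 + Const (be i) * Y 1)) =
        single m k - (single (lmono 0 + m') (k * al i) + single (lmono 1 + m') (k * be i))"
        unfolding Y_eq_single m by (simp add: algebra_simps mult_single Const_def)
      ultimately show ?thesis using QI Qadd Q01 by metis
    qed
  qed
  have "Q (\<Sum>m\<in>J. single m (lookup p m))" if "J \<subseteq> keys p" for J
    using finite_subset[OF that finite_keys] that
    by (induction J rule: finite_induct) (use assms in \<open>auto simp: PV_iff Q0 intro!: Qadd Qs\<close>)
  then have "Q p" using poly_mapping_sum_single[of p] by (metis subset_refl)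
  then show ?thesis by (simp add: Q_def)
qed

end

locale trinomial_model = trinomial_data r n l a + scalar_hom c
  for r n l and a :: "nat \<Rightarrow> 'k::field_char_0 ^ 2" and c :: "'k \<Rightarrow> 'b::comm_ring_1" +
  fixes d :: nat and g :: "generator \<Rightarrow> 'b" and u v :: 'b
  assumes g_lin: "\<And>i. i \<le> r \<Longrightarrow> (\<Prod>j = 1..n i. g (T i j) ^ l i j) = c (a i $ 1) * u + c (a i $ 2) * v"
    and indep: "\<And>p. p \<in> PV (generators r d n) \<Longrightarrow> (\<And>m. m \<in> keys p \<Longrightarrow> trinomial_data.std r n l m) \<Longrightarrow>
      meval c g p = 0 \<Longrightarrow> p = 0"
begin

sublocale polynomial_image c "generators r d n" g ..

abbreviation "R \<equiv> trinomial_algebra r d n l a"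
abbreviation "I \<equiv> trinomial_ideal r d n l a"

lemma linear_trinomial:
  assumes "\<And>i. i \<le> r \<Longrightarrow> y i = c (a i $ 1) * u' + c (a i $ 2) * v'" "i + 2 \<le> r"
  shows "c (dt (i + 1) (i + 2)) * y i - c (dt i (i + 2)) * y (i + 1) + c (dt i (i + 1)) * y (i + 2) = 0"
  using assms by (simp add: dt_def c_diff c_mult algebra_simps)

lemma meval_Y: "meval c h (Y i) = (\<Prod>j = 1..n i. h (T i j) ^ l i j)"
  by (simp add: T_monomial_def meval_prod meval_power)

lemma \<phi>_Y: "i \<le> r \<Longrightarrow> \<phi> (Y i) = c (a i $ 1) * u + c (a i $ 2) * v"
  unfolding meval_Y by (rule g_lin)

lemma kernel_eq: "{p \<in> PV (gens d). \<phi> p = 0} = I"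
proof
  show "I \<subseteq> {p \<in> PV (gens d). \<phi> p = 0}"
  proof (rule trinomial_ideal_least)
    show "ideal {p \<in> PV (gens d). \<phi> p = 0} (polynomial_ring (gens d))"
      unfolding polynomial_ring_ideal_iff
      by (auto simp: PV.add_mem PV.mult_mem PV.zero_mem meval_add meval_mult)
    fix i assume i: "i + 2 \<le> r"
    show "trinomial n l a i \<in> {p \<in> PV (gens d). \<phi> p = 0}"
      using linear_trinomial[of "\<lambda>i. \<phi> (Y i)" u v i] trinomial_PV[OF i] i
      by (simp add: trinomial_eq meval_add meval_diff meval_mult \<phi>_Y)
  qed
  then have I: "\<phi> p = 0" if "p \<in> I" for p using that by blast
  show "{p \<in> PV (gens d). \<phi> p = 0} \<subseteq> I"
  proof
    fix p assume p: "p \<in> {p \<in> PV (gens d). \<phi> p = 0}"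
    then obtain q where q: "q \<in> PV (gens d)" "\<forall>m\<in>keys q. std m" "p - q \<in> I"
      using std_reduction by blast
    have "\<phi> q = 0" using I[OF q(3)] p by (simp add: meval_diff)
    then have "q = 0" using indep q by blast
    then show "p \<in> I" using q by simp
  qed
qed

lemma kernel_least:
  assumes "ideal J (polynomial_ring (gens d))" "\<And>i. i + 2 \<le> r \<Longrightarrow> trinomial n l a i \<in> J"
    "p \<in> PV (gens d)" "\<phi> p = 0"
  shows "p \<in> J"
  using trinomial_ideal_least[OF assms(1,2)] assms(3,4) kernel_eq by blast

abbreviation "M \<equiv> subalg_module c A"

lemma algebra_iso: "\<exists>f. module_iso f R M"
proof -
  let ?P = "polynomial_ring (gens d) :: (generator, 'k) mpoly ring"
  interpret P: cring ?P by (rule cring_polynomial_ring)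
  have H: "ring_hom_ring ?P M \<phi>"
  proof (rule ring_hom_ringI2)
    show "ring ?P" by (rule P.ring_axioms)
    show "ring M"
    proof (rule ringI)
      show "abelian_group M"
      proof (rule abelian_groupI)
        fix x assume "x \<in> carrier M"
        then show "\<exists>y\<in>carrier M. y \<oplus>\<^bsub>M\<^esub> x = \<zero>\<^bsub>M\<^esub>"
          by (intro bexI[of _ "- x"]) (simp_all add: A.minus_mem)
      qed (simp_all add: A.add_mem algebra_simps A.zero_mem)
      show "Group.monoid M" by (rule monoidI) (simp_all add: A.mult_mem A.one_mem algebra_simps)
    qed (simp_all add: algebra_simps)
    show "\<phi> \<in> ring_hom ?P M"
      by (rule ring_hom_memI) (simp_all add: meval_mult meval_add)
  qed
  let ?f = "\<lambda>X. the_elem (\<phi> ` X)"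
  have K: "a_kernel ?P M \<phi> = I" using kernel_eq by (simp add: a_kernel_def')
  have "?f \<in> ring_iso (?P Quot I) M"
    using ring_hom_ring.FactRing_iso_set[OF H, unfolded K] by simp
  then have f: "bij_betw ?f (carrier (?P Quot I)) A"
    "\<And>x y. x \<in> carrier (?P Quot I) \<Longrightarrow> y \<in> carrier (?P Quot I) \<Longrightarrow> ?f (x \<otimes>\<^bsub>?P Quot I\<^esub> y) = ?f x * ?f y"
    "\<And>x y. x \<in> carrier (?P Quot I) \<Longrightarrow> y \<in> carrier (?P Quot I) \<Longrightarrow> ?f (x \<oplus>\<^bsub>?P Quot I\<^esub> y) = ?f x + ?f y"
    unfolding ring_iso_def ring_hom_def by auto
  have Qz: "\<zero>\<^bsub>?P Quot I\<^esub> \<in> carrier (?P Quot I)" and Qzz: "\<zero>\<^bsub>?P Quot I\<^esub> \<oplus>\<^bsub>?P Quot I\<^esub> \<zero>\<^bsub>?P Quot I\<^esub> = \<zero>\<^bsub>?P Quot I\<^esub>"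
    and Qcl: "x \<in> carrier (?P Quot I) \<Longrightarrow> y \<in> carrier (?P Quot I) \<Longrightarrow> x \<oplus>\<^bsub>?P Quot I\<^esub> y \<in> carrier (?P Quot I)"
      "x \<in> carrier (?P Quot I) \<Longrightarrow> y \<in> carrier (?P Quot I) \<Longrightarrow> x \<otimes>\<^bsub>?P Quot I\<^esub> y \<in> carrier (?P Quot I)" for x y
    using ideal.quotient_is_ring[OF ideal_trinomial_ideal]
    by (simp_all add: ring.ring_simprules)
  have fc: "?f (I +>\<^bsub>?P\<^esub> Const k) = c k" for k
    using ring_hom_ring.the_elem_simp[OF H, unfolded K, of "Const k"] by simp
  have cm: "I +>\<^bsub>?P\<^esub> Const k \<in> carrier (?P Quot I)" for k
    by (auto simp: FactRing_def A_RCOSETS_def')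
  have f0: "?f \<zero>\<^bsub>?P Quot I\<^esub> = 0"
    using f(3)[OF Qz Qz] Qzz by simp
  have "module_iso ?f R M"
    unfolding module_iso_def trinomial_algebra_def Let_def
    by (intro conjI ballI allI) (simp_all add: f f0 fc cm Qz Qcl)
  then show ?thesis by blast
qed

text \<open>The derivation is the linear coefficient of the evaluation at the dual numbers
  \<open>g w + h w \<epsilon>\<close>.\<close>

lemma derivation_exists:
  assumes h: "\<And>w. w \<in> gens d \<Longrightarrow> h w \<in> A"
    and lin: "\<And>i. i \<le> r \<Longrightarrow> (\<Sum>j = 1..n i. of_nat (l i j) * g (T i j) ^ (l i j - 1) * h (T i j) *
        (\<Prod>j'\<in>{1..n i} - {j}. g (T i j') ^ l i j')) = c (a i $ 1) * u' + c (a i $ 2) * v'"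
  obtains \<delta> where "derivation M \<delta>" "\<And>w. w \<in> gens d \<Longrightarrow> \<delta> (g w) = h w"
proof -
  define c' where "c' = (\<lambda>k. [:c k:])"
  interpret c': scalar_hom c' by unfold_locales (auto simp: c'_def c_add c_mult one_pCons)
  have c'_coeff [simp]: "coeff (c' k) 0 = c k" "coeff (c' k) (Suc 0) = 0" for k by (simp_all add: c'_def)
  define \<Psi> where "\<Psi> = meval c' (\<lambda>w. [:g w, h w:])"
  define D where "D p = coeff (\<Psi> p) 1" for p
  have \<Psi>0: "coeff (\<Psi> p) 0 = \<phi> p" if "p \<in> PV (gens d)" for p
    using that by (induction rule: PV_induct)
      (auto simp: \<Psi>_def c'.meval_add c'.meval_mult meval_add meval_mult coeff_mult_0)
  have Dadd: "D (p + q) = D p + D q" for p q by (simp add: D_def \<Psi>_def c'.meval_add)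
  have Dmult: "D (p * q) = D p * \<phi> q + \<phi> p * D q" if "p \<in> PV (gens d)" "q \<in> PV (gens d)" for p q
    using \<Psi>0[OF that(1)] \<Psi>0[OF that(2)]
    by (simp add: D_def \<Psi>_def c'.meval_mult coeff_mult algebra_simps)
  have Dc: "D (Const k) = 0" for k by (simp add: D_def \<Psi>_def)
  have Dv: "D (Var w) = h w" for w by (simp add: D_def \<Psi>_def)
  have DA: "D p \<in> A" if "p \<in> PV (gens d)" for p
    using that
  proof (induction rule: PV_induct)
    case (Const k) then show ?case unfolding Dc by (rule A.zero_mem)
  next
    case (Var w) then show ?case unfolding Dv by (rule h)
  next
    case (add p q) then show ?case unfolding Dadd by (intro A.add_mem)
  next
    case (mult p q) then show ?case unfolding Dmult[OF mult(1,2)] by (intro A.add_mem A.mult_mem imageI)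
  qed
  have Dpow: "D (p ^ k) = of_nat k * \<phi> p ^ (k - 1) * D p" if "p \<in> PV (gens d)" for p k
  proof (induction k)
    case 0 show ?case using Dc[of 1] by simp
  next
    case (Suc k) then show ?case using that Dmult[of p "p ^ k"] PV.power_mem[OF that, of k]
      by (cases k) (auto simp: meval_power meval_mult algebra_simps)
  qed
  have Dprod: "D (\<Prod>j\<in>J. f j) = (\<Sum>j\<in>J. D (f j) * (\<Prod>j'\<in>J - {j}. \<phi> (f j')))"
    if "finite J" "\<And>j. j \<in> J \<Longrightarrow> f j \<in> PV (gens d)" for J :: "nat set" and f
    using that
  proof (induction J rule: finite_induct)
    case empty show ?case using Dc[of 1] by simp
  next
    case (insert x F)
    have "(\<Sum>j\<in>F. D (f j) * (\<Prod>j'\<in>insert x F - {j}. \<phi> (f j'))) = (\<Sum>j\<in>F. \<phi> (f x) * (D (f j) * (\<Prod>j'\<in>F - {j}. \<phi> (f j'))))"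
    proof (rule sum.cong[OF refl])
      fix j assume j: "j \<in> F"
      then have "insert x F - {j} = insert x (F - {j})" using insert by auto
      then show "D (f j) * (\<Prod>j'\<in>insert x F - {j}. \<phi> (f j')) = \<phi> (f x) * (D (f j) * (\<Prod>j'\<in>F - {j}. \<phi> (f j')))"
        using insert by (simp add: ac_simps)
    qed
    then show ?case
      using insert Dmult[of "f x" "prod f F"] PV.prod_mem[of F f "gens d"]
      by (simp add: meval_prod sum_distrib_left)
  qed
  have DY: "D (Y i) = c (a i $ 1) * u' + c (a i $ 2) * v'" if "i \<le> r" for i
  proof -
    have V: "T i j \<in> gens d" if "j \<in> {1..n i}" for j using that \<open>i \<le> r\<close> by (simp add: gens_T)
    have "D (Y i) = (\<Sum>j = 1..n i. D (Var (T i j) ^ l i j) * (\<Prod>j'\<in>{1..n i} - {j}. \<phi> (Var (T i j') ^ l i j')))"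
      unfolding T_monomial_def by (rule Dprod) (auto intro!: PV.power_mem Var_PV V)
    also have "\<dots> = (\<Sum>j = 1..n i. of_nat (l i j) * g (T i j) ^ (l i j - 1) * h (T i j) *
        (\<Prod>j'\<in>{1..n i} - {j}. g (T i j') ^ l i j'))"
      by (intro sum.cong refl) (simp add: Dpow Dv V meval_power)
    finally show ?thesis using lin[OF that] by simp
  qed
  have D0: "D p = 0" if "p \<in> PV (gens d)" "\<phi> p = 0" for p
  proof -
    have "p \<in> {p \<in> PV (gens d). \<phi> p = 0 \<and> D p = 0}"
    proof (rule kernel_least[OF _ _ that])
      show "ideal {p \<in> PV (gens d). \<phi> p = 0 \<and> D p = 0} (polynomial_ring (gens d))"
        unfolding polynomial_ring_ideal_iff using Dc[of 0]
        by (auto simp: PV.add_mem PV.mult_mem PV.zero_mem meval_add meval_mult Dadd Dmult)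
      fix i assume i: "i + 2 \<le> r"
      have Dm: "D (Const k * p) = c k * D p" if "p \<in> PV (gens d)" for k p
        using Dmult[OF Const_PV that] by (simp add: Dc)
      have Dd: "D (p - q) = D p - D q" for p q using Dadd[of "p - q" q] by simp
      have "trinomial n l a i \<in> I" using trinomial_mem_ideal[OF i] .
      then have "\<phi> (trinomial n l a i) = 0" using kernel_eq by blast
      moreover have "D (trinomial n l a i) = 0"
        using linear_trinomial[of "\<lambda>i. D (Y i)" u' v' i] DY i
        unfolding trinomial_eq by (simp add: Dadd Dd Dm Y_PV)
      ultimately show "trinomial n l a i \<in> {p \<in> PV (gens d). \<phi> p = 0 \<and> D p = 0}"
        using trinomial_PV[OF i] by simp
    qed
    then show ?thesis by simp
  qed
  define \<delta> where "\<delta> x = D (SOME p. p \<in> PV (gens d) \<and> \<phi> p = x)" for x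
  have \<delta>: "\<delta> (\<phi> p) = D p" if "p \<in> PV (gens d)" for p
  proof -
    define q where "q = (SOME q. q \<in> PV (gens d) \<and> \<phi> q = \<phi> p)"
    have q: "q \<in> PV (gens d)" "\<phi> q = \<phi> p" unfolding q_def using someI[of "\<lambda>q. q \<in> PV (gens d) \<and> \<phi> q = \<phi> p" p] that by auto
    have "D (q - p) = 0" using q that by (intro D0 PV.diff_mem) (auto simp: meval_diff)
    moreover have "D (q - p) = D q - D p" using Dadd[of "q - p" p] by simp
    ultimately show ?thesis by (simp add: \<delta>_def q_def)
  qed
  have "derivation M \<delta>"
    unfolding A.derivation_subalg
  proof (intro conjI ballI allI)
    fix x assume "x \<in> A"
    then obtain p where p: "p \<in> PV (gens d)" "x = \<phi> p" by blast
    then show "\<delta> x \<in> A" using \<delta> DA by simp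
    fix k
    have "c k * x = \<phi> (Const k * p)" using p by (simp add: meval_mult)
    then show "\<delta> (c k * x) = c k * \<delta> x"
      using p \<delta>[of p] \<delta>[of "Const k * p"] Dmult[of "Const k" p] Dc by (simp add: PV.mult_mem)
  next
    fix x y assume "x \<in> A" "y \<in> A"
    then obtain p q where p: "p \<in> PV (gens d)" "x = \<phi> p" "q \<in> PV (gens d)" "y = \<phi> q" by blast
    show "\<delta> (x + y) = \<delta> x + \<delta> y"
      using p \<delta>[of p] \<delta>[of q] \<delta>[of "p + q"] Dadd by (simp add: PV.add_mem meval_add)
    show "\<delta> (x * y) = \<delta> x * y + x * \<delta> y"
      using p \<delta>[of p] \<delta>[of q] \<delta>[of "p * q"] Dmult by (simp add: PV.mult_mem meval_mult)
  qed
  moreover have "\<delta> (g w) = h w" if "w \<in> gens d" for w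
    using \<delta>[of "Var w"] that Dv by simp
  ultimately show ?thesis using that by blast
qed

lemma scaling_exists:
  assumes t: "\<And>i. i \<le> r \<Longrightarrow> (\<Prod>j = 1..n i. t (T i j) ^ l i j) = lam"
  obtains \<tau> where "\<And>p. p \<in> PV (gens d) \<Longrightarrow> \<tau> (\<phi> p) = meval c (\<lambda>w. c (t w) * g w) p"
proof -
  let ?\<psi> = "meval c (\<lambda>w. c (t w) * g w)"
  have Y: "?\<psi> (Y i) = c (a i $ 1) * (c lam * u) + c (a i $ 2) * (c lam * v)" if "i \<le> r" for i
  proof -
    have "?\<psi> (Y i) = c (\<Prod>j = 1..n i. t (T i j) ^ l i j) * (\<Prod>j = 1..n i. g (T i j) ^ l i j)"
    proof -
      have "c (\<Prod>j\<in>J. t (T i j) ^ l i j) = (\<Prod>j\<in>J. c (t (T i j)) ^ l i j)" for J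
        by (induction J rule: infinite_finite_induct) (auto simp: c_mult c_power)
      then show ?thesis by (simp add: meval_Y power_mult_distrib prod.distrib)
    qed
    then show ?thesis unfolding t[OF that] g_lin[OF that] by (simp add: algebra_simps)
  qed
  have Z: "?\<psi> p = 0" if "p \<in> PV (gens d)" "\<phi> p = 0" for p
  proof -
    have "p \<in> {p \<in> PV (gens d). ?\<psi> p = 0}"
    proof (rule kernel_least[OF _ _ that])
      show "ideal {p \<in> PV (gens d). ?\<psi> p = 0} (polynomial_ring (gens d))"
        unfolding polynomial_ring_ideal_iff
        by (auto simp: PV.add_mem PV.mult_mem PV.zero_mem meval_add meval_mult)
      fix i assume i: "i + 2 \<le> r"
      then show "trinomial n l a i \<in> {p \<in> PV (gens d). ?\<psi> p = 0}"
        using linear_trinomial[of "\<lambda>i. ?\<psi> (Y i)" "c lam * u" "c lam * v" i] Y trinomial_PV[OF i]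
        by (simp add: trinomial_eq meval_add meval_diff meval_mult)
    qed
    then show ?thesis by simp
  qed
  show ?thesis
  proof (rule that)
    fix p :: "(generator, 'k) mpoly" assume p: "p \<in> PV (gens d)"
    define q where "q = (SOME q. q \<in> PV (gens d) \<and> \<phi> q = \<phi> p)"
    have q: "q \<in> PV (gens d)" "\<phi> q = \<phi> p" unfolding q_def using someI[of "\<lambda>q. q \<in> PV (gens d) \<and> \<phi> q = \<phi> p" p] p by auto
    have "?\<psi> (q - p) = 0" using q p by (intro Z PV.diff_mem) (auto simp: meval_diff)
    then show "?\<psi> (SOME q. q \<in> PV (gens d) \<and> \<phi> q = \<phi> p) = ?\<psi> p" by (simp add: q_def meval_diff)
  qed
qed

end

section \<open>The quasitorus action\<close>

lemma root_of_unity_dvd: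
  fixes l e :: nat
  assumes l: "l > 0" and H: "\<And>z::'k::{alg_closed_field, field_char_0}. z ^ l = 1 \<Longrightarrow> z ^ e = 1"
  shows "l dvd e"
proof (rule ccontr)
  assume "\<not> l dvd e"
  define k where "k = gcd l e"
  obtain s where s: "l = k * s" using gcd_dvd1[of l e] unfolding k_def dvd_def by blast
  have "s \<noteq> 0" using l s by auto
  moreover have "s \<noteq> 1"
  proof
    assume "s = 1"
    then have "k = l" using s by simp
    then show False using \<open>\<not> l dvd e\<close> gcd_dvd2[of l e] unfolding k_def by simp
  qed
  ultimately have s2: "s - 1 > 0" by simp
  have k: "k > 0" using l unfolding k_def by simp
  obtain x :: 'k where x: "(\<Sum>i\<le>s - 1. 1 * x ^ i) = 0"
    using alg_closed[of "s - 1" "\<lambda>_. 1::'k"] s2 by auto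
  have "x \<noteq> 1"
  proof
    assume "x = 1"
    then have "of_nat (Suc (s - 1)) = (0::'k)" using x by simp
    then show False using of_nat_neq_0 by blast
  qed
  have "x ^ s - 1 = (x - 1) * (\<Sum>i<s. x ^ i)" by (rule power_diff_1_eq)
  also have "{..<s} = {..s - 1}" using s2 by auto
  finally have xs: "x ^ s = 1" using x by simp
  obtain z where z: "z ^ k = x" using nth_root_exists[of k x] k by blast
  have zl: "z ^ l = 1" by (simp add: s power_mult z xs)
  obtain a b where "l * a = e * b + k" using bezout_nat[of l e] l unfolding k_def by blast
  then have "(z ^ l) ^ a = (z ^ e) ^ b * z ^ k" by (simp flip: power_mult power_add)
  then show False using H[OF zl] zl z \<open>x \<noteq> 1\<close> by simp
qed

lemma mon_support:
  assumes "finite W" "\<And>w. w \<notin> W \<Longrightarrow> t w = 1"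
  shows "mon t m = (\<Prod>w\<in>W. t w ^ lookup m w)"
proof -
  have "mon t m = (\<Prod>w\<in>keys m \<union> W. t w ^ lookup m w)" by (rule mon_superset) (use assms in auto)
  also have "\<dots> = (\<Prod>w\<in>W. t w ^ lookup m w)" by (rule prod.mono_neutral_right) (use assms in auto)
  finally show ?thesis .
qed

lemma (in scalar_hom) c_mon: "c (mon t m) = mon (\<lambda>w. c (t w)) m"
proof -
  have "c (\<Prod>v\<in>J. t v ^ lookup m v) = (\<Prod>v\<in>J. c (t v) ^ lookup m v)" for J
    by (induction J rule: infinite_finite_induct) (auto simp: c_mult c_power)
  then show ?thesis by (simp add: mon_def)
qed

lemma two_power_inj: "(2::'k::field_char_0) ^ a = 2 ^ b \<Longrightarrow> a = b"
proof -
  assume "(2::'k) ^ a = 2 ^ b"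
  then have "of_nat (2 ^ a) = (of_nat (2 ^ b) :: 'k)" by simp
  then show "a = b" by (simp only: of_nat_eq_iff) simp
qed

context trinomial_data
begin

text \<open>The quasitorus of all scalings of the variables that preserve the trinomials.\<close>

definition torus :: "(generator \<Rightarrow> 'k) set" where
  "torus = {t. (\<forall>w. t w \<noteq> 0) \<and> (\<forall>i\<le>r. mon t (lmono i) = mon t (lmono 0))}"

definition eqv where "eqv m m' \<longleftrightarrow> (\<forall>t\<in>torus. mon t m = mon t m')"

lemma mon_lmono: "mon t (lmono i) = (\<Prod>j = 1..n i. t (T i j) ^ l i j)"
  by (simp add: lmono_def mon_sum mon_single)

lemma eqv_minor:
  assumes "eqv m m'" "i \<le> r" "j \<in> {1..n i}" "j' \<in> {1..n i}"
  shows "l i j' * lookup m (T i j) + l i j * lookup m' (T i j') = l i j' * lookup m' (T i j) + l i j * lookup m (T i j')"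
proof (cases "j = j'")
  case False
  define t :: "generator \<Rightarrow> 'k" where
    "t = (\<lambda>w. if w = T i j then 2 ^ l i j' else if w = T i j' then inverse (2 ^ l i j) else 1)"
  have t: "mon t m = 2 ^ (l i j' * lookup m (T i j)) / 2 ^ (l i j * lookup m (T i j'))" for m
    using mon_support[of "{T i j, T i j'}" t m] False
    by (simp add: t_def power_mult divide_inverse power_inverse)
  have "mon t (lmono i') = 1" for i' unfolding t using assms by (auto simp: lookup_lmono mult.commute)
  moreover have "t w \<noteq> 0" for w by (simp add: t_def)
  ultimately have "t \<in> torus" unfolding torus_def by simp
  then have "mon t m = mon t m'" using assms by (simp add: eqv_def)
  then have "(2::'k) ^ (l i j' * lookup m (T i j) + l i j * lookup m' (T i j')) = 2 ^ (l i j' * lookup m' (T i j) + l i j * lookup m (T i j'))"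
    by (simp add: t frac_eq_eq power_add)
  then show ?thesis by (rule two_power_inj)
qed simp

lemma eqv_total:
  assumes "eqv m m'"
  defines "L \<equiv> \<Prod>i\<le>r. l i 1"
  shows "(\<Sum>i\<le>r. L div l i 1 * lookup m (T i 1)) = (\<Sum>i\<le>r. L div l i 1 * lookup m' (T i 1))"
proof -
  define t :: "generator \<Rightarrow> 'k" where
    "t = (\<lambda>w. if w \<in> (\<lambda>i. T i 1) ` {..r} then (case w of T i j \<Rightarrow> 2 ^ (L div l i 1) | S k \<Rightarrow> 1) else 1)"
  have t: "mon t m = 2 ^ (\<Sum>i\<le>r. L div l i 1 * lookup m (T i 1))" for m
  proof -
    have "mon t m = (\<Prod>w\<in>(\<lambda>i. T i 1) ` {..r}. t w ^ lookup m w)"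
      by (rule mon_support) (auto simp: t_def)
    also have "\<dots> = (\<Prod>i\<le>r. t (T i 1) ^ lookup m (T i 1))" by (subst prod.reindex) (auto simp: inj_on_def)
    also have "\<dots> = (\<Prod>i\<le>r. 2 ^ (L div l i 1 * lookup m (T i 1)))"
      by (rule prod.cong) (auto simp: t_def power_mult)
    finally show ?thesis by (simp add: power_sum)
  qed
  have "(\<Sum>i\<le>r. L div l i 1 * lookup (lmono i') (T i 1)) = L" if "i' \<le> r" for i'
  proof -
    have "(\<Sum>i\<le>r. L div l i 1 * lookup (lmono i') (T i 1)) = (\<Sum>i\<le>r. if i = i' then L div l i 1 * l i 1 else 0)"
      using n1 by (intro sum.cong) (auto simp: lookup_lmono)
    also have "\<dots> = L div l i' 1 * l i' 1" using that by simp
    also have "\<dots> = L"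
    proof (rule dvd_div_mult_self)
      show "l i' 1 dvd L" unfolding L_def using that by (intro dvd_prodI) auto
    qed
    finally show ?thesis .
  qed
  then have "mon t (lmono i') = 2 ^ L" if "i' \<le> r" for i' unfolding t using that by simp
  moreover have "t w \<noteq> 0" for w by (simp add: t_def split: generator.splits)
  ultimately have "t \<in> torus" unfolding torus_def by simp
  then have "mon t m = mon t m'" using assms by (simp add: eqv_def)
  then show ?thesis unfolding t by (rule two_power_inj)
qed

end

lemma (in trinomial_data) prod_lmono_decomp:
  assumes "keys m \<subseteq> gens 0" "keys b \<subseteq> gens 0"
    "\<And>i j. i \<le> r \<Longrightarrow> j \<in> {1..n i} \<Longrightarrow> lookup m (T i j) = lookup b (T i j) + k i * l i j"
  shows "mon g m = mon g b * (\<Prod>i\<le>r. mon g (lmono i) ^ k i)"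
proof -
  have z: "lookup m w = 0" "lookup b w = 0" if "w \<notin> gens 0" for w
    using assms(1,2) that by (auto simp: in_keys_iff)
  have rep: "lookup (\<Sum>x<q. m) w = q * lookup m w" for q :: nat and m :: "generator \<Rightarrow>\<^sub>0 nat" and w by (simp add: lookup_sum)
  have "m = b + (\<Sum>i\<le>r. \<Sum>x<k i. lmono i)"
  proof (rule poly_mapping_eqI)
    fix w
    have s: "lookup (\<Sum>i\<le>r. \<Sum>x<k i. lmono i) w = (\<Sum>i\<le>r. k i * lookup (lmono i) w)"
      by (simp add: lookup_sum)
    show "lookup m w = lookup (b + (\<Sum>i\<le>r. \<Sum>x<k i. lmono i)) w"
    proof (cases w)
      case (S q)
      then show ?thesis using z[of w] unfolding lookup_add s by (simp add: gens_S lookup_lmono_S)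
    next
      case (T i j)
      have "(\<Sum>i'\<le>r. k i' * lookup (lmono i') w) = (\<Sum>i'\<le>r. if i' = i then (if 1 \<le> j \<and> j \<le> n i then k i * l i j else 0) else 0)"
        unfolding T by (rule sum.cong) (auto simp: lookup_lmono)
      then show ?thesis using z[of w] assms(3)[of i j] T unfolding lookup_add s by (auto simp: gens_T)
    qed
  qed
  moreover have "mon g (\<Sum>i\<le>r. \<Sum>x<k i. lmono i) = (\<Prod>i\<le>r. mon g (lmono i) ^ k i)"
    by (simp add: mon_sum)
  ultimately show ?thesis by (simp add: mon_add)
qed

locale trinomial_torus = trinomial_data r n l a
  for r n l and a :: "nat \<Rightarrow> 'k::{alg_closed_field, field_char_0} ^ 2"
begin

lemma eqv_dvd:
  assumes "eqv m m'" "i \<le> r" "j \<in> {1..n i}"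
  shows "int (l i j) dvd int (lookup m (T i j)) - int (lookup m' (T i j))"
proof -
  have key: "l i j dvd lookup m (T i j) - lookup m' (T i j)" if "eqv m m'" for m m'
  proof (rule root_of_unity_dvd)
    show "l i j > 0" using l1[of i j] assms by simp
    fix z :: 'k assume z: "z ^ l i j = 1"
    have z0: "z \<noteq> 0" using z \<open>l i j > 0\<close> by (auto simp: power_0_left)
    define t where "t = (\<lambda>w. if w = T i j then z else 1)"
    have t: "mon t m = z ^ lookup m (T i j)" for m
      using mon_support[of "{T i j}" t m] by (auto simp: t_def)
    have "mon t (lmono i') = 1" for i' unfolding t using z assms by (auto simp: lookup_lmono)
    moreover have "t w \<noteq> 0" for w by (simp add: t_def z0)
    ultimately have "t \<in> torus" unfolding torus_def by simp
    then have "mon t m = mon t m'" using that unfolding eqv_def by blast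
    then have eq: "z ^ lookup m (T i j) = z ^ lookup m' (T i j)" unfolding t .
    show "z ^ (lookup m (T i j) - lookup m' (T i j)) = 1"
      using eq z0 power_diff[of z "lookup m' (T i j)" "lookup m (T i j)"]
      by (cases "lookup m' (T i j) \<le> lookup m (T i j)") auto
  qed
  have "eqv m' m" using assms(1) by (simp add: eqv_def)
  show ?thesis
  proof (cases "lookup m' (T i j) \<le> lookup m (T i j)")
    case True
    then show ?thesis using key[OF assms(1)] by (metis int_dvd_int_iff of_nat_diff)
  next
    case False
    then have "int (l i j) dvd int (lookup m' (T i j)) - int (lookup m (T i j))"
      using key[OF \<open>eqv m' m\<close>] by (metis int_dvd_int_iff of_nat_diff linear)
    then show ?thesis by (subst dvd_diff_commute)
  qed
qed

lemma eqv_lattice: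
  assumes "eqv m m'"
  obtains q where "\<And>i j. i \<le> r \<Longrightarrow> j \<in> {1..n i} \<Longrightarrow>
      int (lookup m (T i j)) = int (lookup m' (T i j)) + q i * int (l i j)" "(\<Sum>i\<le>r. q i) = 0"
proof -
  define q where "q i = (int (lookup m (T i 1)) - int (lookup m' (T i 1))) div int (l i 1)" for i
  have q1: "int (lookup m (T i 1)) = int (lookup m' (T i 1)) + q i * int (l i 1)" if "i \<le> r" for i
    using eqv_dvd[OF assms that, of 1] n1[OF that] by (simp add: q_def)
  have "int (lookup m (T i j)) = int (lookup m' (T i j)) + q i * int (l i j)" if ij: "i \<le> r" "j \<in> {1..n i}" for i j
  proof -
    have p: "l i 1 > 0" using l1[of i 1] n1[of i] ij by simp
    have "l i 1 * lookup m (T i j) + l i j * lookup m' (T i 1) = l i 1 * lookup m' (T i j) + l i j * lookup m (T i 1)"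
      using eqv_minor[OF assms ij(1) ij(2), of 1] n1[of i] ij by simp
    then have "int (l i 1) * int (lookup m (T i j)) + int (l i j) * int (lookup m' (T i 1)) =
        int (l i 1) * int (lookup m' (T i j)) + int (l i j) * int (lookup m (T i 1))"
      by (simp only: of_nat_add[symmetric] of_nat_mult[symmetric])
    then have "int (l i 1) * (int (lookup m (T i j)) - (int (lookup m' (T i j)) + q i * int (l i j))) = 0"
      unfolding q1[OF ij(1)] by (simp add: algebra_simps)
    then show ?thesis using p by simp
  qed
  moreover have "(\<Sum>i\<le>r. q i) = 0"
  proof -
    define L where "L = (\<Prod>i\<le>r. l i 1)"
    have L: "L > 0" unfolding L_def using l1[of _ 1] n1 by (intro prod_pos) force
    have d: "l i 1 dvd L" if "i \<le> r" for i unfolding L_def using that by (intro dvd_prodI) auto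
    have "(\<Sum>i\<le>r. int (L div l i 1) * int (lookup m (T i 1))) = (\<Sum>i\<le>r. int (L div l i 1) * int (lookup m' (T i 1)))"
      using arg_cong[OF eqv_total[OF assms], of int] by (simp add: L_def)
    moreover have "(\<Sum>i\<le>r. int (L div l i 1) * int (lookup m (T i 1))) =
        (\<Sum>i\<le>r. int (L div l i 1) * int (lookup m' (T i 1)) + int L * q i)"
    proof (rule sum.cong[OF refl])
      fix i assume "i \<in> {..r}"
      then have "int (L div l i 1) * int (l i 1) = int L" using d[of i] by (metis dvd_div_mult_self of_nat_mult atMost_iff)
      then show "int (L div l i 1) * int (lookup m (T i 1)) = int (L div l i 1) * int (lookup m' (T i 1)) + int L * q i"
        using q1[of i] \<open>i \<in> _\<close> by (simp add: distrib_left mult.assoc[symmetric])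
    qed
    ultimately have "int L * (\<Sum>i\<le>r. q i) = 0" by (simp add: sum.distrib sum_distrib_left)
    then show ?thesis using L by simp
  qed
  ultimately show ?thesis using that by blast
qed

end

context scalar_hom
begin

definition homog :: "'b \<Rightarrow> 'b \<Rightarrow> 'k poly \<Rightarrow> nat \<Rightarrow> 'b" where
  "homog u v h E = (\<Sum>b\<le>E. c (coeff h b) * u ^ b * v ^ (E - b))"

lemma homog_add: "homog u v (h + h') E = homog u v h E + homog u v h' E"
  by (simp add: homog_def c_add algebra_simps sum.distrib)

lemma homog_smult: "homog u v (Polynomial.smult k h) E = c k * homog u v h E"
  by (simp add: homog_def c_mult sum_distrib_left mult.assoc)

lemma homog_sum: "homog u v (\<Sum>i\<in>J. h i) E = (\<Sum>i\<in>J. homog u v (h i) E)"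
  by (induction J rule: infinite_finite_induct) (auto simp: homog_add, simp_all add: homog_def)

lemma homog_pCons: "homog u v (pCons 0 h) (Suc E) = u * homog u v h E"
  unfolding homog_def by (subst sum.atMost_Suc_shift) (simp add: sum_distrib_left algebra_simps)

lemma homog_Suc: "coeff h (Suc E) = 0 \<Longrightarrow> homog u v h (Suc E) = v * homog u v h E"
proof -
  assume "coeff h (Suc E) = 0"
  then have "homog u v h (Suc E) = (\<Sum>b\<le>E. c (coeff h b) * u ^ b * v ^ (Suc E - b))" by (simp add: homog_def)
  also have "\<dots> = (\<Sum>b\<le>E. v * (c (coeff h b) * u ^ b * v ^ (E - b)))"
    by (rule sum.cong) (auto simp: Suc_diff_le)
  finally show ?thesis by (simp add: homog_def sum_distrib_left)
qed

lemma homog_linear: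
  assumes "degree h \<le> E"
  shows "homog u v ([:y, x:] * h) (Suc E) = (c x * u + c y * v) * homog u v h E"
proof -
  have "[:y, x:] * h = Polynomial.smult y h + pCons 0 (Polynomial.smult x h)" by (simp add: mult_pCons_left)
  moreover have "coeff h (Suc E) = 0" using assms by (simp add: coeff_eq_0)
  ultimately show ?thesis by (simp add: homog_add homog_smult homog_pCons homog_Suc algebra_simps)
qed

definition linear_forms where "linear_forms u v = {c x * u + c y * v | x y. (x, y) \<noteq> (0, 0)}"

end

lemma (in scalar_hom) homog_factor:
  fixes h :: "'k poly"
  assumes alg_closed: "\<And>p :: 'k poly. degree p > 0 \<Longrightarrow> \<exists>x. poly p x = 0" and "degree h \<le> E"
  shows "\<exists>k ws. homog u v h E = c k * prod_list ws \<and> set ws \<subseteq> linear_forms u v"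
  using assms(2)
proof (induction E arbitrary: h)
  case 0
  have "homog u v h 0 = c (coeff h 0) * prod_list []" by (simp add: homog_def)
  then show ?case by (intro exI[of _ "coeff h 0"] exI[of _ "[]"]) simp
next
  case (Suc E)
  have "\<exists>w h'. w \<in> linear_forms u v \<and> degree h' \<le> E \<and> homog u v h (Suc E) = w * homog u v h' E"
  proof (cases "coeff h (Suc E) = 0")
    case True
    then have "degree h \<le> E" using Suc(2) by (metis degree_0 le_SucE leading_coeff_0_iff le0)
    moreover have "v \<in> linear_forms u v" unfolding linear_forms_def
      by (rule CollectI, intro exI[of _ 0] exI[of _ 1]) simp
    ultimately show ?thesis using homog_Suc[OF True] by blast
  next
    case False
    then have "degree h = Suc E" using Suc(2) by (simp add: le_degree order_antisym)
    then obtain x where "poly h x = 0" using alg_closed[of h] by auto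
    then obtain h' where h': "h = [:- x, 1:] * h'" by (auto simp: poly_eq_0_iff_dvd)
    then have "h' \<noteq> 0" using \<open>degree h = Suc E\<close> by auto
    then have "degree h = Suc (degree h')" unfolding h' by (subst degree_mult_eq) auto
    then have "degree h' \<le> E" using \<open>degree h = Suc E\<close> by simp
    moreover have "c 1 * u + c (- x) * v \<in> linear_forms u v" unfolding linear_forms_def
      by (rule CollectI, intro exI[of _ 1] exI[of _ "- x"]) simp
    ultimately show ?thesis using homog_linear[of h' E u v "- x" 1] h' by blast
  qed
  then obtain w h' where w: "w \<in> linear_forms u v" "degree h' \<le> E" "homog u v h (Suc E) = w * homog u v h' E" by blast
  then obtain k ws where "homog u v h' E = c k * prod_list ws" "set ws \<subseteq> linear_forms u v" using Suc by blast
  then show ?case using w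
    by (intro exI[of _ k] exI[of _ "w # ws"]) (simp add: ac_simps)
qed

lemma (in scalar_hom) homog_prod_linear:
  fixes x y :: "nat \<Rightarrow> 'k"
  assumes "finite J"
  shows "\<exists>h. degree h \<le> (\<Sum>i\<in>J. k i) \<and> (\<Prod>i\<in>J. (c (x i) * u + c (y i) * v) ^ k i) = homog u v h (\<Sum>i\<in>J. k i)"
  using assms
proof (induction J rule: finite_induct)
  case empty
  show ?case by (intro exI[of _ 1]) (simp add: homog_def)
next
  case (insert i J)
  have step: "\<exists>h. degree h \<le> q + E \<and> (c x * u + c y * v) ^ q * homog u v h0 E = homog u v h (q + E)" if "degree h0 \<le> E" for x y q E h0
  proof (induction q)
    case (Suc q)
    then obtain h where h: "degree h \<le> q + E" "(c x * u + c y * v) ^ q * homog u v h0 E = homog u v h (q + E)" by blast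
    have "degree ([:y, x:] * h) \<le> degree [:y, x:] + degree h" by (rule degree_mult_le)
    also have "\<dots> \<le> Suc (q + E)" using h(1) by auto
    finally show ?case using h homog_linear[OF h(1), of u v y x]
      by (intro exI[of _ "[:y, x:] * h"]) (simp add: mult.assoc)
  qed (use that in auto)
  obtain h0 where h0: "degree h0 \<le> (\<Sum>i\<in>J. k i)"
      "(\<Prod>i\<in>J. (c (x i) * u + c (y i) * v) ^ k i) = homog u v h0 (\<Sum>i\<in>J. k i)"
    using insert by blast
  then obtain h where "degree h \<le> k i + (\<Sum>i\<in>J. k i)"
    "(c (x i) * u + c (y i) * v) ^ k i * homog u v h0 (\<Sum>i\<in>J. k i) = homog u v h (k i + (\<Sum>i\<in>J. k i))"
    using step by blast
  then show ?case using insert(1,2) h0 by (intro exI[of _ h]) simp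
qed

lemma lookup_mult_single_1:
  "lookup (p * single k (1::'k::comm_ring_1)) (m + k) = lookup p (m :: 'v \<Rightarrow>\<^sub>0 nat)"
proof -
  have "p * single k 1 = (\<Sum>m\<in>keys p. single (m + k) (lookup p m))"
    by (subst (1) poly_mapping_sum_single[of p]) (simp add: sum_distrib_right mult_single)
  then have "lookup (p * single k 1) (m + k) = (\<Sum>m'\<in>keys p. if m' = m then lookup p m else 0)"
    by (simp add: lookup_sum lookup_single when_def cong: sum.cong)
  then show ?thesis by (auto simp: in_keys_iff)
qed

locale trinomial_domain = trinomial_model r n l a c 0 g u v
  for r n l and a :: "nat \<Rightarrow> 'k::{alg_closed_field, field_char_0} ^ 2" and c :: "'k \<Rightarrow> 'b::idom" and g u v
begin

sublocale trinomial_torus r n l a ..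

abbreviation "G \<equiv> gens 0"

lemma c_eq_0_iff [simp]: "c x = 0 \<longleftrightarrow> x = 0"
  using c_inverse[of x] by (metis c_0 mult_zero_left zero_neq_one)

definition lf where "lf x y = c x * u + c y * v"

definition yy where "yy i = mon g (lmono i)"

lemma yy_eq: "i \<le> r \<Longrightarrow> yy i = lf (a i $ 1) (a i $ 2)"
  using g_lin[of i] by (simp add: yy_def mon_lmono lf_def)

lemma yy_\<phi>: "yy i = \<phi> (Y i)"
  by (simp add: yy_def Y_eq_single meval_single)

lemma yy_mem: "i \<le> r \<Longrightarrow> yy i \<in> A"
  unfolding yy_\<phi> using Y_PV by blast

lemma lf_basis:
  assumes "i \<le> r" "k \<le> r" "i \<noteq> k"
  obtains p q where "lf x y = c p * yy i + c q * yy k" "x = p * a i $ 1 + q * a k $ 1" "y = p * a i $ 2 + q * a k $ 2"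
proof (rule that)
  let ?p = "(x * a k $ 2 - a k $ 1 * y) / dt i k"
  let ?q = "(a i $ 1 * y - x * a i $ 2) / dt i k"
  note nz = dt_nz[OF assms]
  show x: "x = ?p * a i $ 1 + ?q * a k $ 1"
    using nz by (simp add: divide_simps) (simp add: dt_def algebra_simps)
  show y: "y = ?p * a i $ 2 + ?q * a k $ 2"
    using nz by (simp add: divide_simps) (simp add: dt_def algebra_simps)
  have "lf (p * a i $ 1 + q * a k $ 1) (p * a i $ 2 + q * a k $ 2) = c p * yy i + c q * yy k" for p q
    using yy_eq assms by (simp add: lf_def c_add c_mult algebra_simps)
  from this[of ?p ?q, folded x y] show "lf x y = c ?p * yy i + c ?q * yy k" .
qed

lemma lf_basis01:
  "\<exists>p q. lf x y = c p * yy 0 + c q * yy 1 \<and> x = p * a 0 $ 1 + q * a 1 $ 1 \<and> y = p * a 0 $ 2 + q * a 1 $ 2"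
proof (rule lf_basis[of 0 1 x y])
  fix p q assume "lf x y = c p * yy 0 + c q * yy 1" "x = p * a 0 $ 1 + q * a 1 $ 1" "y = p * a 0 $ 2 + q * a 1 $ 2"
  then show ?thesis by blast
qed (use r2 in auto)

lemma lf_mem: "lf x y \<in> A"
proof -
  obtain p q where "lf x y = c p * yy 0 + c q * yy 1" using lf_basis01 by blast
  moreover have "c p * yy 0 + c q * yy 1 \<in> A" using r2 by (intro A.add_mem A.mult_mem A.c_mem yy_mem) auto
  ultimately show ?thesis by simp
qed

lemma lf_eq_0_iff: "lf x y = 0 \<longleftrightarrow> x = 0 \<and> y = 0"
proof
  assume "lf x y = 0"
  obtain p q where pq: "lf x y = c p * yy 0 + c q * yy 1" "x = p * a 0 $ 1 + q * a 1 $ 1" "y = p * a 0 $ 2 + q * a 1 $ 2"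
    using lf_basis01 by blast
  let ?p = "single (lmono 0) p + single (lmono 1) q :: (generator, 'k) mpoly"
  have "?p = 0"
  proof (rule indep)
    show "?p \<in> PV (gens 0)" using r2 by (intro PV.add_mem single_PV keys_lmono) auto
    show "std m" if "m \<in> keys ?p" for m
    proof -
      have "m = lmono 0 \<or> m = lmono 1"
        using that keys_add[of "single (lmono 0) p" "single (lmono 1) q"] by (auto split: if_splits)
      moreover have "l i 1 > 0 \<and> 1 \<in> {1..n i}" if "i \<in> {2..r}" for i using l1[of i 1] n1[of i] that by simp
      ultimately show ?thesis unfolding std_def by (auto simp: lookup_lmono intro!: bexI[of _ 1])
    qed
    show "\<phi> ?p = 0" using \<open>lf x y = 0\<close> pq by (simp add: meval_add meval_single yy_def)
  qed
  have ne: "lookup (lmono 0) (T 0 1) \<noteq> lookup (lmono 1) (T 0 1)"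
    using l1[of 0 1] n1[of 0] by (simp add: lookup_lmono)
  then have "lmono 0 \<noteq> lmono 1" by metis
  then have "lookup ?p (lmono 0) = p" "lookup ?p (lmono 1) = q"
    by (auto simp: lookup_add lookup_single when_def)
  then have "p = 0" "q = 0" using \<open>?p = 0\<close> by (metis lookup_zero)+
  then show "x = 0 \<and> y = 0" using pq by simp
qed (simp add: lf_def)

lemma yy_nz: "i \<le> r \<Longrightarrow> yy i \<noteq> 0"
proof -
  assume i: "i \<le> r"
  obtain k where "k \<le> r" "k \<noteq> i" using r2 by (metis le_trans one_le_numeral zero_le zero_neq_one)
  then have "dt i k \<noteq> 0" using dt_nz i by simp
  then show ?thesis unfolding yy_eq[OF i] lf_eq_0_iff by (auto simp: dt_def)
qed

lemma yy_prod: "yy i = (\<Prod>j = 1..n i. g (T i j) ^ l i j)"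
  by (simp add: yy_def mon_lmono)

lemma g_nz: "w \<in> G \<Longrightarrow> g w \<noteq> 0"
proof (cases w)
  case (T i j)
  assume "w \<in> G"
  then have ij: "i \<le> r" "j \<in> {1..n i}" by (auto simp: T gens_T)
  then have "g (T i j) ^ l i j \<noteq> 0" using yy_nz[OF ij(1)] unfolding yy_prod by (auto simp: prod_zero_iff)
  then show ?thesis using l1[of i j] ij by (auto simp: T power_0_left)
qed (simp add: gens_S)

lemma G_cases:
  assumes "w \<in> G" obtains i j where "w = T i j" "i \<le> r" "j \<in> {1..n i}"
  using assms by (cases w) (auto simp: gens_T gens_S)

lemma mon_mem: "keys m \<subseteq> G \<Longrightarrow> mon g m \<in> A"
  unfolding mon_def by (intro A.prod_mem A.power_mem g_mem) auto

lemma linear_forms_eq: "linear_forms u v = {lf x y | x y. (x, y) \<noteq> (0, 0)}"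
  by (simp add: linear_forms_def lf_def)

lemma homogeneous_factor:
  assumes p: "p \<in> PV G" and m0: "m0 \<in> keys p"
    and eqv: "\<And>m. m \<in> keys p \<Longrightarrow> eqv m0 m"
  shows "\<exists>k b ws. keys b \<subseteq> G \<and> set ws \<subseteq> linear_forms u v \<and> \<phi> p = c k * mon g b * prod_list ws"
proof -
  have kG: "keys m \<subseteq> G" if "m \<in> keys p" for m using p that by (simp add: PV_iff)
  define e where "e i = Min ((\<lambda>j. lookup m0 (T i j) div l i j) ` {1..n i})" for i
  have e_le: "e i * l i j \<le> lookup m0 (T i j)" if "i \<le> r" "j \<in> {1..n i}" for i j
  proof -
    have "e i \<le> lookup m0 (T i j) div l i j" unfolding e_def using that by (intro Min_le) auto
    then have "e i * l i j \<le> (lookup m0 (T i j) div l i j) * l i j" by simp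
    also have "\<dots> \<le> lookup m0 (T i j)" by simp
    finally show ?thesis .
  qed
  have e_ex: "\<exists>j\<in>{1..n i}. e i = lookup m0 (T i j) div l i j" if "i \<le> r" for i
  proof -
    have "e i \<in> (\<lambda>j. lookup m0 (T i j) div l i j) ` {1..n i}" unfolding e_def using n1[OF that] by (intro Min_in) auto
    then show ?thesis by blast
  qed
  define b where "b = m0 - (\<Sum>i\<le>r. \<Sum>x<e i. lmono i)"
  have lb: "lookup b (T i j) = lookup m0 (T i j) - e i * l i j" if "i \<le> r" "j \<in> {1..n i}" for i j
  proof -
    have "lookup (\<Sum>i\<le>r. \<Sum>x<e i. lmono i) (T i j) = (\<Sum>i'\<le>r. \<Sum>x<e i'. lookup (lmono i') (T i j))"
      by (simp only: lookup_sum)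
    also have "\<dots> = (\<Sum>i'\<le>r. if i' = i then e i * l i j else 0)"
      using that by (intro sum.cong) (auto simp: lookup_lmono)
    also have "\<dots> = e i * l i j" using that by simp
    finally show ?thesis unfolding b_def lookup_minus by simp
  qed
  have kb: "keys b \<subseteq> G"
    using kG[OF m0] unfolding b_def by (auto simp: in_keys_iff lookup_minus)
  define E where "E = (\<Sum>i\<le>r. e i)"
  have form: "\<exists>h. degree h \<le> E \<and> mon g m = mon g b * homog u v h E" if m: "m \<in> keys p" for m
  proof -
    have "eqv m m0" using eqv[OF m] by (simp add: eqv_def)
    have "\<exists>q. (\<forall>i j. i \<le> r \<longrightarrow> j \<in> {1..n i} \<longrightarrow>
        int (lookup m (T i j)) = int (lookup m0 (T i j)) + q i * int (l i j)) \<and> (\<Sum>i\<le>r. q i) = 0"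
      by (rule eqv_lattice[OF \<open>eqv m m0\<close>]) blast
    then obtain q where q: "\<And>i j. i \<le> r \<Longrightarrow> j \<in> {1..n i} \<Longrightarrow>
      int (lookup m (T i j)) = int (lookup m0 (T i j)) + q i * int (l i j)" "(\<Sum>i\<le>r. q i) = 0"
      by blast
    define k where "k i = nat (int (e i) + q i)" for i
    have k: "int (k i) = int (e i) + q i" if i: "i \<le> r" for i
    proof -
      obtain j where j: "j \<in> {1..n i}" "e i = lookup m0 (T i j) div l i j" using e_ex[OF i] by blast
      have l: "l i j > 0" using l1[of i j] i j by simp
      have "lookup m0 (T i j) mod l i j < l i j" using l by simp
      moreover have "lookup m0 (T i j) = e i * l i j + lookup m0 (T i j) mod l i j" using j by simp
      ultimately have "int (lookup m0 (T i j)) < (int (e i) + 1) * int (l i j)"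
        by (simp add: algebra_simps) (metis add.commute nat_add_left_cancel_less of_nat_add of_nat_less_iff of_nat_mult)
      then have "0 < (int (e i) + 1 + q i) * int (l i j)" using q(1)[OF i j(1)] by (simp add: algebra_simps)
      then have "0 < int (e i) + 1 + q i" using l by (simp add: zero_less_mult_iff)
      then show ?thesis by (simp add: k_def)
    qed
    have "mon g m = mon g b * (\<Prod>i\<le>r. mon g (lmono i) ^ k i)"
    proof (rule prod_lmono_decomp[OF kG[OF m] kb])
      fix i j assume ij: "i \<le> r" "j \<in> {1..n i}"
      have "int (lookup m (T i j)) = int (lookup b (T i j) + k i * l i j)"
        using q(1)[OF ij] k[OF ij(1)] lb[OF ij] e_le[OF ij] by (simp add: of_nat_diff algebra_simps)
      then show "lookup m (T i j) = lookup b (T i j) + k i * l i j" by (simp only: of_nat_eq_iff)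
    qed
    moreover have "(\<Prod>i\<le>r. mon g (lmono i) ^ k i) = (\<Prod>i\<le>r. (c (a i $ 1) * u + c (a i $ 2) * v) ^ k i)"
      using yy_eq by (intro prod.cong) (auto simp: yy_def lf_def)
    moreover have "(\<Sum>i\<le>r. k i) = E"
    proof -
      have "int (\<Sum>i\<le>r. k i) = (\<Sum>i\<le>r. int (e i) + q i)" using k by simp
      also have "\<dots> = int E" using q(2) by (simp add: sum.distrib E_def)
      finally show ?thesis by (simp only: of_nat_eq_iff)
    qed
    ultimately show ?thesis using homog_prod_linear[of "{..r}" k "\<lambda>i. a i $ 1" u "\<lambda>i. a i $ 2" v] by auto
  qed
  then obtain h where h: "\<And>m. m \<in> keys p \<Longrightarrow> degree (h m) \<le> E \<and> mon g m = mon g b * homog u v (h m) E"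
    by metis
  let ?H = "\<Sum>m\<in>keys p. Polynomial.smult (lookup p m) (h m)"
  have "\<phi> p = (\<Sum>m\<in>keys p. c (lookup p m) * (mon g b * homog u v (h m) E))"
    unfolding meval_def using h by (intro sum.cong) auto
  also have "\<dots> = mon g b * homog u v ?H E"
    by (simp add: homog_sum homog_smult sum_distrib_left algebra_simps)
  finally have "\<phi> p = mon g b * homog u v ?H E" .
  moreover have "degree ?H \<le> E"
    using h by (intro degree_sum_le) (auto intro: order_trans[OF degree_smult_le])
  then obtain k ws where "homog u v ?H E = c k * prod_list ws" "set ws \<subseteq> linear_forms u v"
    using homog_factor[of ?H E u v] alg_closed_imp_poly_has_root by blast
  ultimately have "\<phi> p = c k * mon g b * prod_list ws" by (simp add: ac_simps)
  then show ?thesis using kb \<open>set ws \<subseteq> _\<close> by blast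
qed

lemma euler_exists:
  assumes e: "\<And>i. i \<le> r \<Longrightarrow> (\<Sum>j = 1..n i. of_nat (l i j) * e (T i j)) = \<mu>"
  obtains E where "derivation M E" "\<And>w. w \<in> G \<Longrightarrow> E (g w) = c (e w) * g w" "\<And>x y. E (lf x y) = c \<mu> * lf x y"
proof -
  have "\<exists>E. derivation M E \<and> (\<forall>w\<in>G. E (g w) = c (e w) * g w)"
  proof (rule derivation_exists[of "\<lambda>w. c (e w) * g w" "c \<mu> * u" "c \<mu> * v"])
    show "c (e w) * g w \<in> A" if "w \<in> G" for w using that by (intro A.mult_mem A.c_mem g_mem)
    fix i assume i: "i \<le> r"
    have "(\<Sum>j = 1..n i. of_nat (l i j) * g (T i j) ^ (l i j - 1) * (c (e (T i j)) * g (T i j)) *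
          (\<Prod>j'\<in>{1..n i} - {j}. g (T i j') ^ l i j')) = (\<Sum>j = 1..n i. c (of_nat (l i j) * e (T i j)) * yy i)"
    proof (rule sum.cong[OF refl])
      fix j assume j: "j \<in> {1..n i}"
      have "yy i = g (T i j) ^ l i j * (\<Prod>j'\<in>{1..n i} - {j}. g (T i j') ^ l i j')"
        unfolding yy_prod using j by (simp add: prod.remove)
      moreover have "g (T i j) ^ l i j = g (T i j) ^ (l i j - 1) * g (T i j)"
        using l1[of i j] i j by (cases "l i j") auto
      ultimately show "of_nat (l i j) * g (T i j) ^ (l i j - 1) * (c (e (T i j)) * g (T i j)) *
          (\<Prod>j'\<in>{1..n i} - {j}. g (T i j') ^ l i j') = c (of_nat (l i j) * e (T i j)) * yy i"
        by (simp add: c_mult algebra_simps)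
    qed
    also have "\<dots> = c \<mu> * yy i" by (simp add: e[OF i, symmetric] c_sum sum_distrib_right)
    finally show "(\<Sum>j = 1..n i. of_nat (l i j) * g (T i j) ^ (l i j - 1) * (c (e (T i j)) * g (T i j)) *
          (\<Prod>j'\<in>{1..n i} - {j}. g (T i j') ^ l i j')) = c (a i $ 1) * (c \<mu> * u) + c (a i $ 2) * (c \<mu> * v)"
      using yy_eq[OF i] by (simp add: lf_def algebra_simps)
  qed blast
  then obtain E where E: "derivation M E" "\<And>w. w \<in> G \<Longrightarrow> E (g w) = c (e w) * g w" by blast
  interpret E: subalg_derivation c A E by unfold_locales (rule E)
  have prod: "E (\<Prod>w\<in>W. g w ^ k w) = c (\<Sum>w\<in>W. of_nat (k w) * e w) * (\<Prod>w\<in>W. g w ^ k w)"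
    if "finite W" "W \<subseteq> G" for W k
    using that
  proof (induction W rule: finite_induct)
    case (insert w W)
    have m: "g w \<in> A" "(\<Prod>w\<in>W. g w ^ k w) \<in> A" using insert by (auto intro!: A.prod_mem A.power_mem g_mem)
    have "E (g w ^ k w) = (of_nat (k w) * (g w ^ (k w - 1) * g w)) * c (e w)"
      unfolding E.d_power[OF m(1)] using E(2)[of w] insert by (simp add: ac_simps)
    also have "of_nat (k w) * (g w ^ (k w - 1) * g w) = of_nat (k w) * g w ^ k w"
      by (cases "k w") (auto simp: mult.commute)
    finally have "E (g w ^ k w) = c (of_nat (k w) * e w) * g w ^ k w" by (simp add: c_mult ac_simps)
    then show ?case using insert m E.d_mult[of "g w ^ k w" "\<Prod>w\<in>W. g w ^ k w"]
      by (simp add: A.power_mem c_add algebra_simps)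
  qed simp
  have yy: "E (yy i) = c \<mu> * yy i" if i: "i \<le> r" for i
  proof -
    have y: "yy i = (\<Prod>w\<in>T i ` {1..n i}. g w ^ (case w of T i j \<Rightarrow> l i j | S k \<Rightarrow> 0))"
      unfolding yy_prod by (subst prod.reindex) (auto simp: inj_on_def)
    have "(\<Sum>w\<in>T i ` {1..n i}. of_nat (case w of T i j \<Rightarrow> l i j | S k \<Rightarrow> 0) * e w) = \<mu>"
      using e[OF i] by (subst sum.reindex) (auto simp: inj_on_def)
    moreover have "T i ` {1..n i} \<subseteq> G" using i by (auto simp: gens_T)
    ultimately show ?thesis unfolding y
      using prod[of "T i ` {1..n i}" "\<lambda>w. case w of T i j \<Rightarrow> l i j | S k \<Rightarrow> 0"] by simp
  qed
  have "E (lf x y) = c \<mu> * lf x y" for x y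
  proof -
    obtain p q where "lf x y = c p * yy 0 + c q * yy 1" using lf_basis01 by blast
    then show ?thesis using r2 yy_mem[of 0] yy_mem[of 1] yy[of 0] yy[of 1]
      by (simp add: E.d_add E.d_scale A.mult_mem algebra_simps)
  qed
  then show ?thesis using E that by blast
qed

lemma scaling_iso:
  assumes t: "t \<in> torus"
  obtains \<tau> where "module_iso \<tau> M M" "\<And>p. p \<in> PV G \<Longrightarrow> \<tau> (\<phi> p) = meval c (\<lambda>w. c (t w) * g w) p"
proof -
  define t' where "t' = (\<lambda>w. inverse (t w))"
  have tt: "t w * t' w = 1" "t' w * t w = 1" for w using t by (auto simp: t'_def torus_def)
  have "mon t m * mon t' m = 1" for m
    using mon_mult[of t t' m] by (simp add: tt mon_def)
  then have inv: "mon t' m = inverse (mon t m)" for m by (metis inverse_unique)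
  have mt: "mon t (lmono i) = mon t (lmono 0)" "mon t' (lmono i) = mon t' (lmono 0)" if "i \<le> r" for i
  proof -
    show "mon t (lmono i) = mon t (lmono 0)" using t that unfolding torus_def by blast
    then show "mon t' (lmono i) = mon t' (lmono 0)" unfolding inv by (rule arg_cong)
  qed
  obtain \<tau> where \<tau>: "\<And>p. p \<in> PV G \<Longrightarrow> \<tau> (\<phi> p) = meval c (\<lambda>w. c (t w) * g w) p"
    using scaling_exists[of t "mon t (lmono 0)"] mt(1)[unfolded mon_lmono[of t]] unfolding mon_lmono by blast
  obtain \<tau>' where \<tau>': "\<And>p. p \<in> PV G \<Longrightarrow> \<tau>' (\<phi> p) = meval c (\<lambda>w. c (t' w) * g w) p"
    using scaling_exists[of t' "mon t' (lmono 0)"] mt(2)[unfolded mon_lmono[of t']] unfolding mon_lmono by blast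
  have sc: "\<exists>q\<in>PV G. meval c (\<lambda>w. c (s w) * g w) p = \<phi> q \<and>
      meval c (\<lambda>w. c (s' w) * g w) q = \<phi> p" if "p \<in> PV G" "\<And>w. s w * s' w = 1" for p and s s' :: "generator \<Rightarrow> 'k"
    using that(1)
  proof (induction rule: PV_induct)
    case (Const k) then show ?case by (intro bexI[of _ "Const k"]) auto
  next
    case (Var w) then show ?case
      using that(2)[of w] by (intro bexI[of _ "Const (s w) * Var w"])
        (auto simp: PV.mult_mem meval_mult mult.assoc[symmetric] simp flip: c_mult)
  next
    case (add p p')
    then obtain q q' where "q \<in> PV G" "q' \<in> PV G" "meval c (\<lambda>w. c (s w) * g w) p = \<phi> q"
      "meval c (\<lambda>w. c (s' w) * g w) q = \<phi> p" "meval c (\<lambda>w. c (s w) * g w) p' = \<phi> q'"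
      "meval c (\<lambda>w. c (s' w) * g w) q' = \<phi> p'" by blast
    then show ?case by (intro bexI[of _ "q + q'"]) (auto simp: PV.add_mem meval_add)
  next
    case (mult p p')
    then obtain q q' where "q \<in> PV G" "q' \<in> PV G" "meval c (\<lambda>w. c (s w) * g w) p = \<phi> q"
      "meval c (\<lambda>w. c (s' w) * g w) q = \<phi> p" "meval c (\<lambda>w. c (s w) * g w) p' = \<phi> q'"
      "meval c (\<lambda>w. c (s' w) * g w) q' = \<phi> p'" by blast
    then show ?case by (intro bexI[of _ "q * q'"]) (auto simp: PV.mult_mem meval_mult)
  qed
  have 1: "\<tau> x \<in> A \<and> \<tau>' (\<tau> x) = x" if "x \<in> A" for x
  proof -
    obtain p where p: "p \<in> PV G" "x = \<phi> p" using \<open>x \<in> A\<close> by blast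
    show ?thesis using sc[of p t t'] p tt \<tau> \<tau>' by auto
  qed
  have 2: "\<tau>' x \<in> A \<and> \<tau> (\<tau>' x) = x" if "x \<in> A" for x
  proof -
    obtain p where p: "p \<in> PV G" "x = \<phi> p" using \<open>x \<in> A\<close> by blast
    show ?thesis using sc[of p t' t] p tt \<tau> \<tau>' by auto
  qed
  have "module_iso \<tau> M M"
    unfolding module_iso_def subalg_module_simps
  proof (intro conjI ballI allI)
    show "bij_betw \<tau> A A" using 1 2 by (intro bij_betwI[of _ _ _ \<tau>']) auto
    show "\<tau> 0 = 0" using \<tau>[of 0] by (simp add: PV.zero_mem)
    show "0 \<in> A" by (rule A.zero_mem)
  next
    fix x y assume "x \<in> A" "y \<in> A"
    then obtain p q where p: "p \<in> PV G" "x = \<phi> p" "q \<in> PV G" "y = \<phi> q" by blast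
    show "x + y \<in> A" "x * y \<in> A" using \<open>x \<in> A\<close> \<open>y \<in> A\<close> by (auto simp: A.add_mem A.mult_mem)
    show "\<tau> (x + y) = \<tau> x + \<tau> y" "\<tau> (x * y) = \<tau> x * \<tau> y"
      using p \<tau>[of p] \<tau>[of q] \<tau>[of "p + q"] \<tau>[of "p * q"] by (auto simp: PV.add_mem PV.mult_mem meval_add meval_mult)
  next
    fix k x assume "x \<in> A"
    then obtain p where p: "p \<in> PV G" "x = \<phi> p" by blast
    show "c k * x \<in> A" using \<open>x \<in> A\<close> by (auto simp: A.mult_mem)
    show "\<tau> (c k * x) = c k * \<tau> x"
      using p \<tau>[of p] \<tau>[of "Const k * p"] by (simp add: PV.mult_mem meval_mult)
  qed
  then show ?thesis using that \<tau> by blast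
qed

end

section \<open>The kernel in the semirigid case\<close>

locale trinomial_semirigid = trinomial_domain r n l a c g u v
  for r n l and a :: "nat \<Rightarrow> 'k::{alg_closed_field, field_char_0} ^ 2" and c :: "'k \<Rightarrow> 'b::idom" and g u v +
  fixes \<delta>
  assumes semirigid: "semirigid (subalg_module c (meval c g ` PV (gens 0)))"
    and nonzero: "nonzero_LND (subalg_module c (meval c g ` PV (gens 0))) \<delta>"
begin

sublocale d: subalg_LND c A \<delta>
  using nonzero by unfold_locales (auto simp: nonzero_LND_def LND_def)

lemma semirigid_kernel:
  assumes "nonzero_LND M \<delta>'" shows "{x \<in> A. \<delta>' x = 0} = {x \<in> A. \<delta> x = 0}"
  using semirigid nonzero assms unfolding semirigid_def equivalent_LND_def a_kernel_subalg_module by blast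

lemma torus_kernel:
  assumes "t \<in> torus" "p \<in> PV G" "\<delta> (\<phi> p) = 0"
  shows "\<delta> (meval c (\<lambda>w. c (t w) * g w) p) = 0"
proof -
  obtain \<tau> where \<tau>: "module_iso \<tau> M M" "\<And>p. p \<in> PV G \<Longrightarrow> \<tau> (\<phi> p) = meval c (\<lambda>w. c (t w) * g w) p"
    using scaling_iso[OF assms(1)] by blast
  have "\<tau> ` {x \<in> A. \<delta> x = 0} = {x \<in> A. \<delta> x = 0}"
    using semirigid_kernel[OF nonzero_LND_transport(1)[OF \<tau>(1) nonzero]] nonzero_LND_transport(2)[OF \<tau>(1) nonzero]
    unfolding a_kernel_subalg_module by simp
  moreover have "\<phi> p \<in> {x \<in> A. \<delta> x = 0}" using assms by simp
  ultimately have "\<tau> (\<phi> p) \<in> {x \<in> A. \<delta> x = 0}" by (metis (no_types, lifting) imageI)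
  then show ?thesis using \<tau>(2)[OF assms(2)] by simp
qed

definition restr :: "(generator \<Rightarrow>\<^sub>0 nat) \<Rightarrow> (generator, 'k) mpoly \<Rightarrow> (generator, 'k) mpoly" where
  "restr m0 p = (\<Sum>m\<in>{m \<in> keys p. eqv m0 m}. single m (lookup p m))"

lemma lookup_restr: "lookup (restr m0 p) m = (if eqv m0 m then lookup p m else 0)"
proof -
  have "lookup (restr m0 p) m = (\<Sum>m'\<in>{m \<in> keys p. eqv m0 m}. if m' = m then lookup p m else 0)"
    unfolding restr_def lookup_sum by (intro sum.cong) (auto simp: lookup_single when_def)
  then show ?thesis by (auto simp: in_keys_iff)
qed

lemma keys_restr: "keys (restr m0 p) = {m \<in> keys p. eqv m0 m}"
  by (auto simp: in_keys_iff lookup_restr split: if_splits)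

lemma restr_PV: "p \<in> PV G \<Longrightarrow> restr m0 p \<in> PV G"
  by (simp add: PV_iff keys_restr)

text \<open>Subtracting from a scaled polynomial a multiple of itself removes one weight; this
  shows that the weight components of a kernel element lie in the kernel.\<close>

lemma restr_kernel: "p \<in> PV G \<Longrightarrow> \<delta> (\<phi> p) = 0 \<Longrightarrow> \<delta> (\<phi> (restr m0 p)) = 0"
proof (induction "card (keys p)" arbitrary: p rule: less_induct)
  case less
  show ?case
  proof (cases "\<exists>m2\<in>keys p. \<not> eqv m0 m2")
    case False
    then have "restr m0 p = p" by (intro poly_mapping_eqI) (auto simp: lookup_restr in_keys_iff)
    then show ?thesis using less by simp
  next
    case True
    then obtain m2 t where m2: "m2 \<in> keys p" and t: "t \<in> torus" "mon t m0 \<noteq> mon t m2"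
      unfolding eqv_def by blast
    define q where "q = (\<Sum>m\<in>keys p. single m (lookup p m * (mon t m - mon t m2)))"
    have lq: "lookup q m = lookup p m * (mon t m - mon t m2)" for m
    proof -
      have "lookup q m = (\<Sum>m'\<in>keys p. if m' = m then lookup p m * (mon t m - mon t m2) else 0)"
        unfolding q_def lookup_sum by (intro sum.cong) (auto simp: lookup_single when_def)
      then show ?thesis by (auto simp: in_keys_iff)
    qed
    have kq: "keys q \<subseteq> keys p - {m2}" by (auto simp: in_keys_iff lq)
    have qPV: "q \<in> PV G" using less(2) kq by (auto simp: PV_iff)
    have "\<phi> q = meval c (\<lambda>w. c (t w) * g w) p - c (mon t m2) * \<phi> p"
    proof -
      have "\<phi> q = (\<Sum>m\<in>keys p. c (lookup p m * (mon t m - mon t m2)) * mon g m)"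
        by (simp add: q_def meval_sum meval_single)
      also have "\<dots> = (\<Sum>m\<in>keys p. c (lookup p m) * mon (\<lambda>w. c (t w) * g w) m) - c (mon t m2) * (\<Sum>m\<in>keys p. c (lookup p m) * mon g m)"
        by (simp add: c_mult c_diff c_mon mon_mult algebra_simps sum_subtractf sum_distrib_left)
      finally show ?thesis by (simp add: meval_def)
    qed
    moreover have "meval c (\<lambda>w. c (t w) * g w) p \<in> A"
    proof -
      obtain \<tau> where \<tau>: "module_iso \<tau> M M" "\<And>p. p \<in> PV G \<Longrightarrow> \<tau> (\<phi> p) = meval c (\<lambda>w. c (t w) * g w) p"
        using scaling_iso[OF t(1)] by blast
      have "bij_betw \<tau> A A" using \<tau>(1) by (simp add: module_iso_def)
      then have "\<tau> (\<phi> p) \<in> A" by (rule bij_betwE[rule_format]) (use less(2) in blast)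
      then show ?thesis unfolding \<tau>(2)[OF less(2)] .
    qed
    ultimately have "\<delta> (\<phi> q) = 0" using torus_kernel[OF t(1) less(2,3)] less(2,3)
      by (simp add: d.d_diff d.d_scale A.mult_mem)
    moreover have "card (keys q) < card (keys p)"
      using kq m2 by (intro psubset_card_mono) auto
    ultimately have "\<delta> (\<phi> (restr m0 q)) = 0" using less(1) qPV by blast
    moreover have "restr m0 q = Const (mon t m0 - mon t m2) * restr m0 p"
    proof (rule poly_mapping_eqI)
      fix m
      have "lookup (Const k * p) m = k * lookup p m" for k and p :: "(generator, 'k) mpoly"
        using lookup_mult_single_1[of p 0 m] by (simp add: Const_def mult_map_scale_conv_mult[symmetric] Poly_Mapping.map.rep_eq when_def)
      then show "lookup (restr m0 q) m = lookup (Const (mon t m0 - mon t m2) * restr m0 p) m"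
        using t(1) by (auto simp: lookup_restr lq eqv_def)
    qed
    ultimately have "c (mon t m0 - mon t m2) * \<delta> (\<phi> (restr m0 p)) = 0"
      using restr_PV[OF less(2)] by (simp add: meval_mult d.d_scale)
    then show ?thesis using t(2) by simp
  qed
qed

lemma kernel_induct [consumes 2, case_names zero add prod]:
  assumes x: "x \<in> A" "\<delta> x = 0"
    and Q: "Q 0" "\<And>x y. x \<in> A \<Longrightarrow> y \<in> A \<Longrightarrow> Q x \<Longrightarrow> Q y \<Longrightarrow> Q (x + y)"
    "\<And>k b ws. keys b \<subseteq> G \<Longrightarrow> (\<And>w. w \<in> keys b \<Longrightarrow> \<delta> (g w) = 0) \<Longrightarrow>
      (\<And>w. w \<in> set ws \<Longrightarrow> w \<in> linear_forms u v \<and> \<delta> w = 0) \<Longrightarrow> Q (c k * mon g b * prod_list ws)"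
  shows "Q x"
proof -
  have hom: "Q (\<phi> p)" if p: "p \<in> PV G" "m0 \<in> keys p" "\<And>m. m \<in> keys p \<Longrightarrow> eqv m0 m" "\<delta> (\<phi> p) = 0" for p m0
  proof (cases "\<phi> p = 0")
    case False
    obtain k b ws where f: "keys b \<subseteq> G" "set ws \<subseteq> linear_forms u v" "\<phi> p = c k * mon g b * prod_list ws"
      using homogeneous_factor[OF p(1-3)] by blast
    have ws: "set ws \<subseteq> A" using f(2) lf_mem unfolding linear_forms_eq by auto
    have pl: "prod_list ws \<in> A" if "set ws \<subseteq> A" for ws
      using that by (induction ws) (auto simp: A.mult_mem A.one_mem)
    note [intro] = A.mult_mem A.c_mem mon_mem[OF f(1)] pl[OF ws]
    have nz: "c k * (mon g b * prod_list ws) \<noteq> 0" "mon g b * prod_list ws \<noteq> 0" using False f by (auto simp: mult.assoc)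
    have "\<delta> (c k * (mon g b * prod_list ws)) = 0" using p(4) f(3) by (simp add: mult.assoc)
    then have "\<delta> (mon g b * prod_list ws) = 0" using d.Ker_factorial(2)[OF _ _ nz(1)] by blast
    then have 1: "\<delta> (mon g b) = 0" and 2: "\<delta> (prod_list ws) = 0"
      using d.Ker_factorial[OF _ _ nz(2)] by blast+
    have "\<delta> w = 0" if "w \<in> set ws" "prod_list ws \<noteq> 0" "\<delta> (prod_list ws) = 0" "set ws \<subseteq> A" for w ws
      using that
    proof (induction ws)
      case (Cons z ws)
      then have "z \<in> A" "prod_list ws \<in> A" "z * prod_list ws \<noteq> 0" "\<delta> (z * prod_list ws) = 0" using pl by auto
      then show ?case using d.Ker_factorial[of z "prod_list ws"] Cons by auto
    qed simp
    then have 3: "\<delta> w = 0" if "w \<in> set ws" for w using that 2 ws nz(2) by auto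
    have "\<delta> (g w) = 0" if w: "w \<in> keys b" for w
    proof -
      have gA: "g w \<in> A" if "w \<in> keys b" for w using that f(1) g_mem by blast
      have "\<delta> (g w ^ lookup b w) = 0"
        using d.Ker_prod[of "keys b" "\<lambda>w. g w ^ lookup b w" w] 1 nz(2) w gA
        unfolding mon_def by (auto simp: A.power_mem)
      then show ?thesis using d.Ker_power[OF gA[OF w], of "lookup b w"] w by (auto simp: in_keys_iff)
    qed
    then show ?thesis unfolding f(3) using f(1,2) 3 by (intro Q(3)) auto
  qed (simp add: Q)
  have "Q (\<phi> p)" if "p \<in> PV G" "\<delta> (\<phi> p) = 0" for p
    using that
  proof (induction "card (keys p)" arbitrary: p rule: less_induct)
    case less
    show ?case
    proof (cases "p = 0")
      case False
      then obtain m0 where m0: "m0 \<in> keys p" using keys_eq_empty by blast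
      let ?r = "restr m0 p"
      have r: "?r \<in> PV G" "\<delta> (\<phi> ?r) = 0" using restr_PV restr_kernel less by auto
      have em: "eqv m0 m0" by (simp add: eqv_def)
      have "Q (\<phi> ?r)" by (rule hom[OF r(1) _ _ r(2), of m0]) (auto simp: keys_restr m0 em)
      moreover have "keys (p - ?r) \<subseteq> keys p - {m0}"
        using em by (auto simp: in_keys_iff lookup_minus lookup_restr split: if_splits)
      then have "card (keys (p - ?r)) < card (keys p)"
        using m0 by (intro psubset_card_mono) auto
      then have "Q (\<phi> (p - ?r))" using less r
        by (intro less(1)) (auto simp: PV.diff_mem meval_diff d.d_diff)
      ultimately have "Q (\<phi> ?r + \<phi> (p - ?r))" using less(2) r by (intro Q(2)) (auto simp: PV.diff_mem)
      then show ?thesis by (simp add: meval_diff)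
    qed (simp add: Q)
  qed
  then show ?thesis using x by blast
qed

lemma euler_kills_kernel:
  assumes "derivation M E" "\<And>w. w \<in> G \<Longrightarrow> \<delta> (g w) = 0 \<Longrightarrow> E (g w) = 0"
    "\<And>z. z \<in> linear_forms u v \<Longrightarrow> \<delta> z = 0 \<Longrightarrow> E z = 0" and x: "x \<in> A" "\<delta> x = 0"
  shows "E x = 0"
  using x
proof (induction rule: kernel_induct)
  case (prod k b ws)
  interpret E: subalg_derivation c A E by unfold_locales (rule assms)
  have K: "subalgebra c {x \<in> A. E x = 0}"
    by unfold_locales (auto simp: A.add_mem A.mult_mem E.d_add E.d_mult)
  have "mon g b \<in> {x \<in> A. E x = 0}"
    unfolding mon_def using prod assms(2) g_mem
    by (intro subalgebra.prod_mem[OF K] subalgebra.power_mem[OF K]) blast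
  moreover have "prod_list ws \<in> {x \<in> A. E x = 0}" using prod(3)
  proof (induction ws)
    case (Cons w ws)
    then have w: "w \<in> linear_forms u v" "\<delta> w = 0" by auto
    then have "w \<in> A" using lf_mem unfolding linear_forms_eq by blast
    then have "w \<in> {x \<in> A. E x = 0}" using assms(3)[OF w] by simp
    moreover have "prod_list ws \<in> {x \<in> A. E x = 0}" using Cons by simp
    ultimately show ?case unfolding prod_list.Cons by (rule subalgebra.mult_mem[OF K])
  qed (use subalgebra.one_mem[OF K] in simp)
  ultimately have "c k * mon g b * prod_list ws \<in> {x \<in> A. E x = 0}"
    by (intro subalgebra.mult_mem[OF K] subalgebra.c_mem[OF K])
  then show ?case by simp
next
  case (add x y)
  interpret E: subalg_derivation c A E by unfold_locales (rule assms)
  show ?case using add by (simp add: E.d_add)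
next
  case zero
  interpret E: subalg_derivation c A E by unfold_locales (rule assms)
  show ?case by simp
qed

lemma unique_nonconstant:
  assumes i: "i \<le> r" and j: "j \<in> {1..n i}" "j' \<in> {1..n i}" "j \<noteq> j'"
    and nz: "\<delta> (g (T i j)) \<noteq> 0" "\<delta> (g (T i j')) \<noteq> 0"
  shows False
proof -
  define e :: "generator \<Rightarrow> 'k" where
    "e = (\<lambda>w. if w = T i j then of_nat (l i j') else if w = T i j' then - of_nat (l i j) else 0)"
  have "(\<Sum>j''=1..n i'. of_nat (l i' j'') * e (T i' j'')) = 0" for i'
  proof (cases "i' = i")
    case True
    have "(\<Sum>j''=1..n i'. of_nat (l i' j'') * e (T i' j'')) =
      (\<Sum>j''\<in>{j, j'}. of_nat (l i' j'') * e (T i' j''))"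
      by (rule sum.mono_neutral_right) (use j True in \<open>auto simp: e_def\<close>)
    then show ?thesis using j True by (simp add: e_def)
  qed (simp add: e_def)
  then obtain E where E: "derivation M E" "\<And>w. w \<in> G \<Longrightarrow> E (g w) = c (e w) * g w" "\<And>x y. E (lf x y) = c 0 * lf x y"
    using euler_exists[of e 0] by blast
  let ?x = "g (T i j)" and ?y = "g (T i j')"
  have G: "T i j \<in> G" "T i j' \<in> G" using i j by (auto simp: gens_T)
  then have A: "?x \<in> A" "?y \<in> A" using g_mem by auto
  have "E x = 0" if "x \<in> A" "\<delta> x = 0" for x
  proof (rule euler_kills_kernel[OF E(1) _ _ that])
    show "E (g w) = 0" if "w \<in> G" "\<delta> (g w) = 0" for w
      using that E(2)[of w] nz by (auto simp: e_def)
    show "E z = 0" if "z \<in> linear_forms u v" for z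
      using that E(3) unfolding linear_forms_eq by auto
  qed
  then have "E ?x * \<delta> ?y = E ?y * \<delta> ?x"
    using d.derivation_wronskian[OF E(1) _ A] by blast
  then have w: "of_nat (l i j') * ?x * \<delta> ?y + of_nat (l i j) * ?y * \<delta> ?x = 0"
    using E(2)[OF G(1)] E(2)[OF G(2)] j by (simp add: e_def c_minus algebra_simps)
  have "l i j > 0" "l i j' > 0" using l1[of i j] l1[of i j'] i j by auto
  then obtain p q where l: "l i j = Suc p" "l i j' = Suc q" using gr0_implies_Suc by blast
  have "\<delta> (?x ^ l i j * ?y ^ l i j') = ?x ^ p * ?y ^ q * (of_nat (l i j') * ?x * \<delta> ?y + of_nat (l i j) * ?y * \<delta> ?x)"
    unfolding d.d_mult[OF A.power_mem[OF A(1)] A.power_mem[OF A(2)]] d.d_power[OF A(1)] d.d_power[OF A(2)]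
    unfolding l by (simp add: algebra_simps)
  then have "\<delta> (?x ^ l i j * ?y ^ l i j') = 0" unfolding w by simp
  then have "\<delta> (?x ^ l i j) = 0"
    using d.Ker_factorial(1)[of "?x ^ l i j" "?y ^ l i j'"] A g_nz G by (auto simp: A.power_mem)
  then show False using d.Ker_power[OF A(1) \<open>l i j > 0\<close>] nz by blast
qed

text \<open>Otherwise the Euler derivation that scales \<open>yy 0\<close> and \<open>yy 1\<close> by one kills the kernel, so the
  fraction \<open>yy 1 / yy 0\<close> is a quotient of two kernel elements; but these are combinations of
  monomials that involve no \<open>T i (J i)\<close>.\<close>

lemma kernel_linear_form:
  assumes nc: "\<And>i. i \<le> r \<Longrightarrow> \<exists>j\<in>{1..n i}. \<delta> (g (T i j)) \<noteq> 0"
  shows "\<exists>z\<in>linear_forms u v. \<delta> z = 0"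
proof (rule ccontr)
  assume no: "\<not> ?thesis"
  obtain J where J: "\<And>i. i \<le> r \<Longrightarrow> J i \<in> {1..n i} \<and> \<delta> (g (T i (J i))) \<noteq> 0" using nc by metis
  define e :: "generator \<Rightarrow> 'k" where
    "e = (\<lambda>w. case w of T i j \<Rightarrow> if j = J i then inverse (of_nat (l i j)) else 0 | S k \<Rightarrow> 0)"
  have "(\<Sum>j=1..n i. of_nat (l i j) * e (T i j)) = 1" if i: "i \<le> r" for i
  proof -
    have "(\<Sum>j=1..n i. of_nat (l i j) * e (T i j)) = (\<Sum>j\<in>{J i}. of_nat (l i j) * e (T i j))"
      by (rule sum.mono_neutral_right) (use J[OF i] in \<open>auto simp: e_def\<close>)
    moreover have "l i (J i) \<noteq> 0" using l1[of i "J i"] J[OF i] i by auto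
    ultimately show ?thesis by (simp add: e_def)
  qed
  then obtain E where E: "derivation M E" "\<And>w. w \<in> G \<Longrightarrow> E (g w) = c (e w) * g w" "\<And>x y. E (lf x y) = c 1 * lf x y"
    using euler_exists[of e 1] by blast
  have "E x = 0" if "x \<in> A" "\<delta> x = 0" for x
  proof (rule euler_kills_kernel[OF E(1) _ _ that])
    show "E (g w) = 0" if "w \<in> G" "\<delta> (g w) = 0" for w
    proof -
      obtain i j where ij: "w = T i j" "i \<le> r" "j \<in> {1..n i}" using G_cases \<open>w \<in> G\<close> by blast
      then have "e w = 0" using J[of i] that by (auto simp: e_def)
      then show ?thesis using E(2)[OF \<open>w \<in> G\<close>] by simp
    qed
    show "E z = 0" if "z \<in> linear_forms u v" "\<delta> z = 0" for z using no that by blast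
  qed
  then have wr: "E x * \<delta> y = E y * \<delta> x" if "x \<in> A" "y \<in> A" for x y
    using d.derivation_wronskian[OF E(1) _ that] by blast
  have A: "yy 0 \<in> A" "yy 1 \<in> A" using yy_mem r2 by auto
  have Ey: "E (yy i) = yy i" if "i \<le> r" for i using E(3) yy_eq[OF that] by simp
  have w0: "yy 0 * \<delta> (yy 1) = yy 1 * \<delta> (yy 0)" using wr[OF A] Ey[of 0] Ey[of 1] r2 by simp
  have wk: "yy 0 * (\<delta> ^^ k) (yy 1) = yy 1 * (\<delta> ^^ k) (yy 0)" for k
  proof (induction k)
    case (Suc k)
    let ?p = "(\<delta> ^^ k) (yy 0)" and ?q = "(\<delta> ^^ k) (yy 1)"
    have "\<delta> (yy 0) * ?q + yy 0 * \<delta> ?q = \<delta> (yy 1) * ?p + yy 1 * \<delta> ?p"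
      using arg_cong[OF Suc, of \<delta>] A by (simp add: d.d_mult d.dn_mem)
    moreover have "\<delta> (yy 0) * ?q = \<delta> (yy 1) * ?p"
    proof -
      have "yy 0 * (\<delta> (yy 0) * ?q) = \<delta> (yy 0) * (yy 0 * ?q)" by (simp add: ac_simps)
      also have "\<dots> = (yy 1 * \<delta> (yy 0)) * ?p" unfolding Suc by (simp add: ac_simps)
      also have "\<dots> = yy 0 * (\<delta> (yy 1) * ?p)" unfolding w0[symmetric] by (simp add: ac_simps)
      finally show ?thesis using yy_nz[of 0] by simp
    qed
    ultimately show ?case by simp
  qed simp
  define k where "k = d.dg (yy 0)"
  define x where "x = (\<delta> ^^ k) (yy 0)"
  define y where "y = (\<delta> ^^ k) (yy 1)"
  have xA: "x \<in> A" "y \<in> A" using A d.dn_mem by (auto simp: x_def y_def)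
  have x: "x \<noteq> 0" "\<delta> x = 0" using d.dg_nonzero[of "yy 0"] d.dg_zero[OF A(1)] yy_nz[of 0]
    by (auto simp: x_def k_def)
  have y: "\<delta> y = 0" using wk[of "Suc k"] x yy_nz[of 0] by (simp add: x_def y_def)
  have xy: "yy 0 * y = yy 1 * x" using wk[of k] by (simp add: x_def y_def)
  have rep: "\<exists>p\<in>PV G. \<phi> p = x \<and> (\<forall>m\<in>keys p. \<forall>i\<le>r. lookup m (T i (J i)) = 0)"
    if "x \<in> A" "\<delta> x = 0" for x
    using that
  proof (induction rule: kernel_induct)
    case zero show ?case by (intro bexI[of _ 0]) (auto simp: PV.zero_mem)
  next
    case (add x y)
    then obtain p q where "p \<in> PV G" "q \<in> PV G" "\<phi> p = x" "\<phi> q = y"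
      "\<forall>m\<in>keys p. \<forall>i\<le>r. lookup m (T i (J i)) = 0"
      "\<forall>m\<in>keys q. \<forall>i\<le>r. lookup m (T i (J i)) = 0" by blast
    then show ?case using keys_add[of p q] by (intro bexI[of _ "p + q"]) (auto simp: PV.add_mem meval_add)
  next
    case (prod k b ws)
    have "ws = []" using no prod(3) by (cases ws) auto
    moreover have "lookup b (T i (J i)) = 0" if "i \<le> r" for i
      using prod(2)[of "T i (J i)"] J[OF that] by (auto simp: in_keys_iff)
    ultimately show ?case
      by (intro bexI[of _ "single b k"]) (auto simp: meval_single single_PV[OF prod(1)])
  qed
  obtain p where p: "p \<in> PV G" "\<phi> p = x" "\<And>m i. m \<in> keys p \<Longrightarrow> i \<le> r \<Longrightarrow> lookup m (T i (J i)) = 0"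
    using rep[OF xA(1) x(2)] by blast
  obtain q where q: "q \<in> PV G" "\<phi> q = y" "\<And>m i. m \<in> keys q \<Longrightarrow> i \<le> r \<Longrightarrow> lookup m (T i (J i)) = 0"
    using rep[OF xA(2) y] by blast
  have km: "m' \<in> {m + lmono i | m. m \<in> keys p}" if "m' \<in> keys (p * Y i)" for m' i and p :: "(generator, 'k) mpoly"
    using that keys_mult[of p "Y i"] by (auto simp: Y_eq_single)
  have "q * Y 0 - p * Y 1 = 0"
  proof (rule indep)
    show "q * Y 0 - p * Y 1 \<in> PV (gens 0)" using p q r2 by (intro PV.diff_mem PV.mult_mem Y_PV) auto
    show "\<phi> (q * Y 0 - p * Y 1) = 0" using xy p q by (simp add: meval_diff meval_mult yy_\<phi> ac_simps)
    fix m' assume "m' \<in> keys (q * Y 0 - p * Y 1)"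
    then have "m' \<in> keys (q * Y 0) \<or> m' \<in> keys (p * Y 1)"
      by (auto simp: in_keys_iff lookup_minus)
    then obtain m i where m: "m' = m + lmono i" "i < 2" "m \<in> keys q \<or> m \<in> keys p"
      using km[of m' q 0] km[of m' p 1] by fastforce
    show "std m'"
      unfolding std_def
    proof
      fix i' assume i': "i' \<in> {2..r}"
      then have "lookup m' (T i' (J i')) = 0" using m p(3)[of m i'] q(3)[of m i'] by (auto simp: lookup_add lookup_lmono)
      then show "\<exists>j\<in>{1..n i'}. lookup m' (T i' j) < l i' j"
        using J[of i'] l1[of i' "J i'"] i' by (intro bexI[of _ "J i'"]) auto
    qed
  qed
  then have eq: "q * Y 0 = p * Y 1" by simp
  have "p \<noteq> 0" using x p by auto
  then obtain m where m: "m \<in> keys p" using keys_eq_empty by blast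
  then have "m + lmono 1 \<in> keys (p * Y 1)"
    unfolding in_keys_iff Y_eq_single lookup_mult_single_1 .
  then have "m + lmono 1 \<in> keys (q * Y 0)" by (simp only: eq)
  then obtain m' where m': "m' \<in> keys q" "m + lmono 1 = m' + lmono 0" using km[of _ q 0] by blast
  have "lookup (m + lmono 1) (T 0 (J 0)) = lookup (m' + lmono 0) (T 0 (J 0))" using m'(2) by simp
  then have "l 0 (J 0) = 0" using p(3)[OF m, of 0] q(3)[OF m'(1), of 0] J[of 0]
    by (simp add: lookup_add lookup_lmono)
  then show False using l1[of 0 "J 0"] J[of 0] by simp
qed

end

lemma (in trinomial_domain) elementary_LND:
  assumes i12: "i1 \<le> r" "i2 \<le> r" "i1 \<noteq> i2" and J: "\<And>i. i \<le> r \<Longrightarrow> J i \<in> {1..n i}"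
    and l1J: "\<And>i. i \<le> r \<Longrightarrow> i \<noteq> i1 \<Longrightarrow> i \<noteq> i2 \<Longrightarrow> l i (J i) = 1"
  obtains \<delta>' where "nonzero_LND M \<delta>'" "\<And>j. j \<in> {1..n i1} \<Longrightarrow> \<delta>' (g (T i1 j)) = 0"
proof -
  define P where "P k = of_nat (l k (J k)) * g (T k (J k)) ^ (l k (J k) - 1) *
      (\<Prod>j\<in>{1..n k} - {J k}. g (T k j) ^ l k j)" for k
  define h where "h w = (case w of T i j \<Rightarrow>
      if i \<noteq> i1 \<and> j = J i then c (dt i1 i) * (\<Prod>k\<in>{..r} - {i1, i}. P k) else 0 | S k \<Rightarrow> 0)" for w
  have gA: "g (T i j) \<in> A" if "i \<le> r" "j \<in> {1..n i}" for i j using that by (intro g_mem) (auto simp: gens_T)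
  have PA: "P k \<in> A" if "k \<le> r" for k
    unfolding P_def using that J[OF that] gA
    by (intro A.mult_mem A.prod_mem A.power_mem A.of_nat_mem) auto
  have hA: "h w \<in> A" if w: "w \<in> G" for w
  proof -
    have "c (dt i1 i) * (\<Prod>k\<in>{..r} - {i1, i}. P k) \<in> A" for i
      using PA by (intro A.mult_mem A.c_mem A.prod_mem) auto
    then show ?thesis unfolding h_def by (auto simp: A.zero_mem split: generator.split)
  qed
  let ?Pi = "\<Prod>k\<in>{..r} - {i1}. P k"
  have "\<exists>\<delta>'. derivation M \<delta>' \<and> (\<forall>w\<in>G. \<delta>' (g w) = h w)"
  proof (rule derivation_exists[of h "- c (a i1 $ 2) * ?Pi" "c (a i1 $ 1) * ?Pi"])
    fix i assume i: "i \<le> r"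
    have "(\<Sum>j = 1..n i. of_nat (l i j) * g (T i j) ^ (l i j - 1) * h (T i j) * (\<Prod>j'\<in>{1..n i} - {j}. g (T i j') ^ l i j'))
      = (\<Sum>j\<in>{J i}. of_nat (l i j) * g (T i j) ^ (l i j - 1) * h (T i j) * (\<Prod>j'\<in>{1..n i} - {j}. g (T i j') ^ l i j'))"
      by (rule sum.mono_neutral_right) (use J[OF i] in \<open>auto simp: h_def\<close>)
    also have "\<dots> = P i * h (T i (J i))" by (simp add: P_def ac_simps)
    also have "\<dots> = c (dt i1 i) * ?Pi"
    proof (cases "i = i1")
      case False
      have "?Pi = P i * (\<Prod>k\<in>{..r} - {i1, i}. P k)"
        using i False by (subst prod.remove[of _ i]) (auto intro!: arg_cong2[of _ _ _ _ "(*)"] prod.cong)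
      then show ?thesis using False by (simp add: h_def ac_simps)
    qed (simp add: h_def dt_def)
    finally show "(\<Sum>j = 1..n i. of_nat (l i j) * g (T i j) ^ (l i j - 1) * h (T i j) * (\<Prod>j'\<in>{1..n i} - {j}. g (T i j') ^ l i j'))
      = c (a i $ 1) * (- c (a i1 $ 2) * ?Pi) + c (a i $ 2) * (c (a i1 $ 1) * ?Pi)"
      by (simp add: dt_def c_diff c_mult algebra_simps)
  qed (use hA in blast)+
  then obtain \<delta>' where d: "derivation M \<delta>'" "\<And>w. w \<in> G \<Longrightarrow> \<delta>' (g w) = h w" by blast
  interpret D: subalg_derivation c A \<delta>' by unfold_locales (rule d)
  note N = D.nil_set_subalgebra
  interpret N: subalgebra c D.nil_set by (rule N)
  have K: "subalgebra c {x \<in> A. \<delta>' x = 0}"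
    by unfold_locales (auto simp: A.add_mem A.mult_mem D.d_add D.d_mult)
  have dg: "\<delta>' (g (T i j)) = (if i \<noteq> i1 \<and> j = J i then c (dt i1 i) * (\<Prod>k\<in>{..r} - {i1, i}. P k) else 0)"
    if "i \<le> r" "j \<in> {1..n i}" for i j
    using that d(2)[of "T i j"] by (auto simp: gens_T h_def)
  have ker: "g (T i j) \<in> {x \<in> A. \<delta>' x = 0}" if "i \<le> r" "j \<in> {1..n i}" "i = i1 \<or> j \<noteq> J i" for i j
    using gA dg that by auto
  have nilI: "x \<in> D.nil_set" if "x \<in> A" "\<delta>' x \<in> D.nil_set" for x
  proof -
    obtain m where "(\<delta>' ^^ m) (\<delta>' x) = 0" using \<open>\<delta>' x \<in> D.nil_set\<close> unfolding D.nil_set_def by blast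
    then have "(\<delta>' ^^ Suc m) x = 0" by (simp add: funpow_Suc_right del: funpow.simps)
    then show ?thesis using \<open>x \<in> A\<close> unfolding D.nil_set_def by blast
  qed
  have kernil: "x \<in> D.nil_set" if "x \<in> {x \<in> A. \<delta>' x = 0}" for x
  proof (rule nilI)
    show "x \<in> A" using that by blast
    have "\<delta>' x = 0" using that by blast
    then show "\<delta>' x \<in> D.nil_set" by (simp only: N.zero_mem)
  qed
  have Pker: "P k \<in> {x \<in> A. \<delta>' x = 0}" if "k \<le> r" "k \<noteq> i1" "k \<noteq> i2" for k
  proof -
    have "P k = (\<Prod>j\<in>{1..n k} - {J k}. g (T k j) ^ l k j)" by (simp add: P_def l1J[OF that])
    moreover have "g (T k j) \<in> {x \<in> A. \<delta>' x = 0}" if "j \<in> {1..n k} - {J k}" for j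
      using ker[of k j] that \<open>k \<le> r\<close> by blast
    ultimately show ?thesis
      by (simp only:) (intro subalgebra.prod_mem[OF K] subalgebra.power_mem[OF K])
  qed
  have i2nil: "g (T i2 (J i2)) \<in> D.nil_set"
  proof (rule nilI)
    show "g (T i2 (J i2)) \<in> A" using gA J i12 by blast
    have "c (dt i1 i2) * (\<Prod>k\<in>{..r} - {i1, i2}. P k) \<in> {x \<in> A. \<delta>' x = 0}"
      using Pker by (intro subalgebra.mult_mem[OF K] subalgebra.c_mem[OF K] subalgebra.prod_mem[OF K]) auto
    then show "\<delta>' (g (T i2 (J i2))) \<in> D.nil_set" using dg[of i2 "J i2"] J[of i2] i12 kernil by simp
  qed
  have Pnil: "P k \<in> D.nil_set" if "k \<le> r" "k \<noteq> i1" for k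
  proof (cases "k = i2")
    case True
    have "g (T k j) \<in> D.nil_set" if "j \<in> {1..n k} - {J k}" for j
      using kernil[OF ker[of k j]] that \<open>k \<le> r\<close> by blast
    then show ?thesis unfolding P_def using i2nil True
      by (intro N.mult_mem N.prod_mem N.power_mem N.of_nat_mem) simp_all
  qed (use Pker that kernil in blast)
  have "LND M \<delta>'"
  proof (rule LND_generators[OF d(1)])
    fix w assume "w \<in> G"
    then obtain i j where ij: "w = T i j" "i \<le> r" "j \<in> {1..n i}" using G_cases by blast
    have "c (dt i1 i) * (\<Prod>k\<in>{..r} - {i1, i}. P k) \<in> D.nil_set"
      using Pnil by (intro N.mult_mem N.c_mem N.prod_mem) auto
    then have "\<delta>' (g w) \<in> D.nil_set" using dg[OF ij(2,3)] ij by (simp add: N.zero_mem)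
    then have "g w \<in> D.nil_set" using nilI gA ij by blast
    then show "\<exists>m. (\<delta>' ^^ m) (g w) = 0" unfolding D.nil_set_def by blast
  qed
  moreover have "\<delta>' (g (T i2 (J i2))) \<noteq> 0"
  proof -
    have "P k \<noteq> 0" if k: "k \<le> r" for k
    proof -
      have "g (T k j) \<noteq> 0" if "j \<in> {1..n k}" for j using that k by (intro g_nz) (auto simp: gens_T)
      moreover have "(of_nat (l k (J k)) :: 'b) \<noteq> 0"
        using c_eq_0_iff[of "of_nat (l k (J k))"] l1[of k "J k"] J[OF k] k by auto
      ultimately show ?thesis unfolding P_def using J[OF k] by (auto simp: prod_zero_iff)
    qed
    then show ?thesis using dg[of i2 "J i2"] J[of i2] i12 dt_nz[of i1 i2] by (auto simp: prod_zero_iff)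
  qed
  ultimately have "nonzero_LND M \<delta>'"
    unfolding nonzero_LND_def using gA[of i2 "J i2"] J[of i2] i12 by auto
  moreover have "\<delta>' (g (T i1 j)) = 0" if "j \<in> {1..n i1}" for j using ker[of i1 j] i12 that by simp
  ultimately show ?thesis using that by simp
qed

context trinomial_semirigid
begin

lemma yy_factor:
  assumes "i \<le> r" "j \<in> {1..n i}" "\<And>j'. j' \<in> {1..n i} \<Longrightarrow> j' \<noteq> j \<Longrightarrow> \<delta> (g (T i j')) = 0"
  obtains b where "b \<in> A" "\<delta> b = 0" "b \<noteq> 0" "yy i = b * g (T i j) ^ l i j"
proof (rule that)
  let ?b = "\<Prod>j'\<in>{1..n i} - {j}. g (T i j') ^ l i j'"
  have G: "T i j' \<in> G" if "j' \<in> {1..n i}" for j' using that assms by (auto simp: gens_T)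
  have "?b \<in> {x \<in> A. \<delta> x = 0}"
    using assms g_mem[OF G]
    by (intro subalgebra.prod_mem[OF d.Ker_subalgebra] subalgebra.power_mem[OF d.Ker_subalgebra]) auto
  then show "?b \<in> A" "\<delta> ?b = 0" by auto
  show "?b \<noteq> 0" using g_nz[OF G] by (auto simp: prod_zero_iff)
  show "yy i = ?b * g (T i j) ^ l i j"
    unfolding yy_prod using assms(2) by (simp add: prod.remove mult.commute)
qed

lemma yy_Ker_imp:
  assumes "i \<le> r" "\<delta> (yy i) = 0" "j \<in> {1..n i}" shows "\<delta> (g (T i j)) = 0"
proof -
  have G: "T i j' \<in> G" if "j' \<in> {1..n i}" for j' using that assms by (auto simp: gens_T)
  have "\<delta> (g (T i j) ^ l i j) = 0"
    using d.Ker_prod[of "{1..n i}" "\<lambda>j. g (T i j) ^ l i j" j] assms yy_nz[OF assms(1)] g_mem[OF G]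
    unfolding yy_prod by (auto simp: A.power_mem)
  moreover have "l i j > 0" using l1[of i j] assms by auto
  ultimately show ?thesis using d.Ker_power[OF g_mem[OF G[OF assms(3)]]] by blast
qed

lemma yy_Ker_unique:
  assumes "i \<le> r" "k \<le> r" "i \<noteq> k" shows "\<delta> (yy i) \<noteq> 0 \<or> \<delta> (yy k) \<noteq> 0"
proof (rule ccontr)
  assume "\<not> ?thesis"
  then have 0: "\<delta> (yy i) = 0" "\<delta> (yy k) = 0" by auto
  have lf0: "\<delta> (lf x y) = 0" for x y
  proof -
    have "\<exists>p q. lf x y = c p * yy i + c q * yy k" by (rule lf_basis[OF assms]) blast
    then show ?thesis using 0 yy_mem assms by (auto simp: d.d_add d.d_scale A.mult_mem)
  qed
  have "\<delta> (g w) = 0" if "w \<in> G" for w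
  proof -
    obtain i j where ij: "w = T i j" "i \<le> r" "j \<in> {1..n i}" using G_cases \<open>w \<in> G\<close> by blast
    then show ?thesis using yy_Ker_imp[OF ij(2) _ ij(3)] yy_eq[OF ij(2)] lf0 by simp
  qed
  then have "\<delta> x = 0" if "x \<in> A" for x using derivation_eq_0[OF d.der _ \<open>x \<in> A\<close>] by blast
  then show False using nonzero unfolding nonzero_LND_def by auto
qed

lemma exponent_pair:
  assumes ik: "i \<le> r" "k \<le> r" "i \<noteq> k" and j: "j \<in> {1..n i}" "j' \<in> {1..n k}"
    and nz: "\<delta> (g (T i j)) \<noteq> 0" "\<delta> (g (T k j')) \<noteq> 0"
  shows "l i j = 1 \<or> l k j' = 1"
proof -
  obtain z where z: "z \<in> linear_forms u v" "\<delta> z = 0"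
  proof (cases "\<exists>i\<le>r. \<delta> (yy i) = 0")
    case True
    then obtain i where i: "i \<le> r" "\<delta> (yy i) = 0" by blast
    have "yy i \<in> linear_forms u v" unfolding linear_forms_eq using yy_eq[OF i(1)] yy_nz[OF i(1)] lf_eq_0_iff by fastforce
    then show ?thesis using i \<open>\<And>z. z \<in> linear_forms u v \<Longrightarrow> \<delta> z = 0 \<Longrightarrow> thesis\<close> by blast
  next
    case False
    have "\<exists>j\<in>{1..n i}. \<delta> (g (T i j)) \<noteq> 0" if i: "i \<le> r" for i
    proof (rule ccontr)
      assume no: "\<not> ?thesis"
      have "yy i \<in> {x \<in> A. \<delta> x = 0}" unfolding yy_prod using no i g_mem
        by (intro subalgebra.prod_mem[OF d.Ker_subalgebra] subalgebra.power_mem[OF d.Ker_subalgebra]) (auto simp: gens_T)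
      then show False using False i by auto
    qed
    then show ?thesis using kernel_linear_form \<open>\<And>z. z \<in> linear_forms u v \<Longrightarrow> \<delta> z = 0 \<Longrightarrow> thesis\<close> by blast
  qed
  obtain x y where xy: "z = lf x y" "(x, y) \<noteq> (0, 0)" using z(1) unfolding linear_forms_eq by blast
  have zn: "z \<noteq> 0" using xy lf_eq_0_iff by simp
  have zA: "z \<in> A" using xy lf_mem by simp
  have "\<exists>p q. z = c p * yy i + c q * yy k" unfolding xy(1) by (rule lf_basis[OF ik]) blast
  then obtain p q where pq: "z = c p * yy i + c q * yy k" by blast
  have y: "\<delta> (yy i) \<noteq> 0" "\<delta> (yy k) \<noteq> 0" using yy_Ker_imp ik j nz by blast+
  have dz: "c p * \<delta> (yy i) + c q * \<delta> (yy k) = 0"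
    using z(2) unfolding pq using yy_mem ik by (simp add: d.d_add d.d_scale A.mult_mem)
  have pn: "p \<noteq> 0" "q \<noteq> 0" using dz y zn pq by auto
  obtain b where b: "b \<in> A" "\<delta> b = 0" "b \<noteq> 0" "yy i = b * g (T i j) ^ l i j"
    using yy_factor[OF ik(1) j(1)] unique_nonconstant[OF ik(1) j(1) _ _ nz(1)] by metis
  obtain b' where b': "b' \<in> A" "\<delta> b' = 0" "b' \<noteq> 0" "yy k = b' * g (T k j') ^ l k j'"
    using yy_factor[OF ik(2) j(2)] unique_nonconstant[OF ik(2) j(2) _ _ nz(2)] by metis
  have "l i j \<le> 1 \<or> l k j' \<le> 1"
  proof (rule d.two_term_exponent)
    show "(c p * b) * g (T i j) ^ l i j + (c q * b') * g (T k j') ^ l k j' = z"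
      unfolding pq b(4) b'(4) by (simp add: ac_simps)
    show "g (T i j) \<in> A" "g (T k j') \<in> A" using ik j g_mem by (auto simp: gens_T)
  qed (use nz b b' pn zn zA z(2) in \<open>auto simp: d.d_scale A.mult_mem\<close>)
  then show ?thesis using l1[of i j] l1[of k j'] ik j by auto
qed

theorem not_semirigid: False
proof -
  define N where "N = {i. i \<le> r \<and> (\<exists>j\<in>{1..n i}. \<delta> (g (T i j)) \<noteq> 0)}"
  have Nc: "\<delta> (yy i) = 0" if "i \<le> r" "i \<notin> N" for i
  proof -
    have "yy i \<in> {x \<in> A. \<delta> x = 0}" unfolding yy_prod using that g_mem
      by (intro subalgebra.prod_mem[OF d.Ker_subalgebra] subalgebra.power_mem[OF d.Ker_subalgebra]) (auto simp: gens_T N_def)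
    then show ?thesis by simp
  qed
  have Nc1: "i = k" if "i \<le> r" "k \<le> r" "i \<notin> N" "k \<notin> N" for i k
    using yy_Ker_unique[OF that(1,2)] Nc that by blast
  have "\<exists>J. \<forall>i\<le>r. J i \<in> {1..n i} \<and> (i \<in> N \<longrightarrow> \<delta> (g (T i (J i))) \<noteq> 0)"
  proof (rule choice_iff'[THEN iffD1, rule_format])
    fix i assume i: "i \<le> r"
    show "\<exists>j. j \<in> {1..n i} \<and> (i \<in> N \<longrightarrow> \<delta> (g (T i j)) \<noteq> 0)"
      using n1[OF i] unfolding N_def by (cases "i \<in> N") (auto simp: N_def)
  qed
  then obtain J where J: "\<And>i. i \<le> r \<Longrightarrow> J i \<in> {1..n i}" "\<And>i. i \<in> N \<Longrightarrow> \<delta> (g (T i (J i))) \<noteq> 0"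
    unfolding N_def by blast
  have Nr: "i \<le> r" if "i \<in> N" for i using that by (simp add: N_def)
  have pair: "l i (J i) = 1 \<or> l k (J k) = 1" if "i \<in> N" "k \<in> N" "i \<noteq> k" for i k
    using exponent_pair[OF Nr Nr _ J(1) J(1) J(2) J(2)] that Nr by blast
  have "0 \<in> N \<or> 1 \<in> N" using Nc1[of 0 1] r2 by auto
  then obtain i1 where i1: "i1 \<in> N" "\<And>i. i \<in> N \<Longrightarrow> i \<noteq> i1 \<Longrightarrow> l i (J i) = 1"
    using pair by metis
  define i2 where "i2 = (if \<exists>i\<le>r. i \<notin> N then SOME i. i \<le> r \<and> i \<notin> N else if i1 = 0 then 1 else 0)"
  have i2: "i2 \<le> r \<and> i1 \<noteq> i2 \<and> (\<forall>i\<le>r. i \<noteq> i2 \<longrightarrow> i \<in> N)"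
  proof (cases "\<exists>i\<le>r. i \<notin> N")
    case True
    then have "i2 \<le> r \<and> i2 \<notin> N" unfolding i2_def using someI_ex[of "\<lambda>i. i \<le> r \<and> i \<notin> N"] by auto
    then show ?thesis using Nc1 i1 by blast
  next
    case False
    then show ?thesis using r2 by (auto simp: i2_def)
  qed
  obtain \<delta>' where d': "nonzero_LND M \<delta>'" "\<And>j. j \<in> {1..n i1} \<Longrightarrow> \<delta>' (g (T i1 j)) = 0"
  proof (rule elementary_LND[of i1 i2 J])
    show "l i (J i) = 1" if "i \<le> r" "i \<noteq> i1" "i \<noteq> i2" for i using i1 i2 that by blast
  qed (use i1 i2 J Nr in auto)
  have "g (T i1 (J i1)) \<in> A" using J(1) Nr[OF i1(1)] by (intro g_mem) (auto simp: gens_T)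
  then have "\<delta> (g (T i1 (J i1))) = 0"
    using semirigid_kernel[OF d'(1)] d'(2)[of "J i1"] J(1) Nr[OF i1(1)] by blast
  then show False using J(2) i1 by blast
qed

end

theorem (in trinomial_domain) semirigid_imp_rigid:
  assumes "semirigid M" shows "rigid M"
proof (rule ccontr)
  assume "\<not> rigid M"
  then obtain \<delta> where "nonzero_LND M \<delta>" unfolding rigid_def by blast
  then interpret trinomial_semirigid r n l a c g u v \<delta> by unfold_locales (use assms in auto)
  show False by (rule not_semirigid)
qed

section \<open>Polynomial extensions\<close>

lemma coeff_mult_top:
  fixes p q :: "'b::comm_ring_1 poly"
  assumes "\<And>i. i > a \<Longrightarrow> coeff p i = 0" "\<And>i. i > b \<Longrightarrow> coeff q i = 0"
  shows "coeff (p * q) (a + b) = coeff p a * coeff q b" "i > a + b \<Longrightarrow> coeff (p * q) i = 0"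
proof -
  have z: "coeff p j * coeff q (i - j) = 0" if "i \<ge> a + b" "j \<noteq> a \<or> i \<noteq> a + b" for i j
  proof (cases "j > a")
    case False
    then have "i - j > b" using that by linarith
    then show ?thesis using assms by simp
  qed (simp add: assms)
  have "coeff (p * q) (a + b) = (\<Sum>j\<le>a + b. if j = a then coeff p a * coeff q b else 0)"
    unfolding coeff_mult by (rule sum.cong) (auto simp: z)
  then show "coeff (p * q) (a + b) = coeff p a * coeff q b" by simp
  show "coeff (p * q) i = 0" if "i > a + b"
    unfolding coeff_mult using that by (intro sum.neutral) (auto simp: z)
qed

locale poly_extension = subalgebra c A for c :: "'k::field_char_0 \<Rightarrow> 'b::idom" and A
begin

definition c' where "c' k = [:c k:]"
definition PA where "PA = {p. \<forall>i. coeff p i \<in> A}"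
definition X :: "'b poly" where "X = [:0, 1:]"

lemma PA_const: "[:a:] \<in> PA \<longleftrightarrow> a \<in> A"
  by (auto simp: PA_def coeff_pCons split: nat.splits)

lemma X_PA: "X \<in> PA"
  by (auto simp: PA_def X_def coeff_pCons split: nat.splits)

sublocale P: subalgebra c' PA
proof
  fix p q assume pq: "p \<in> PA" "q \<in> PA"
  then show "p + q \<in> PA" by (auto simp: PA_def add_mem)
  show "p * q \<in> PA" using pq by (auto simp: PA_def coeff_mult intro!: sum_mem mult_mem)
qed (auto simp: c'_def one_pCons c_add c_mult PA_const)

lemma monom_eq: "monom a m = [:a:] * X ^ m"
  by (induction m) (auto simp: X_def monom_Suc monom_0)

lemma pCons_eq: "pCons a p = [:a:] + X * p"
  by (simp add: X_def)

lemma monom_PA: "a \<in> A \<Longrightarrow> monom a m \<in> PA"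
  by (auto simp: PA_def)

lemma PA_induct [consumes 1, case_names zero pCons]:
  assumes "p \<in> PA" "Q 0" "\<And>a p. a \<in> A \<Longrightarrow> p \<in> PA \<Longrightarrow> Q p \<Longrightarrow> Q (pCons a p)"
  shows "Q p"
  using assms(1)
proof (induction p rule: pCons_induct)
  case (pCons a p)
  have "coeff (pCons a p) 0 \<in> A" "coeff (pCons a p) (Suc i) \<in> A" for i using pCons(3) unfolding PA_def by blast+
  then have "a \<in> A" "p \<in> PA" by (auto simp: PA_def)
  then show ?case using pCons assms(3) by blast
qed (use assms in simp)

lemma PA_least:
  assumes "subalgebra c' B" "\<And>a. a \<in> A \<Longrightarrow> [:a:] \<in> B" "X \<in> B" shows "PA \<subseteq> B"
proof
  interpret B: subalgebra c' B by fact
  fix p assume "p \<in> PA"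
  then show "p \<in> B"
  proof (induction rule: PA_induct)
    case (pCons a p)
    then have "[:a:] + X * p \<in> B" by (intro B.add_mem B.mult_mem assms(2,3))
    then show ?case by (simp only: pCons_eq[of a p])
  qed (rule B.zero_mem)
qed

lemma map_poly_derivation:
  assumes "derivation (subalg_module c A) \<delta>" shows "derivation (subalg_module c' PA) (map_poly \<delta>)"
proof -
  interpret d: subalg_derivation c A \<delta> by unfold_locales fact
  have cf: "coeff (map_poly \<delta> p) i = \<delta> (coeff p i)" for p i by (rule coeff_map_poly) simp
  show ?thesis unfolding P.derivation_subalg
  proof (intro conjI ballI allI)
    fix p q assume p: "p \<in> PA" then show "map_poly \<delta> p \<in> PA" by (auto simp: PA_def cf d.d_mem)
    fix k show "map_poly \<delta> (c' k * p) = c' k * map_poly \<delta> p"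
      by (rule poly_eqI) (use p in \<open>simp add: cf c'_def PA_def d.d_scale\<close>)
    assume q: "q \<in> PA"
    show "map_poly \<delta> (p + q) = map_poly \<delta> p + map_poly \<delta> q"
      by (rule poly_eqI) (use p q in \<open>simp add: cf PA_def d.d_add\<close>)
    show "map_poly \<delta> (p * q) = map_poly \<delta> p * q + p * map_poly \<delta> q"
      by (rule poly_eqI) (use p q in \<open>simp add: cf PA_def coeff_mult d.d_sum mult_mem d.d_mult sum.distrib\<close>)
  qed
qed

lemma pderiv_PA: "p \<in> PA \<Longrightarrow> pderiv p \<in> PA"
  unfolding PA_def by (auto simp: coeff_pderiv simp del: of_nat_Suc intro!: mult_mem)

lemma pderiv_derivation: "derivation (subalg_module c' PA) pderiv"
  unfolding P.derivation_subalg
  by (auto simp: pderiv_PA pderiv_add pderiv_mult c'_def pderiv_smult)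

lemma nonrigid_imp_not_semirigid:
  assumes "\<not> rigid (subalg_module c A)" shows "\<not> semirigid (subalg_module c' PA)"
proof
  assume s: "semirigid (subalg_module c' PA)"
  obtain \<delta> where \<delta>: "nonzero_LND (subalg_module c A) \<delta>" using assms unfolding rigid_def by blast
  then interpret d: subalg_LND c A \<delta> by unfold_locales (auto simp: nonzero_LND_def LND_def)
  have cf: "coeff (map_poly \<delta> p) i = \<delta> (coeff p i)" for p i by (rule coeff_map_poly) simp
  interpret D: subalg_derivation c' PA "map_poly \<delta>"
    by unfold_locales (rule map_poly_derivation[OF d.der])
  interpret E: subalg_derivation c' PA pderiv
    by unfold_locales (rule pderiv_derivation)
  have it: "(map_poly \<delta> ^^ m) [:a:] = [:(\<delta> ^^ m) a:]" for m a
    by (induction m) (auto simp: map_poly_pCons)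
  have X0: "map_poly \<delta> X = 0" by (simp add: X_def map_poly_pCons)
  have "PA \<subseteq> D.nil_set"
  proof (rule PA_least[OF D.nil_set_subalgebra])
    fix a assume a: "a \<in> A"
    then obtain m where "(\<delta> ^^ m) a = 0" using d.lnd unfolding LND_def by auto
    then have "(map_poly \<delta> ^^ m) [:a:] = 0" by (simp add: it)
    then show "[:a:] \<in> D.nil_set" using a unfolding D.nil_set_def by (auto simp: PA_const)
  next
    have "(map_poly \<delta> ^^ 1) X = 0" by (simp add: X0)
    then show "X \<in> D.nil_set" using X_PA unfolding D.nil_set_def by blast
  qed
  moreover obtain a where "a \<in> A" "\<delta> a \<noteq> 0" using \<delta> unfolding nonzero_LND_def by auto
  then have "[:a:] \<in> PA" "map_poly \<delta> [:a:] \<noteq> 0" by (auto simp: PA_const map_poly_pCons)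
  ultimately have 1: "nonzero_LND (subalg_module c' PA) (map_poly \<delta>)"
    unfolding nonzero_LND_def D.LND_iff_nil_set by auto
  have "PA \<subseteq> E.nil_set"
  proof (rule PA_least[OF E.nil_set_subalgebra])
    fix a assume a: "a \<in> A"
    have "(pderiv ^^ 1) [:a:] = 0" by (simp add: pderiv_pCons)
    then show "[:a:] \<in> E.nil_set" using a PA_const unfolding E.nil_set_def by blast
  next
    have "(pderiv ^^ 2) X = 0" by (simp add: X_def pderiv_pCons numeral_2_eq_2)
    then show "X \<in> E.nil_set" using X_PA unfolding E.nil_set_def by blast
  qed
  moreover have X1: "pderiv X = 1" by (simp add: X_def pderiv_pCons one_pCons)
  ultimately have 2: "nonzero_LND (subalg_module c' PA) pderiv"
    unfolding nonzero_LND_def E.LND_iff_nil_set using X_PA by (auto intro!: bexI[of _ X])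
  have "{p \<in> PA. map_poly \<delta> p = 0} = {p \<in> PA. pderiv p = 0}"
    using s 1 2 unfolding semirigid_def equivalent_LND_def a_kernel_subalg_module by blast
  then show False using X_PA X0 X1 by force
qed

text \<open>The number \<open>e\<close> is the least shift such that \<open>\<delta>\<close> raises the degree by less than \<open>e\<close>. If
  \<open>e > 0\<close>, the part \<open>\<delta>'\<close> of degree \<open>e - 1\<close> is again locally nilpotent and maps \<open>X\<close> to a multiple
  of \<open>X\<close>, hence to \<open>0\<close>, so that it comes from a nonzero derivation of the coefficients.\<close>

lemma rigid_LND_form:
  assumes F: "finite F" "F \<subseteq> A" "\<And>B. subalgebra c B \<Longrightarrow> F \<subseteq> B \<Longrightarrow> A \<subseteq> B"
    and rigid: "rigid (subalg_module c A)" and \<delta>: "nonzero_LND (subalg_module c' PA) \<delta>"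
  shows "{p \<in> PA. \<delta> p = 0} = {p \<in> PA. pderiv p = 0}"
proof -
  interpret d: subalg_LND c' PA \<delta> using \<delta> by unfold_locales (auto simp: nonzero_LND_def LND_def)
  define N where "N = Max (insert 0 ((\<lambda>a. degree (\<delta> [:a:])) ` F))"
  have "subalgebra c {a \<in> A. degree (\<delta> [:a:]) \<le> N}"
  proof
    fix a b assume ab: "a \<in> {a \<in> A. degree (\<delta> [:a:]) \<le> N}" "b \<in> {a \<in> A. degree (\<delta> [:a:]) \<le> N}"
    have "\<delta> [:a + b:] = \<delta> [:a:] + \<delta> [:b:]" using d.d_add[of "[:a:]" "[:b:]"] ab by (simp add: PA_const)
    then show "a + b \<in> {a \<in> A. degree (\<delta> [:a:]) \<le> N}" using ab by (auto simp: add_mem degree_add_le)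
    have "\<delta> [:a * b:] = Polynomial.smult b (\<delta> [:a:]) + Polynomial.smult a (\<delta> [:b:])"
      using d.d_mult[of "[:a:]" "[:b:]"] ab by (simp add: PA_const mult.commute[of b a])
    then show "a * b \<in> {a \<in> A. degree (\<delta> [:a:]) \<le> N}"
      using ab by (auto simp: mult_mem intro!: degree_add_le order_trans[OF degree_smult_le])
  next
    fix k have "\<delta> [:c k:] = 0" using d.d_c[of k] by (simp add: c'_def)
    then show "c k \<in> {a \<in> A. degree (\<delta> [:a:]) \<le> N}" by simp
  qed
  then have "A \<subseteq> {a \<in> A. degree (\<delta> [:a:]) \<le> N}"
    by (rule F(3)) (use F(1,2) in \<open>auto simp: N_def\<close>)
  then have N: "degree (\<delta> [:a:]) \<le> N" if "a \<in> A" for a using that by blast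
  define W where "W e \<longleftrightarrow> (\<forall>a\<in>A. \<forall>i\<ge>e. coeff (\<delta> [:a:]) i = 0) \<and> (\<forall>i>e. coeff (\<delta> X) i = 0)" for e
  have "W (Suc (N + degree (\<delta> X)))"
    unfolding W_def using N by (fastforce intro!: coeff_eq_0 dest: le_less_trans)
  define e where "e = (LEAST e. W e)"
  have e: "W e" unfolding e_def by (rule LeastI) fact
  have eL: "\<not> W e'" if "e' < e" for e' using that not_less_Least unfolding e_def by blast
  have "e = 0"
  proof (rule ccontr)
    assume "e \<noteq> 0"
    then obtain e' where e': "e = Suc e'" using not0_implies_Suc by blast
    define D where "D a = coeff (\<delta> [:a:]) e'" for a
    define h where "h = coeff (\<delta> X) e"
    have hA: "h \<in> A" using d.d_mem[OF X_PA] by (simp add: h_def PA_def)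
    have "derivation (subalg_module c A) D"
      unfolding derivation_subalg D_def
    proof (intro conjI ballI allI)
      fix a b assume a: "a \<in> A"
      then show "coeff (\<delta> [:a:]) e' \<in> A" using d.d_mem[OF PA_const[THEN iffD2, OF a]] by (simp add: PA_def)
      fix k show "coeff (\<delta> [:c k * a:]) e' = c k * coeff (\<delta> [:a:]) e'"
        using d.d_scale[of "[:a:]" k] a by (simp add: PA_const c'_def mult.commute[of a])
      assume b: "b \<in> A"
      show "coeff (\<delta> [:a + b:]) e' = coeff (\<delta> [:a:]) e' + coeff (\<delta> [:b:]) e'"
        using d.d_add[of "[:a:]" "[:b:]"] a b by (simp add: PA_const)
      show "coeff (\<delta> [:a * b:]) e' = coeff (\<delta> [:a:]) e' * b + a * coeff (\<delta> [:b:]) e'"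
        using d.d_mult[of "[:a:]" "[:b:]"] a b by (simp add: PA_const mult.commute[of b])
    qed
    then interpret D: subalg_derivation c A D by unfold_locales
    have top: "(\<forall>i>m + e'. coeff (\<delta> p) i = 0) \<and> coeff (\<delta> p) (m + e') = D (coeff p m) + of_nat m * h * coeff p m"
      if "p \<in> PA" "degree p \<le> m" for p m
      using that
    proof (induction m arbitrary: p)
      case 0
      then obtain a where p: "p = [:a:]" using degree_eq_zeroE by blast
      then have "a \<in> A" using 0 by (simp add: PA_const)
      then show ?case using e p unfolding W_def e' D_def by auto
    next
      case (Suc m)
      obtain a q where p: "p = pCons a q" by (rule pCons_cases)
      have "coeff p 0 \<in> A" "coeff p (Suc i) \<in> A" for i using Suc(2) unfolding PA_def by blast+
      then have aq: "a \<in> A" "q \<in> PA" by (auto simp: p PA_def)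
      have dq: "degree q \<le> m" using Suc(3) p by (cases "q = 0") auto
      have dp: "\<delta> p = \<delta> [:a:] + (q * \<delta> X + pCons 0 (\<delta> q))"
      proof -
        have "\<delta> p = \<delta> [:a:] + (\<delta> X * q + X * \<delta> q)"
          unfolding p pCons_eq[of a q] using aq X_PA by (simp add: d.d_add d.d_mult P.mult_mem PA_const)
        moreover have "X * \<delta> q = pCons 0 (\<delta> q)" by (simp add: X_def)
        ultimately show ?thesis by (simp add: ac_simps)
      qed
      note IH = Suc(1)[OF aq(2) dq]
      have qt: "coeff q i = 0" if "i > m" for i using that dq by (simp add: coeff_eq_0)
      have et: "coeff (\<delta> X) i = 0" if "i > e" for i using e that by (simp add: W_def)
      have at: "coeff (\<delta> [:a:]) i = 0" if "i \<ge> e" for i using e that aq by (simp add: W_def)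
      note t = coeff_mult_top[of m q e "\<delta> X", OF qt et]
      show ?case
      proof (intro conjI allI impI)
        fix i assume i: "i > Suc m + e'"
        then obtain i' where i': "i = Suc i'" using not0_implies_Suc by (metis not_less0)
        show "coeff (\<delta> p) i = 0" unfolding dp using at[of i] t(2)[of i] IH i e' by (simp add: i')
      next
        have "coeff (\<delta> p) (Suc m + e') = coeff q m * h + (D (coeff q m) + of_nat m * h * coeff q m)"
          unfolding dp using at[of "Suc m + e'"] t(1) IH e' by (simp add: h_def)
        then show "coeff (\<delta> p) (Suc m + e') = D (coeff p (Suc m)) + of_nat (Suc m) * h * coeff p (Suc m)"
          by (simp add: p algebra_simps)
      qed
    qed
    define \<delta>' where "\<delta>' p = map_poly D p * X ^ e' + pderiv p * ([:h:] * X ^ e)" for p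
    have dm: "derivation (subalg_module c' PA) (map_poly D)" by (rule map_poly_derivation[OF D.der])
    interpret mD: subalg_derivation c' PA "map_poly D" by unfold_locales (rule dm)
    have d': "derivation (subalg_module c' PA) \<delta>'"
      unfolding P.derivation_subalg
    proof (intro conjI ballI allI)
      fix p q assume p: "p \<in> PA"
      show "\<delta>' p \<in> PA" unfolding \<delta>'_def
        using p hA X_PA by (intro P.add_mem P.mult_mem P.power_mem mD.d_mem pderiv_PA) (auto simp: PA_const)
      fix k show "\<delta>' (c' k * p) = c' k * \<delta>' p"
        using p by (simp add: \<delta>'_def mD.d_scale) (simp add: c'_def pderiv_smult smult_add_right mult.commute[of h])
      assume q: "q \<in> PA"
      show "\<delta>' (p + q) = \<delta>' p + \<delta>' q"
        using p q unfolding \<delta>'_def by (simp add: mD.d_add pderiv_add distrib_right smult_add_right)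
      show "\<delta>' (p * q) = \<delta>' p * q + p * \<delta>' q"
        using p q unfolding \<delta>'_def mD.d_mult[OF p q] pderiv_mult by (simp only: algebra_simps)
    qed
    interpret d': subalg_derivation c' PA \<delta>' by unfold_locales (rule d')
    have dmonom: "\<delta>' (monom a m) = monom (D a + of_nat m * h * a) (m + e')" for a m
    proof -
      have "map_poly D (monom a m) = monom (D a) m" by (rule map_poly_monom) simp
      moreover have "pderiv (monom a m) * ([:h:] * X ^ e) = monom (of_nat m * h * a) (m + e')"
      proof (cases m)
        case (Suc m')
        then show ?thesis unfolding pderiv_monom monom_eq[symmetric] mult_monom by (simp add: e' ac_simps)
      qed (simp add: pderiv_monom)
      moreover have "monom (D a) m * X ^ e' = monom (D a) (m + e')"
        by (simp add: monom_eq power_add mult.assoc)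
      ultimately show ?thesis by (simp add: \<delta>'_def add_monom)
    qed
    have it: "(\<forall>i>m + k * e'. coeff ((\<delta> ^^ k) (monom a m)) i = 0) \<and>
        (\<delta>' ^^ k) (monom a m) = monom (coeff ((\<delta> ^^ k) (monom a m)) (m + k * e')) (m + k * e')"
      if a: "a \<in> A" for a m k
    proof (induction k)
      case 0 then show ?case by simp
    next
      case (Suc k)
      let ?q = "(\<delta> ^^ k) (monom a m)"
      have "?q \<in> PA" by (intro d.dn_mem monom_PA a)
      moreover have "degree ?q \<le> m + k * e'" using Suc by (intro degree_le) auto
      ultimately have "(\<forall>i>m + k * e' + e'. coeff (\<delta> ?q) i = 0) \<and>
          coeff (\<delta> ?q) (m + k * e' + e') = D (coeff ?q (m + k * e')) + of_nat (m + k * e') * h * coeff ?q (m + k * e')"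
        by (rule top)
      moreover have "(\<delta>' ^^ Suc k) (monom a m) = monom (D (coeff ?q (m + k * e')) + of_nat (m + k * e') * h * coeff ?q (m + k * e')) (m + k * e' + e')"
        using Suc dmonom by simp
      ultimately show ?case by (simp add: ac_simps)
    qed
    have nil: "monom a m \<in> d'.nil_set" if a: "a \<in> A" for a m
    proof -
      obtain k where "(\<delta> ^^ k) (monom a m) = 0" using d.lnd monom_PA[OF a] unfolding LND_def by auto
      then have "(\<delta>' ^^ k) (monom a m) = 0" using it[OF a, of m k] by simp
      then show ?thesis using monom_PA[OF a] unfolding d'.nil_set_def by blast
    qed
    have "PA \<subseteq> d'.nil_set"
    proof (rule PA_least[OF d'.nil_set_subalgebra])
      show "[:a:] \<in> d'.nil_set" if "a \<in> A" for a using nil[OF that, of 0] by (simp add: monom_0)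
      show "X \<in> d'.nil_set" using nil[of 1 1] monom_eq[of 1 1] by (simp add: one_pCons)
    qed
    then have "LND (subalg_module c' PA) \<delta>'" by (simp add: d'.LND_iff_nil_set)
    then interpret L: subalg_LND c' PA \<delta>' by unfold_locales
    have Xm: "X = monom 1 1" using monom_eq[of 1 1] by (simp add: one_pCons)
    have dX: "\<delta>' X = monom h e" unfolding Xm dmonom using D.d_1 by (simp add: e')
    also have "\<dots> = X * ([:h:] * X ^ e')"
      unfolding monom_eq e' by (simp add: ac_simps)
    finally have "\<delta>' X = X * ([:h:] * X ^ e')" .
    then have "\<delta>' X = 0" using hA X_PA
      by (intro L.dvd_imp_Ker[of X "[:h:] * X ^ e'"] P.mult_mem P.power_mem) (auto simp: PA_const)
    then have h0: "h = 0" unfolding dX by simp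
    have itD: "(\<delta>' ^^ k) (monom a 0) = monom ((D ^^ k) a) (k * e')" for a k
      by (induction k) (auto simp: dmonom h0 ac_simps)
    have "LND (subalg_module c A) D"
      unfolding D.LND_iff_nil_set
    proof
      fix a assume a: "a \<in> A"
      then obtain k where "(\<delta>' ^^ k) (monom a 0) = 0" using nil[of a 0] unfolding d'.nil_set_def by blast
      then have "(D ^^ k) a = 0" by (simp add: itD)
      then show "a \<in> D.nil_set" using a unfolding D.nil_set_def by blast
    qed
    then have D0: "D a = 0" if "a \<in> A" for a
      using rigid that unfolding rigid_def nonzero_LND_def by auto
    have "W e'"
      unfolding W_def
    proof (intro conjI ballI allI impI)
      fix a i assume "a \<in> A" "i \<ge> e'"
      then show "coeff (\<delta> [:a:]) i = 0"
        using D0[of a] e unfolding W_def D_def e' by (cases "i = e'") auto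
    next
      fix i assume "i > e'"
      then show "coeff (\<delta> X) i = 0"
        using h0 e unfolding W_def h_def e' by (cases "i = Suc e'") auto
    qed
    then show False using eL[of e'] e' by simp
  qed
  then have a0: "\<delta> [:a:] = 0" if "a \<in> A" for a using e that unfolding W_def by (auto simp: poly_eq_iff)
  have dp: "\<delta> p = pderiv p * \<delta> X" if "p \<in> PA" for p
    using that
  proof (induction rule: PA_induct)
    case (pCons a p)
    then show ?case using X_PA unfolding pCons_eq[of a p]
      by (simp add: d.d_add d.d_mult P.mult_mem PA_const a0 pderiv_add pderiv_mult pderiv_pCons)
        (simp add: X_def pderiv_pCons algebra_simps)
  qed simp
  have "\<delta> X \<noteq> 0" using \<delta> dp unfolding nonzero_LND_def by auto
  then show ?thesis using dp by auto
qed

theorem semirigid_extension_iff: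
  assumes F: "finite F" "F \<subseteq> A" "\<And>B. subalgebra c B \<Longrightarrow> F \<subseteq> B \<Longrightarrow> A \<subseteq> B"
  shows "semirigid (subalg_module c' PA) \<longleftrightarrow> rigid (subalg_module c A)"
proof
  assume "rigid (subalg_module c A)"
  then show "semirigid (subalg_module c' PA)"
    using rigid_LND_form[OF F] unfolding semirigid_def equivalent_LND_def a_kernel_subalg_module by blast
qed (use nonrigid_imp_not_semirigid in blast)

end

section \<open>Independence of radicals of linear polynomials\<close>

lemma fps_of_poly_eq_0: "fps_of_poly p = 0 \<longleftrightarrow> p = 0"
  by (auto simp: fps_eq_iff poly_eq_iff)

lemma fps_nth_root:
  fixes p :: "'k::{alg_closed_field, field_char_0} fps"
  assumes "fps_nth p 0 \<noteq> 0" "q > 0" obtains s where "s ^ q = p"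
proof -
  obtain z where z: "z ^ q = fps_nth p 0" using nth_root_exists[of q "fps_nth p 0"] assms(2) by blast
  obtain k where k: "q = Suc k" using assms(2) gr0_implies_Suc by blast
  have "fps_radical (\<lambda>_ _. z) (Suc k) p ^ Suc k = p"
    using power_radical[OF assms(1), of "\<lambda>_ _. z" k] z k by simp
  then show ?thesis using that k by blast
qed

locale linear_radicals =
  fixes J :: "nat set" and \<alpha> \<beta> :: "nat \<Rightarrow> 'k::field_char_0" and q :: "nat \<Rightarrow> nat" and \<psi> :: "nat \<Rightarrow> 'k fps"
  assumes J: "finite J" and \<beta>: "\<And>i. i \<in> J \<Longrightarrow> \<beta> i \<noteq> 0"
    and distinct: "\<And>i k. i \<in> J \<Longrightarrow> k \<in> J \<Longrightarrow> i \<noteq> k \<Longrightarrow> \<alpha> i * \<beta> k \<noteq> \<alpha> k * \<beta> i"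
    and q: "\<And>i. i \<in> J \<Longrightarrow> q i > 0" and \<psi>: "\<And>i. i \<in> J \<Longrightarrow> \<psi> i ^ q i = fps_of_poly [:\<alpha> i, \<beta> i:]"
begin

definition L where "L i = [:\<alpha> i, \<beta> i:]"
definition P where "P = (\<Prod>i\<in>J. L i)"
definition w where "w e = (\<Sum>i\<in>J. Polynomial.smult (of_nat (e i) * \<beta> i / of_nat (q i)) (\<Prod>k\<in>J - {i}. L k))"
definition \<Psi> where "\<Psi> e = (\<Prod>i\<in>J. \<psi> i ^ e i)" for e :: "nat \<Rightarrow> nat"

lemma \<psi>_nz: "i \<in> J \<Longrightarrow> \<psi> i \<noteq> 0"
  using \<psi>[of i] \<beta>[of i] q[of i] by (auto simp: power_0_left fps_of_poly_eq_0 simp del: fps_of_poly_pCons)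

lemma \<Psi>_nz: "\<Psi> e \<noteq> 0"
  unfolding \<Psi>_def using J \<psi>_nz by (auto simp: prod_zero_iff)

lemma deriv_\<psi>:
  assumes i: "i \<in> J"
  shows "fps_of_poly (L i) * fps_deriv (\<psi> i ^ m) = fps_const (of_nat m * \<beta> i / of_nat (q i)) * \<psi> i ^ m"
proof -
  have qi: "q i = Suc (q i - 1)" using q[OF i] by simp
  have "fps_deriv (\<psi> i ^ q i) = fps_const (\<beta> i)"
    unfolding \<psi>[OF i] fps_of_poly_pderiv[symmetric] by (simp add: pderiv_pCons)
  then have "of_nat (q i) * fps_deriv (\<psi> i) * \<psi> i ^ (q i - 1) = fps_const (\<beta> i)"
    by (simp add: fps_deriv_power')
  then have "of_nat (q i) * fps_deriv (\<psi> i) * \<psi> i ^ (q i - 1) * \<psi> i = fps_const (\<beta> i) * \<psi> i" by (rule arg_cong)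
  then have "of_nat (q i) * fps_deriv (\<psi> i) * (\<psi> i ^ (q i - 1) * \<psi> i) = fps_const (\<beta> i) * \<psi> i"
    by (simp only: mult.assoc)
  moreover have mm: "\<psi> i ^ (q i - 1) * \<psi> i = fps_of_poly (L i)"
    unfolding L_def \<psi>[OF i, symmetric] by (subst (2) qi) (simp add: mult.commute)
  ultimately have "fps_const (of_nat (q i)) * (fps_of_poly (L i) * fps_deriv (\<psi> i)) = fps_const (\<beta> i) * \<psi> i"
    unfolding mm by (simp add: fps_of_nat ac_simps)
  then have "fps_const (inverse (of_nat (q i))) * (fps_const (of_nat (q i)) * (fps_of_poly (L i) * fps_deriv (\<psi> i)))
      = fps_const (inverse (of_nat (q i))) * (fps_const (\<beta> i) * \<psi> i)" by simp
  then have 1: "fps_of_poly (L i) * fps_deriv (\<psi> i) = fps_const (\<beta> i / of_nat (q i)) * \<psi> i"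
    unfolding mult.assoc[symmetric] fps_const_mult using q[OF i] by (simp add: divide_inverse mult.commute)
  show ?thesis
  proof (cases m)
    case (Suc m')
    have "fps_deriv (\<psi> i ^ m) = of_nat m * fps_deriv (\<psi> i) * \<psi> i ^ m'"
      using fps_deriv_power'[of "\<psi> i" m] unfolding Suc diff_Suc_1 .
    then have "fps_of_poly (L i) * fps_deriv (\<psi> i ^ m) = of_nat m * (fps_of_poly (L i) * fps_deriv (\<psi> i)) * \<psi> i ^ m'"
      by (simp only: ac_simps)
    also have "\<dots> = fps_const (of_nat m * (\<beta> i / of_nat (q i))) * \<psi> i ^ m"
      unfolding 1 by (simp add: Suc fps_of_nat[symmetric] ac_simps flip: fps_const_mult)
    finally show ?thesis by simp
  qed simp
qed

lemma deriv_prod: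
  assumes "finite K" "K \<subseteq> J"
  shows "fps_of_poly (\<Prod>i\<in>K. L i) * fps_deriv (\<Prod>i\<in>K. \<psi> i ^ e i) =
    fps_of_poly (\<Sum>i\<in>K. Polynomial.smult (of_nat (e i) * \<beta> i / of_nat (q i)) (\<Prod>k\<in>K - {i}. L k)) * (\<Prod>i\<in>K. \<psi> i ^ e i)"
  using assms
proof (induction K rule: finite_induct)
  case (insert x K)
  let ?t = "\<lambda>i. of_nat (e i) * \<beta> i / of_nat (q i)"
  have "(\<Sum>i\<in>K. Polynomial.smult (?t i) (\<Prod>k\<in>insert x K - {i}. L k)) = L x * (\<Sum>i\<in>K. Polynomial.smult (?t i) (\<Prod>k\<in>K - {i}. L k))"
    unfolding sum_distrib_left
  proof (rule sum.cong[OF refl])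
    fix i assume "i \<in> K"
    then have "insert x K - {i} = insert x (K - {i})" using insert by auto
    then show "Polynomial.smult (?t i) (\<Prod>k\<in>insert x K - {i}. L k) = L x * Polynomial.smult (?t i) (\<Prod>k\<in>K - {i}. L k)"
      using insert by simp
  qed
  then have s: "(\<Sum>i\<in>insert x K. Polynomial.smult (?t i) (\<Prod>k\<in>insert x K - {i}. L k)) =
      Polynomial.smult (?t x) (\<Prod>k\<in>K. L k) + L x * (\<Sum>i\<in>K. Polynomial.smult (?t i) (\<Prod>k\<in>K - {i}. L k))"
    using insert by simp
  let ?Q = "\<Prod>k\<in>K. L k" and ?R = "\<Prod>i\<in>K. \<psi> i ^ e i" and ?S = "\<Sum>i\<in>K. Polynomial.smult (?t i) (\<Prod>k\<in>K - {i}. L k)"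
  have sm: "fps_of_poly (Polynomial.smult k p) = fps_const k * fps_of_poly p" for k p by (simp add: fps_eq_iff)
  have "fps_of_poly (L x * ?Q) * fps_deriv (\<psi> x ^ e x * ?R) =
      (fps_of_poly (L x) * fps_deriv (\<psi> x ^ e x)) * fps_of_poly ?Q * ?R + fps_of_poly (L x) * \<psi> x ^ e x * (fps_of_poly ?Q * fps_deriv ?R)"
    by (simp add: fps_of_poly_mult algebra_simps)
  also have "\<dots> = (fps_const (?t x) * \<psi> x ^ e x) * fps_of_poly ?Q * ?R + fps_of_poly (L x) * \<psi> x ^ e x * (fps_of_poly ?S * ?R)"
    using insert deriv_\<psi>[of x "e x"] by simp
  also have "\<dots> = fps_of_poly (Polynomial.smult (?t x) ?Q + L x * ?S) * (\<psi> x ^ e x * ?R)"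
    by (simp add: fps_of_poly_add fps_of_poly_mult sm algebra_simps)
  finally show ?case using insert s by simp
qed simp

lemma deriv_\<Psi>: "fps_of_poly P * fps_deriv (\<Psi> e) = fps_of_poly (w e) * \<Psi> e"
  unfolding P_def \<Psi>_def w_def by (rule deriv_prod[OF J subset_refl])

lemma exponents_congruent:
  assumes C: "C0 \<noteq> 0" "C1 \<noteq> 0" and i: "i \<in> J"
    and eq: "C0 * (P * pderiv C1 + w e1 * C1) = C1 * (P * pderiv C0 + w e0 * C0)"
  shows "int (q i) dvd int (e0 i) - int (e1 i)"
proof -
  define \<rho> where "\<rho> = - \<alpha> i / \<beta> i"
  define X where "X = [:- \<rho>, 1:]"
  define Pi where "Pi = (\<Prod>k\<in>J - {i}. L k)"
  have bi: "\<beta> i \<noteq> 0" using \<beta> i by simp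
  have Li: "L i = Polynomial.smult (\<beta> i) X" using bi by (simp add: L_def X_def \<rho>_def)
  have P: "P = Polynomial.smult (\<beta> i) (X * Pi)" unfolding P_def Pi_def using i J by (simp add: prod.remove Li)
  have "poly (L k) \<rho> \<noteq> 0" if "k \<in> J - {i}" for k
    using distinct[of i k] i that bi \<beta>[of k] by (auto simp: L_def \<rho>_def field_simps)
  then have Pi0: "poly Pi \<rho> \<noteq> 0" unfolding Pi_def using J by (simp add: poly_prod prod_zero_iff)
  have w: "poly (w e) \<rho> = of_nat (e i) * \<beta> i / of_nat (q i) * poly Pi \<rho>" for e
  proof -
    have "poly (w e) \<rho> = (\<Sum>i'\<in>J. if i' = i then of_nat (e i) * \<beta> i / of_nat (q i) * poly Pi \<rho> else 0)"
      unfolding w_def poly_sum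
    proof (rule sum.cong[OF refl])
      fix i' assume "i' \<in> J"
      have "poly (\<Prod>k\<in>J - {i'}. L k) \<rho> = 0" if "i' \<noteq> i"
        using J i that by (auto simp: poly_prod prod_zero_iff Li X_def intro!: bexI[of _ i])
      then show "poly (Polynomial.smult (of_nat (e i') * \<beta> i' / of_nat (q i')) (\<Prod>k\<in>J - {i'}. L k)) \<rho> =
          (if i' = i then of_nat (e i) * \<beta> i / of_nat (q i) * poly Pi \<rho> else 0)"
        by (auto simp: Pi_def)
    qed
    then show ?thesis using i J by simp
  qed
  obtain s A where A: "C0 = X ^ s * A" "\<not> X dvd A" using order_decomp[OF C(1), of \<rho>] unfolding X_def by blast
  obtain t B where B: "C1 = X ^ t * B" "\<not> X dvd B" using order_decomp[OF C(2), of \<rho>] unfolding X_def by blast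
  have pX: "X * pderiv (X ^ m * A) = X ^ m * (of_nat m * A + X * pderiv A)" for m A
  proof -
    have "pderiv X = 1" by (simp add: X_def pderiv_pCons one_pCons)
    have "X * pderiv (X ^ m) = of_nat m * X ^ m"
    proof (cases m)
      case (Suc m')
      have "pderiv (X ^ Suc m') = of_nat (Suc m') * X ^ m'"
        unfolding pderiv_power_Suc using \<open>pderiv X = 1\<close> by (simp add: of_nat_poly del: of_nat_Suc)
      then show ?thesis unfolding Suc by (simp add: ac_simps del: of_nat_Suc)
    qed simp
    then show ?thesis by (simp add: pderiv_mult algebra_simps)
  qed
  have "X * (C0 * pderiv C1) = C0 * (X * pderiv C1)" by (simp only: ac_simps)
  also have "\<dots> = X ^ (s + t) * (A * (of_nat t * B + X * pderiv B))"
    unfolding A(1) B(1) pX by (simp only: power_add ac_simps)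
  finally have c1: "X * (C0 * pderiv C1) = X ^ (s + t) * (A * (of_nat t * B + X * pderiv B))" .
  have "X * (C1 * pderiv C0) = C1 * (X * pderiv C0)" by (simp only: ac_simps)
  also have "\<dots> = X ^ (s + t) * (B * (of_nat s * A + X * pderiv A))"
    unfolding A(1) B(1) pX by (simp only: power_add ac_simps)
  finally have c2: "X * (C1 * pderiv C0) = X ^ (s + t) * (B * (of_nat s * A + X * pderiv A))" .
  have "Polynomial.smult (\<beta> i) Pi * (X * (C0 * pderiv C1)) - Polynomial.smult (\<beta> i) Pi * (X * (C1 * pderiv C0)) = (w e0 - w e1) * (C0 * C1)"
    using eq unfolding P by (simp add: algebra_simps)
  moreover have "C0 * C1 = X ^ (s + t) * (A * B)" unfolding A(1) B(1) by (simp only: power_add ac_simps)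
  ultimately have "X ^ (s + t) * (Polynomial.smult (\<beta> i) Pi * (A * (of_nat t * B + X * pderiv B)) - Polynomial.smult (\<beta> i) Pi * (B * (of_nat s * A + X * pderiv A))) =
      X ^ (s + t) * ((w e0 - w e1) * (A * B))"
    unfolding c1 c2 by (simp only: right_diff_distrib mult.left_commute[of "X ^ (s + t)"])
  moreover have "X ^ (s + t) \<noteq> 0" by (simp add: X_def)
  ultimately have E: "Polynomial.smult (\<beta> i) Pi * (A * (of_nat t * B + X * pderiv B)) - Polynomial.smult (\<beta> i) Pi * (B * (of_nat s * A + X * pderiv A)) = (w e0 - w e1) * (A * B)"
    by (simp only: mult_cancel_left) simp
  define K where "K = \<beta> i * poly Pi \<rho> * (poly A \<rho> * poly B \<rho>)"
  have X0: "poly X \<rho> = 0" by (simp add: X_def)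
  have on: "poly (of_nat m) \<rho> = of_nat m" for m by (simp add: of_nat_poly)
  have "poly A \<rho> \<noteq> 0" "poly B \<rho> \<noteq> 0" using A(2) B(2) by (auto simp: X_def poly_eq_0_iff_dvd)
  then have K: "K \<noteq> 0" using Pi0 bi by (simp add: K_def)
  have "K * (of_nat t - of_nat s) = K * ((of_nat (e0 i) - of_nat (e1 i)) / of_nat (q i))"
    using arg_cong[OF E, of "\<lambda>p. poly p \<rho>"] by (simp add: X0 w on K_def algebra_simps diff_divide_distrib)
  then have "of_nat t - of_nat s = (of_nat (e0 i) - of_nat (e1 i)) / (of_nat (q i) :: 'k)"
    unfolding mult_cancel_left using K by blast
  then have "(of_nat t - of_nat s) * of_nat (q i) = (of_nat (e0 i) - of_nat (e1 i) :: 'k)" using q[OF i] by (simp add: field_simps)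
  then have "(of_int ((int t - int s) * int (q i)) :: 'k) = of_int (int (e0 i) - int (e1 i))" by simp
  then have "(int t - int s) * int (q i) = int (e0 i) - int (e1 i)" by (simp only: of_int_eq_iff)
  then show ?thesis by (metis dvd_triv_right)
qed

text \<open>A shortest relation is differentiated logarithmically; eliminating one term yields a
  shorter one.\<close>

lemma radicals_independent:
  assumes "finite F" "\<And>e e'. e \<in> F \<Longrightarrow> e' \<in> F \<Longrightarrow> e \<noteq> e' \<Longrightarrow> \<exists>i\<in>J. \<not> int (q i) dvd int (e i) - int (e' i)"
    and "(\<Sum>e\<in>F. fps_of_poly (C e) * \<Psi> e) = 0" "e \<in> F"
  shows "C e = 0"
  using assms
proof (induction "card F" arbitrary: F C e rule: less_induct)
  case less
  show ?case
  proof (cases "\<exists>e0\<in>F. C e0 = 0")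
    case True
    then obtain e0 where e0: "e0 \<in> F" "C e0 = 0" by blast
    have "(\<Sum>e\<in>F - {e0}. fps_of_poly (C e) * \<Psi> e) = 0"
      using less(4) e0 less(2) by (simp add: sum.remove)
    moreover have "card (F - {e0}) < card F" using e0 less(2) by (meson card_Diff1_less)
    ultimately show ?thesis using less(1)[of "F - {e0}" C e] less e0 by (cases "e = e0") auto
  next
    case False
    show ?thesis
    proof (cases "F = {e}")
      case True
      then show ?thesis using less(4) \<Psi>_nz by (simp add: fps_of_poly_eq_0)
    next
      case ne: False
      then obtain e1 where e1: "e1 \<in> F" "e1 \<noteq> e" using less(5) by blast
      define C' where "C' x = C e * (P * pderiv (C x) + w x * C x) - C x * (P * pderiv (C e) + w e * C e)" for x
      have D: "fps_of_poly P * fps_deriv (fps_of_poly (C x) * \<Psi> x) = fps_of_poly (P * pderiv (C x) + w x * C x) * \<Psi> x" for x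
      proof -
        have "fps_of_poly P * fps_deriv (fps_of_poly (C x) * \<Psi> x) =
          fps_of_poly P * fps_of_poly (pderiv (C x)) * \<Psi> x + fps_of_poly (C x) * (fps_of_poly P * fps_deriv (\<Psi> x))"
          by (simp add: fps_of_poly_pderiv algebra_simps)
        then show ?thesis unfolding deriv_\<Psi> by (simp add: fps_of_poly_add fps_of_poly_mult algebra_simps)
      qed
      have ds: "fps_deriv (sum f F) = (\<Sum>x\<in>F. fps_deriv (f x))" for f :: "(nat \<Rightarrow> nat) \<Rightarrow> 'k fps"
        by (induction F rule: infinite_finite_induct) auto
      have "fps_of_poly P * fps_deriv (\<Sum>x\<in>F. fps_of_poly (C x) * \<Psi> x) = 0" unfolding less(4) by simp
      then have "(\<Sum>x\<in>F. fps_of_poly (P * pderiv (C x) + w x * C x) * \<Psi> x) = 0"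
        unfolding ds sum_distrib_left D .
      then have "fps_of_poly (C e) * (\<Sum>x\<in>F. fps_of_poly (P * pderiv (C x) + w x * C x) * \<Psi> x)
          - fps_of_poly (P * pderiv (C e) + w e * C e) * (\<Sum>x\<in>F. fps_of_poly (C x) * \<Psi> x) = 0" using less(4) by simp
      then have "(\<Sum>x\<in>F. fps_of_poly (C' x) * \<Psi> x) = 0"
        unfolding sum_distrib_left sum_subtractf[symmetric] C'_def fps_of_poly_diff fps_of_poly_mult
        by (simp only: left_diff_distrib) (simp only: ac_simps)
      moreover have "C' e = 0" by (simp add: C'_def)
      ultimately have "(\<Sum>x\<in>F - {e}. fps_of_poly (C' x) * \<Psi> x) = 0"
        using less(2,5) by (simp add: sum.remove)
      moreover have "card (F - {e}) < card F" using less(2,5) by (meson card_Diff1_less)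
      ultimately have "C' e1 = 0" using less(1)[of "F - {e}" C' e1] less e1 by auto
      then have "int (q i) dvd int (e i) - int (e1 i)" if "i \<in> J" for i
        using exponents_congruent[of "C e" "C e1" i e1 e] that False less(5) e1 by (simp add: C'_def)
      then show ?thesis using less(3)[of e e1] less(5) e1 by blast
    qed
  qed
qed

end

lemma linear_powers_independent:
  fixes L :: "'k::field_char_0 poly"
  assumes "finite F" "inj_on k F" "degree L > 0" "(\<Sum>m\<in>F. Polynomial.smult (x m) (L ^ k m)) = 0" "m \<in> F"
  shows "x m = 0"
proof -
  let ?p = "\<Sum>m\<in>F. monom (x m) (k m)"
  have "pcompose ?p L = (\<Sum>m\<in>F. Polynomial.smult (x m) (L ^ k m))"
  proof -
    have "pcompose (monom y j) L = Polynomial.smult y (L ^ j)" for y j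
      by (induction j) (auto simp: monom_0 monom_Suc pcompose_pCons)
    then show ?thesis by (simp add: pcompose_sum)
  qed
  then have "?p = 0" using assms(3,4) pcompose_eq_0 by simp
  moreover have "coeff ?p (k m) = (\<Sum>m'\<in>F. if m' = m then x m else 0)"
    unfolding coeff_sum by (rule sum.cong) (use assms(2,5) in \<open>auto simp: inj_on_def\<close>)
  ultimately show ?thesis using assms(1,5) by simp
qed

section \<open>Embedding the trinomial algebra into a domain\<close>

lemma mon_single_weights:
  "mon (\<lambda>v. single (wt v) (s v)) m =
    single (\<Sum>v\<in>keys m. \<Sum>x<lookup m v. wt v) (mon s m)"
proof -
  have pw: "single a b ^ n = single (\<Sum>x<n. a) (b ^ n)" for a :: "'a::comm_monoid_add" and b :: "'b::comm_ring_1" and n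
  proof (induction n)
    case (Suc n)
    have "single a b ^ Suc n = single a b * single (\<Sum>x<n. a) (b ^ n)" using Suc by simp
    then show ?case by (simp add: mult_single lessThan_Suc)
  qed simp
  have "(\<Prod>v\<in>K. single (wt v) (s v) ^ lookup m v) =
      single (\<Sum>v\<in>K. \<Sum>x<lookup m v. wt v) (\<Prod>v\<in>K. s v ^ lookup m v)" for K
    by (induction K rule: infinite_finite_induct) (auto simp: pw mult_single)
  then show ?thesis by (simp only: mon_def)
qed

context trinomial_torus
begin

definition wbase where "wbase = prod_encode (0, 0)"
definition wcode where "wcode i j = prod_encode (i, j)"

lemma wcode_inj: "wcode i j = wcode i' j' \<longleftrightarrow> i = i' \<and> j = j'"
  by (simp add: wcode_def)

lemma wcode_base: "j \<ge> 2 \<Longrightarrow> wcode i j \<noteq> wbase"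
  by (simp add: wcode_def wbase_def)

definition Lam where "Lam = (\<Prod>i\<le>r. l i 1)"

text \<open>A grading by a free abelian group in which all the monomials \<open>T_i^{l_i}\<close> have the
  same weight \<open>Lam\<close> in the base coordinate.\<close>

definition wt :: "generator \<Rightarrow> nat \<Rightarrow>\<^sub>0 int" where
  "wt w = (case w of T i j \<Rightarrow>
      if j = 1 then single wbase (int (Lam div l i 1)) - (\<Sum>j' = 2..n i. single (wcode i j') (int (l i j')))
      else single (wcode i j) (int (l i 1))
    | S k \<Rightarrow> 0)"

definition Wt where "Wt m = (\<Sum>v\<in>keys m. \<Sum>x<lookup m v. wt v)"

lemma lookup_Wt:
  assumes "finite W" "\<And>v. v \<in> keys m \<Longrightarrow> v \<notin> W \<Longrightarrow> lookup (wt v) k = 0"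
  shows "lookup (Wt m) k = (\<Sum>v\<in>W. int (lookup m v) * lookup (wt v) k)"
proof -
  have "lookup (Wt m) k = (\<Sum>v\<in>keys m. int (lookup m v) * lookup (wt v) k)"
    unfolding Wt_def by (simp only: lookup_sum) simp
  also have "\<dots> = (\<Sum>v\<in>keys m \<union> W. int (lookup m v) * lookup (wt v) k)"
    by (rule sum.mono_neutral_left) (use assms in \<open>auto simp: in_keys_iff\<close>)
  also have "\<dots> = (\<Sum>v\<in>W. int (lookup m v) * lookup (wt v) k)"
    by (rule sum.mono_neutral_right) (use assms in auto)
  finally show ?thesis .
qed

lemma lookup_wt_T1: "lookup (wt (T i 1)) k = (if k = wbase then int (Lam div l i 1) else 0) - (\<Sum>j' = 2..n i. if k = wcode i j' then int (l i j') else 0)"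
  by (simp add: wt_def lookup_minus lookup_sum lookup_single when_def eq_commute[of k] cong: sum.cong)

lemma lookup_wt_T: "j \<noteq> 1 \<Longrightarrow> lookup (wt (T i j)) k = (if k = wcode i j then int (l i 1) else 0)"
  by (simp add: wt_def lookup_single when_def eq_commute[of k])

lemma Wt_base:
  assumes "keys m \<subseteq> gens 0"
  shows "lookup (Wt m) wbase = (\<Sum>i\<le>r. int (lookup m (T i 1)) * int (Lam div l i 1))"
proof -
  have nb: "wcode i j' \<noteq> wbase" "wbase \<noteq> wcode i j'" if "2 \<le> j'" for i j' using wcode_base[OF that, of i] by metis+
  have "lookup (Wt m) wbase = (\<Sum>v\<in>(\<lambda>i. T i 1) ` {..r}. int (lookup m v) * lookup (wt v) wbase)"
  proof (rule lookup_Wt)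
    fix v assume v: "v \<in> keys m" "v \<notin> (\<lambda>i. T i 1) ` {..r}"
    then have "v \<in> gens 0" using assms by blast
    then obtain i j where ij: "v = T i j" "i \<le> r" "1 \<le> j" by (cases v) (auto simp: gens_T gens_S)
    then have "2 \<le> j" using v by (cases "j = 1") auto
    then show "lookup (wt v) wbase = 0" using nb[of j i] by (simp add: ij lookup_wt_T)
  qed simp
  also have "\<dots> = (\<Sum>i\<le>r. int (lookup m (T i 1)) * lookup (wt (T i 1)) wbase)"
    by (subst sum.reindex) (auto simp: inj_on_def)
  also have "\<dots> = (\<Sum>i\<le>r. int (lookup m (T i 1)) * int (Lam div l i 1))"
    by (intro sum.cong refl) (simp only: lookup_wt_T1, simp add: nb sum.neutral)
  finally show ?thesis .
qed

lemma Wt_code: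
  assumes "keys m \<subseteq> gens 0" "i \<le> r" "2 \<le> j" "j \<le> n i"
  shows "lookup (Wt m) (wcode i j) = int (lookup m (T i j)) * int (l i 1) - int (lookup m (T i 1)) * int (l i j)"
proof -
  have nb: "wcode i j \<noteq> wbase" using wcode_base assms by simp
  have T1: "lookup (wt (T i' 1)) (wcode i j) = (if i' = i then - int (l i j) else 0)" for i'
  proof -
    have "(\<Sum>j' = 2..n i'. if wcode i j = wcode i' j' then int (l i' j') else 0) =
        (\<Sum>j' = 2..n i'. if j' = j then (if i' = i then int (l i j) else 0) else 0)"
      by (rule sum.cong) (auto simp: wcode_inj)
    then show ?thesis unfolding lookup_wt_T1 using nb assms by auto
  qed
  have "lookup (Wt m) (wcode i j) = (\<Sum>v\<in>{T i 1, T i j}. int (lookup m v) * lookup (wt v) (wcode i j))"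
  proof (rule lookup_Wt)
    fix v assume v: "v \<in> keys m" "v \<notin> {T i 1, T i j}"
    then have "v \<in> gens 0" using assms by blast
    then obtain i' j' where ij: "v = T i' j'" by (cases v) (auto simp: gens_T gens_S)
    show "lookup (wt v) (wcode i j) = 0"
    proof (cases "j' = 1")
      case True then show ?thesis using v ij T1[of i'] by auto
    next
      case False then show ?thesis using v ij by (auto simp: lookup_wt_T wcode_inj)
    qed
  qed simp
  then show ?thesis using assms T1[of i] by (simp add: lookup_wt_T)
qed

lemma Wt_lmono:
  assumes i: "i \<le> r" shows "Wt (lmono i) = single wbase (int Lam)"
proof (rule poly_mapping_eqI)
  fix k
  have li: "l i 1 dvd Lam" unfolding Lam_def using i by (intro dvd_prodI) auto
  have z: "lookup (wt v) k = 0" if "v \<in> gens 0" "k \<noteq> wbase" "\<And>i j. k = wcode i j \<Longrightarrow> i \<le> r \<Longrightarrow> 2 \<le> j \<Longrightarrow> j \<le> n i \<Longrightarrow> False" for v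
  proof -
    obtain i' j' where ij: "v = T i' j'" "i' \<le> r" "1 \<le> j'" "j' \<le> n i'" using \<open>v \<in> gens 0\<close> by (cases v) (auto simp: gens_T gens_S)
    show ?thesis
    proof (cases "j' = 1")
      case True
      have "(\<Sum>j' = 2..n i'. if k = wcode i' j' then int (l i' j') else 0) = 0"
      proof (intro sum.neutral ballI)
        fix x assume "x \<in> {2..n i'}"
        then have "k \<noteq> wcode i' x" using that(3)[of i' x] ij(2) by auto
        then show "(if k = wcode i' x then int (l i' x) else 0) = 0" by simp
      qed
      then show ?thesis using that(2) unfolding ij(1) True lookup_wt_T1 by simp
    next
      case False
      then have "2 \<le> j'" using ij(3) by simp
      then have "k \<noteq> wcode i' j'" using that(3)[of i' j'] ij by auto
      then show ?thesis using False by (simp add: ij(1) lookup_wt_T)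
    qed
  qed
  show "lookup (Wt (lmono i)) k = lookup (single wbase (int Lam)) k"
  proof (cases "k = wbase")
    case True
    have "(\<Sum>i'\<le>r. int (lookup (lmono i) (T i' 1)) * int (Lam div l i' 1)) = (\<Sum>i'\<le>r. if i' = i then int (l i 1) * int (Lam div l i 1) else 0)"
      using n1 by (intro sum.cong) (auto simp: lookup_lmono)
    also have "\<dots> = int Lam" using i li by (simp flip: of_nat_mult)
    finally show ?thesis using True Wt_base[OF keys_lmono[OF i]] by simp
  next
    case False
    show ?thesis
    proof (cases "\<exists>i j. k = wcode i j \<and> i \<le> r \<and> 2 \<le> j \<and> j \<le> n i")
      case True
      then obtain i' j' where k: "k = wcode i' j'" "i' \<le> r" "2 \<le> j'" "j' \<le> n i'" by blast
      then show ?thesis using False Wt_code[OF keys_lmono[OF i], of i' j'] by (auto simp: lookup_lmono lookup_single)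
    next
      case no: False
      have "lookup (Wt (lmono i)) k = (\<Sum>v\<in>{}. int (lookup (lmono i) v) * lookup (wt v) k)"
      proof (rule lookup_Wt)
        fix v assume "v \<in> keys (lmono i)"
        then have "v \<in> gens 0" using keys_lmono[OF i] by blast
        then show "lookup (wt v) k = 0" using z False no by blast
      qed simp
      then show ?thesis using False by (simp add: lookup_single)
    qed
  qed
qed

lemma Wt_eq_lattice:
  assumes m: "keys m \<subseteq> gens 0" "keys m' \<subseteq> gens 0" and eq: "Wt m = Wt m'"
    and q: "\<And>i. 1 \<le> i \<Longrightarrow> i \<le> r \<Longrightarrow> int (lookup m (T i 1)) = int (lookup m' (T i 1)) + q i * int (l i 1)"
    and q0: "q 0 = - (\<Sum>i = 1..r. q i)"
    and ij: "i \<le> r" "j \<in> {1..n i}"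
  shows "int (lookup m (T i j)) = int (lookup m' (T i j)) + q i * int (l i j)"
proof -
  have lp: "l i 1 > 0" if "i \<le> r" for i using l1[of i 1] n1[of i] that by simp
  have Lp: "Lam > 0" unfolding Lam_def using lp by (intro prod_pos) auto
  have d: "int (Lam div l i 1) * int (l i 1) = int Lam" if "i \<le> r" for i
  proof -
    have "l i 1 dvd Lam" unfolding Lam_def using that by (intro dvd_prodI) auto
    then show ?thesis by (metis dvd_div_mult_self of_nat_mult)
  qed
  define x where "x i = int (lookup m (T i 1)) - int (lookup m' (T i 1))" for i
  have "(\<Sum>i\<le>r. x i * int (Lam div l i 1)) = 0"
    using Wt_base[OF m(1)] Wt_base[OF m(2)] eq by (simp add: x_def left_diff_distrib sum_subtractf)
  moreover have "{..r} = insert 0 {1..r}" by auto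
  ultimately have "x 0 * int (Lam div l 0 1) + (\<Sum>i=1..r. x i * int (Lam div l i 1)) = 0" by simp
  moreover have "(\<Sum>i=1..r. x i * int (Lam div l i 1)) = (\<Sum>i=1..r. q i * int Lam)"
  proof (rule sum.cong[OF refl])
    fix i assume i: "i \<in> {1..r}"
    then have "x i = q i * int (l i 1)" using q[of i] by (simp add: x_def)
    then show "x i * int (Lam div l i 1) = q i * int Lam" using d[of i] i by (simp add: ac_simps)
  qed
  ultimately have "x 0 * int (Lam div l 0 1) = q 0 * int Lam" by (simp add: q0 sum_distrib_right sum_negf)
  moreover have "x 0 * int Lam = (x 0 * int (Lam div l 0 1)) * int (l 0 1)"
    unfolding d[of 0, simplified, symmetric] by (simp add: mult.assoc)
  ultimately have "x 0 * int Lam = q 0 * int (l 0 1) * int Lam" by (simp only: ac_simps)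
  then have x0: "x 0 = q 0 * int (l 0 1)" using Lp by simp
  have q1: "int (lookup m (T i 1)) = int (lookup m' (T i 1)) + q i * int (l i 1)" if "i \<le> r" for i
    using q[of i] x0 that by (cases "i = 0") (auto simp: x_def)
  show ?thesis
  proof (cases "j = 1")
    case True then show ?thesis using q1[OF ij(1)] by simp
  next
    case False
    then have j: "2 \<le> j" "j \<le> n i" using ij by auto
    have "int (lookup m (T i j)) * int (l i 1) - int (lookup m (T i 1)) * int (l i j) = int (lookup m' (T i j)) * int (l i 1) - int (lookup m' (T i 1)) * int (l i j)"
      using Wt_code[OF m(1) ij(1) j] Wt_code[OF m(2) ij(1) j] eq by simp
    then have "int (l i 1) * (int (lookup m (T i j)) - (int (lookup m' (T i j)) + q i * int (l i j))) = 0"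
      unfolding q1[OF ij(1)] by (simp add: algebra_simps)
    then show ?thesis using lp[OF ij(1)] by simp
  qed
qed

lemma std_q_zero:
  assumes "std m" "std m'" "2 \<le> i" "i \<le> r"
    and "\<And>j. j \<in> {1..n i} \<Longrightarrow> int (lookup m (T i j)) = int (lookup m' (T i j)) + q * int (l i j)"
  shows "q = (0::int)"
proof (rule ccontr)
  assume "q \<noteq> 0"
  then consider "q \<ge> 1" | "- q \<ge> 1" by linarith
  then show False
  proof cases
    case 1
    obtain j where j: "j \<in> {1..n i}" "lookup m (T i j) < l i j"
      using assms(1)[unfolded std_def, THEN bspec, of i] assms(3,4) by auto
    have "int (l i j) \<le> q * int (l i j)" using mult_right_mono[OF 1, of "int (l i j)"] by simp
    then show False using assms(5)[OF j(1)] j(2) by linarith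
  next
    case 2
    obtain j where j: "j \<in> {1..n i}" "lookup m' (T i j) < l i j"
      using assms(2)[unfolded std_def, THEN bspec, of i] assms(3,4) by auto
    have "int (l i j) \<le> - q * int (l i j)" using mult_right_mono[OF 2, of "int (l i j)"] by simp
    then show False using assms(5)[OF j(1)] j(2) by simp
  qed
qed

lemma generic_point: "\<exists>s. \<forall>i\<le>r. a i $ 1 + s * a i $ 2 \<noteq> 0"
proof -
  have "finite ((\<lambda>i. - a i $ 1 / a i $ 2) ` {..r})" by simp
  then obtain s where s: "s \<notin> (\<lambda>i. - a i $ 1 / a i $ 2) ` {..r}" using infinite_UNIV_char_0 ex_new_if_finite by metis
  have "a i $ 1 + s * a i $ 2 \<noteq> 0" if i: "i \<le> r" for i
  proof
    assume 0: "a i $ 1 + s * a i $ 2 = 0"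
    show False
    proof (cases "a i $ 2 = 0")
      case True
      obtain k where "k \<le> r" "k \<noteq> i" using r2 by (metis le_trans one_le_numeral zero_le zero_neq_one)
      then show False using 0 True dt_nz[of i k] i by (simp add: dt_def)
    next
      case False
      then have "s = - a i $ 1 / a i $ 2" using 0 by (simp add: field_simps add_eq_0_iff)
      then show False using s i by auto
    qed
  qed
  then show ?thesis by blast
qed

theorem domain_model_exists:
  "\<exists>(c :: 'k \<Rightarrow> (nat \<Rightarrow>\<^sub>0 int) \<Rightarrow>\<^sub>0 'k fps) g u v. trinomial_model r n l a c 0 g u v"
proof -
  obtain s where s: "\<And>i. i \<le> r \<Longrightarrow> a i $ 1 + s * a i $ 2 \<noteq> 0" using generic_point by blast
  define \<alpha> where "\<alpha> i = a i $ 1 + s * a i $ 2" for i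
  define \<beta> where "\<beta> i = dt 0 i" for i
  have lp: "l i 1 > 0" if "i \<le> r" for i using l1[of i 1] n1[of i] that by simp
  have "\<exists>\<psi>. \<forall>i\<le>r. \<psi> i ^ l i 1 = fps_of_poly [:\<alpha> i, \<beta> i:] \<and> (i = 0 \<longrightarrow> (\<exists>z. \<psi> i = fps_const z))"
  proof (rule choice_iff'[THEN iffD1, rule_format])
    fix i assume i: "i \<le> r"
    show "\<exists>\<psi>. \<psi> ^ l i 1 = fps_of_poly [:\<alpha> i, \<beta> i:] \<and> (i = 0 \<longrightarrow> (\<exists>z. \<psi> = fps_const z))"
    proof (cases "i = 0")
      case True
      obtain z where "z ^ l 0 1 = \<alpha> 0" using nth_root_exists[OF lp[of 0], of "\<alpha> 0"] by auto
      then have "fps_const z ^ l 0 1 = fps_of_poly [:\<alpha> 0, \<beta> 0:]" by (simp add: \<beta>_def dt_def fps_const_power)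
      then show ?thesis using True by blast
    next
      case False
      have "fps_nth (fps_of_poly [:\<alpha> i, \<beta> i:]) 0 \<noteq> 0" using s[OF i] by (simp add: \<alpha>_def)
      then show ?thesis using fps_nth_root lp[OF i] False by metis
    qed
  qed
  then obtain \<psi> z where \<psi>: "\<And>i. i \<le> r \<Longrightarrow> \<psi> i ^ l i 1 = fps_of_poly [:\<alpha> i, \<beta> i:]" and z: "\<psi> 0 = fps_const z"
    by (metis le0)
  have z0: "z \<noteq> 0"
  proof
    assume "z = 0"
    then have "fps_of_poly [:\<alpha> 0, \<beta> 0:] = 0" using \<psi>[of 0] z lp[of 0] by (simp add: power_0_left)
    then show False using s[of 0] by (simp add: fps_of_poly_eq_0 \<alpha>_def del: fps_of_poly_pCons)
  qed
  interpret R: linear_radicals "{1..r}" \<alpha> \<beta> "\<lambda>i. l i 1" \<psi>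
  proof
    show "\<beta> i \<noteq> 0" if "i \<in> {1..r}" for i using that dt_nz[of 0 i] by (simp add: \<beta>_def)
    show "\<alpha> i * \<beta> k \<noteq> \<alpha> k * \<beta> i" if "i \<in> {1..r}" "k \<in> {1..r}" "i \<noteq> k" for i k
    proof
      assume "\<alpha> i * \<beta> k = \<alpha> k * \<beta> i"
      then have "\<alpha> i * \<beta> k - \<alpha> k * \<beta> i = 0" by simp
      then have "dt i k * \<alpha> 0 = 0" by (simp add: \<alpha>_def \<beta>_def dt_def algebra_simps)
      then show False using dt_nz[of i k] that s[of 0] by (simp add: \<alpha>_def)
    qed
  qed (use lp \<psi> in auto)
  define c :: "'k \<Rightarrow> (nat \<Rightarrow>\<^sub>0 int) \<Rightarrow>\<^sub>0 'k fps" where "c k = single 0 (fps_const k)" for k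
  interpret c: scalar_hom c
    by unfold_locales (auto simp: c_def single_add[symmetric] mult_single simp flip: fps_const_add fps_const_mult)
  define h where "h w = (case w of T i j \<Rightarrow> if j = 1 then \<psi> i else 1 | S k \<Rightarrow> 1)" for w
  define g where "g w = single (wt w) (h w)" for w
  have gm: "mon g m = single (Wt m) (mon h m)" for m
    unfolding Wt_def using mon_single_weights[of wt h m] by (simp add: g_def[abs_def])
  have hm: "mon h m = (\<Prod>i\<le>r. \<psi> i ^ lookup m (T i 1))" if "keys m \<subseteq> gens 0" for m
  proof -
    have "mon h m = (\<Prod>w\<in>keys m \<union> (\<lambda>i. T i 1) ` {..r}. h w ^ lookup m w)"
      by (rule mon_superset) auto
    also have "\<dots> = (\<Prod>w\<in>(\<lambda>i. T i 1) ` {..r}. h w ^ lookup m w)"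
    proof (rule prod.mono_neutral_right)
      show "\<forall>w\<in>keys m \<union> (\<lambda>i. T i 1) ` {..r} - (\<lambda>i. T i 1) ` {..r}. h w ^ lookup m w = 1"
      proof
        fix w assume w: "w \<in> keys m \<union> (\<lambda>i. T i 1) ` {..r} - (\<lambda>i. T i 1) ` {..r}"
        then have "w \<in> gens 0" using that by blast
        then show "h w ^ lookup m w = 1" using w by (cases w) (auto simp: gens_T h_def)
      qed
    qed auto
    also have "\<dots> = (\<Prod>i\<le>r. \<psi> i ^ lookup m (T i 1))"
      by (subst prod.reindex) (auto simp: inj_on_def h_def)
    finally show ?thesis .
  qed
  define u where "u = single (single wbase (int Lam)) (fps_of_poly [:1, - a 0 $ 2:])"
  define v where "v = single (single wbase (int Lam)) (fps_of_poly [:s, a 0 $ 1:])"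
  have "trinomial_model r n l a c 0 g u v"
  proof
    fix i assume i: "i \<le> r"
    have "mon h (lmono i) = (\<Prod>i'\<le>r. if i' = i then \<psi> i ^ l i 1 else 1)"
      unfolding hm[OF keys_lmono[OF i]] using n1 by (intro prod.cong) (auto simp: lookup_lmono)
    also have "\<dots> = fps_of_poly [:\<alpha> i, \<beta> i:]" using \<psi>[OF i] i by simp
    finally have "mon g (lmono i) = single (single wbase (int Lam)) (fps_of_poly [:\<alpha> i, \<beta> i:])"
      by (simp only: gm Wt_lmono[OF i])
    moreover have "fps_of_poly [:\<alpha> i, \<beta> i:] = fps_const (a i $ 1) * fps_of_poly [:1, - a 0 $ 2:] + fps_const (a i $ 2) * fps_of_poly [:s, a 0 $ 1:]"
      unfolding fps_of_poly_const[symmetric] fps_of_poly_mult[symmetric] fps_of_poly_add[symmetric]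
      by (simp add: \<alpha>_def \<beta>_def dt_def algebra_simps)
    ultimately show "(\<Prod>j = 1..n i. g (T i j) ^ l i j) = c (a i $ 1) * u + c (a i $ 2) * v"
      by (simp add: mon_lmono c_def u_def v_def mult_single single_add)
  next
    fix p assume p: "p \<in> PV (gens 0)" and std: "\<And>m. m \<in> keys p \<Longrightarrow> std m" and 0: "meval c g p = 0"
    have kG: "keys m \<subseteq> gens 0" if "m \<in> keys p" for m using p that by (simp add: PV_iff)
    show "p = 0"
    proof (rule ccontr)
      assume "p \<noteq> 0"
      then obtain m0 where m0: "m0 \<in> keys p" using keys_eq_empty by blast
      define K where "K = {m \<in> keys p. Wt m = Wt m0}"
      have K: "finite K" "m0 \<in> K" "\<And>m. m \<in> K \<Longrightarrow> m \<in> keys p" using m0 by (auto simp: K_def)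
      have "meval c g p = (\<Sum>m\<in>keys p. single (Wt m) (fps_const (lookup p m) * mon h m))"
        by (simp add: meval_def c_def gm mult_single)
      then have "lookup (\<Sum>m\<in>keys p. single (Wt m) (fps_const (lookup p m) * mon h m)) (Wt m0) = 0"
        using 0 by (simp only: lookup_zero)
      then have "0 = (\<Sum>m\<in>keys p. lookup (single (Wt m) (fps_const (lookup p m) * mon h m)) (Wt m0))"
        by (simp only: lookup_sum)
      also have "\<dots> = (\<Sum>m\<in>keys p. if Wt m = Wt m0 then fps_const (lookup p m) * mon h m else 0)"
        by (rule sum.cong) (auto simp: lookup_single)
      also have "\<dots> = (\<Sum>m\<in>K. fps_const (lookup p m) * mon h m)"
        unfolding K_def by (rule sum.inter_filter[symmetric]) simp
      finally have S0: "(\<Sum>m\<in>K. fps_const (lookup p m) * mon h m) = 0" by simp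
      define e where "e m = (\<lambda>i. if i \<in> {1..r} then lookup m (T i 1) mod l i 1 else 0)" for m
      define k where "k m i = lookup m (T i 1) div l i 1" for m i
      define C where "C m = Polynomial.smult (lookup p m * z ^ lookup m (T 0 1)) (\<Prod>i=1..r. R.L i ^ k m i)" for m
      have hC: "fps_const (lookup p m) * mon h m = fps_of_poly (C m) * R.\<Psi> (e m)" if "m \<in> K" for m
      proof -
        have "(\<Prod>i=1..r. \<psi> i ^ lookup m (T i 1)) = (\<Prod>i=1..r. fps_of_poly (R.L i ^ k m i) * \<psi> i ^ e m i)"
        proof (rule prod.cong[OF refl])
          fix i assume i: "i \<in> {1..r}"
          have "e m i = lookup m (T i 1) mod l i 1" unfolding e_def using i by (rule if_P)
          then have "lookup m (T i 1) = l i 1 * k m i + e m i" unfolding k_def by (simp only: mult_div_mod_eq)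
          then have "\<psi> i ^ lookup m (T i 1) = \<psi> i ^ (l i 1 * k m i + e m i)" by (rule ssubst) (rule refl)
          also have "\<dots> = (\<psi> i ^ l i 1) ^ k m i * \<psi> i ^ e m i" by (simp only: power_add power_mult)
          finally show "\<psi> i ^ lookup m (T i 1) = fps_of_poly (R.L i ^ k m i) * \<psi> i ^ e m i"
            using \<psi>[of i] i unfolding R.L_def fps_of_poly_power by (metis atLeastAtMost_iff)
        qed
        then have "(\<Prod>i=1..r. \<psi> i ^ lookup m (T i 1)) = fps_of_poly (\<Prod>i=1..r. R.L i ^ k m i) * R.\<Psi> (e m)"
          by (simp only: prod.distrib fps_of_poly_prod R.\<Psi>_def)
        moreover have "{..r} = insert 0 {1..r}" by auto
        then have "mon h m = \<psi> 0 ^ lookup m (T 0 1) * (\<Prod>i=1..r. \<psi> i ^ lookup m (T i 1))"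
          unfolding hm[OF kG[OF K(3)[OF that]]] by simp
        moreover have sm: "fps_of_poly (Polynomial.smult x y) = fps_const x * fps_of_poly y" for x y by (simp add: fps_eq_iff)
        ultimately show ?thesis
          by (simp only: C_def sm z fps_const_power fps_const_mult[symmetric] mult.assoc)
      qed
      have "(\<Sum>x\<in>e ` K. fps_of_poly (\<Sum>m\<in>{m \<in> K. e m = x}. C m) * R.\<Psi> x) = (\<Sum>m\<in>K. fps_const (lookup p m) * mon h m)"
      proof -
        have "(\<Sum>x\<in>e ` K. fps_of_poly (\<Sum>m\<in>{m \<in> K. e m = x}. C m) * R.\<Psi> x) = (\<Sum>x\<in>e ` K. \<Sum>m\<in>{m \<in> K. e m = x}. fps_const (lookup p m) * mon h m)"
          by (intro sum.cong refl) (simp add: fps_of_poly_sum sum_distrib_right hC)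
        also have "\<dots> = (\<Sum>m\<in>K. fps_const (lookup p m) * mon h m)" by (rule sum.image_gen[OF K(1), symmetric])
        finally show ?thesis .
      qed
      then have R0: "(\<Sum>x\<in>e ` K. fps_of_poly (\<Sum>m\<in>{m \<in> K. e m = x}. C m) * R.\<Psi> x) = 0" using S0 by simp
      define K0 where "K0 = {m \<in> K. e m = e m0}"
      have C0: "(\<Sum>m\<in>K0. C m) = 0"
        unfolding K0_def
      proof (rule R.radicals_independent[OF _ _ R0])
        show "finite (e ` K)" "e m0 \<in> e ` K" using K by auto
        fix x y assume "x \<in> e ` K" "y \<in> e ` K" "x \<noteq> y"
        then obtain m m' where mm: "x = e m" "y = e m'" by blast
        obtain i where i: "x i \<noteq> y i" using \<open>x \<noteq> y\<close> by blast
        then have i1: "i \<in> {1..r}" by (auto simp: mm e_def split: if_splits)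
        have "\<not> int (l i 1) dvd int (x i) - int (y i)"
        proof
          assume "int (l i 1) dvd int (x i) - int (y i)"
          then have "int (x i) mod int (l i 1) = int (y i) mod int (l i 1)" by (simp add: mod_eq_dvd_iff)
          then have "x i mod l i 1 = y i mod l i 1" by (metis of_nat_eq_iff zmod_int)
          then show False using i i1 by (simp add: mm e_def)
        qed
        then show "\<exists>i\<in>{1..r}. \<not> int (l i 1) dvd int (x i) - int (y i)" using i1 by blast
      qed
      have lat: "int (lookup m (T i j)) = int (lookup m' (T i j)) +
          (if i = 0 then - (\<Sum>i=1..r. int (k m i) - int (k m' i)) else int (k m i) - int (k m' i)) * int (l i j)"
        if m: "m \<in> K0" "m' \<in> K0" and ij: "i \<le> r" "j \<in> {1..n i}" for m m' i j
      proof (rule Wt_eq_lattice[OF _ _ _ _ _ ij])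
        show "keys m \<subseteq> gens 0" "keys m' \<subseteq> gens 0" using m kG K by (auto simp: K0_def)
        show "Wt m = Wt m'" using m by (simp add: K0_def K_def)
        fix i assume i: "1 \<le> i" "i \<le> r"
        have "e m i = e m' i" using m by (simp add: K0_def)
        then have "lookup m (T i 1) mod l i 1 = lookup m' (T i 1) mod l i 1" using i by (simp add: e_def)
        moreover have "lookup m (T i 1) = k m i * l i 1 + lookup m (T i 1) mod l i 1"
          "lookup m' (T i 1) = k m' i * l i 1 + lookup m' (T i 1) mod l i 1"
          unfolding k_def by (simp_all only: div_mult_mod_eq)
        ultimately have "int (lookup m (T i 1)) - int (lookup m' (T i 1)) = int (k m i * l i 1) - int (k m' i * l i 1)"
          by linarith
        then show "int (lookup m (T i 1)) = int (lookup m' (T i 1)) +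
            (if i = 0 then - (\<Sum>i=1..r. int (k m i) - int (k m' i)) else int (k m i) - int (k m' i)) * int (l i 1)"
          using i by (simp add: left_diff_distrib)
      qed simp
      have k2: "k m i = k m' i" if "m \<in> K0" "m' \<in> K0" "2 \<le> i" "i \<le> r" for m m' i
      proof -
        have "int (k m i) - int (k m' i) = 0"
        proof (rule std_q_zero[OF _ _ that(3,4)])
          show "std m" "std m'" using that std K by (auto simp: K0_def)
          show "int (lookup m (T i j)) = int (lookup m' (T i j)) + (int (k m i) - int (k m' i)) * int (l i j)" if "j \<in> {1..n i}" for j
            using lat[OF \<open>m \<in> K0\<close> \<open>m' \<in> K0\<close> \<open>i \<le> r\<close> that] \<open>2 \<le> i\<close> by simp
        qed
        then show ?thesis by simp
      qed
      have inj: "inj_on (\<lambda>m. k m 1) K0"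
      proof (rule inj_onI)
        fix m m' assume m: "m \<in> K0" "m' \<in> K0" "k m 1 = k m' 1"
        have kk: "k m i = k m' i" if "1 \<le> i" "i \<le> r" for i
          using k2[OF m(1,2), of i] m(3) that by (cases "i = 1") auto
        have "(\<Sum>i=1..r. int (k m i) - int (k m' i)) = 0" using kk by (intro sum.neutral) auto
        then have "lookup m (T i j) = lookup m' (T i j)" if "i \<le> r" "j \<in> {1..n i}" for i j
          using lat[OF m(1,2) that] kk[of i] that by (auto split: if_splits)
        moreover have "keys m \<subseteq> gens 0" "keys m' \<subseteq> gens 0" using m kG K by (auto simp: K0_def)
        ultimately have "lookup m w = lookup m' w" for w
        proof (cases "w \<in> gens 0")
          case True then show ?thesis using \<open>\<And>j i. i \<le> r \<Longrightarrow> j \<in> {1..n i} \<Longrightarrow> lookup m (T i j) = lookup m' (T i j)\<close>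
            by (cases w) (auto simp: gens_T gens_S)
        next
          case False then show ?thesis using \<open>keys m \<subseteq> gens 0\<close> \<open>keys m' \<subseteq> gens 0\<close>
 by (metis in_keys_iff subsetD)
        qed
        then show "m = m'" by (rule poly_mapping_eqI)
      qed
      have L1: "degree (R.L 1) > 0" using R.\<beta>[of 1] r2 by (simp add: R.L_def)
      have m00: "m0 \<in> K0" using K by (simp add: K0_def)
      define Q where "Q = (\<Prod>i=2..r. R.L i ^ k m0 i)"
      have Cm: "C m = Q * Polynomial.smult (lookup p m * z ^ lookup m (T 0 1)) (R.L 1 ^ k m 1)" if "m \<in> K0" for m
      proof -
        have "{1..r} = insert 1 {2..r}" using r2 by auto
        then have "(\<Prod>i=1..r. R.L i ^ k m i) = R.L 1 ^ k m 1 * (\<Prod>i=2..r. R.L i ^ k m i)" by simp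
        moreover have "(\<Prod>i=2..r. R.L i ^ k m i) = Q"
          unfolding Q_def using k2[OF that m00] by (intro prod.cong) auto
        ultimately show ?thesis by (simp add: C_def mult.commute[of Q])
      qed
      have "Q \<noteq> 0" unfolding Q_def
      proof (subst prod_zero_iff)
        show "\<not> (\<exists>i\<in>{2..r}. R.L i ^ k m0 i = 0)" using R.\<beta> by (auto simp: R.L_def)
      qed simp
      moreover have "Q * (\<Sum>m\<in>K0. Polynomial.smult (lookup p m * z ^ lookup m (T 0 1)) (R.L 1 ^ k m 1)) = 0"
        using C0 Cm by (simp add: sum_distrib_left)
      ultimately have "(\<Sum>m\<in>K0. Polynomial.smult (lookup p m * z ^ lookup m (T 0 1)) (R.L 1 ^ k m 1)) = 0" by simp
      note rel = this
      have "finite K0" using K(1) by (simp add: K0_def)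
      note linear_powers_independent[where x = "\<lambda>m. lookup p m * z ^ lookup m (T 0 1)", OF this inj L1 rel m00]
      then show False using m0 z0 by (simp add: in_keys_iff)
    qed
  qed
  then show ?thesis by blast
qed

end

section \<open>Free variables\<close>

lemma (in trinomial_model) not_semirigid_two_free:
  assumes "d \<ge> 2" shows "\<not> semirigid M"
proof
  assume s: "semirigid M"
  have "\<exists>\<delta>. nonzero_LND M \<delta> \<and> \<delta> (g (S k)) = 1 \<and> (\<forall>k'. 1 \<le> k' \<and> k' \<le> d \<and> k' \<noteq> k \<longrightarrow> \<delta> (g (S k')) = 0)"
    if k: "1 \<le> k" "k \<le> d" for k
  proof -
    have "\<exists>\<delta>. derivation M \<delta> \<and> (\<forall>w\<in>gens d. \<delta> (g w) = (if w = S k then 1 else 0))"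
    proof (rule derivation_exists[of "\<lambda>w. if w = S k then 1 else 0" 0 0])
      show "(if w = S k then 1 else 0) \<in> A" for w by (simp only: A.one_mem A.zero_mem split: if_split) simp
    qed (simp, blast)
    then obtain \<delta> where \<delta>: "derivation M \<delta>" "\<And>w. w \<in> gens d \<Longrightarrow> \<delta> (g w) = (if w = S k then 1 else 0)" by blast
    interpret D: subalg_derivation c A \<delta> by unfold_locales (rule \<delta>)
    have "(\<delta> ^^ 2) (g w) = 0" if "w \<in> gens d" for w
      using \<delta>(2)[OF that] by (simp add: numeral_2_eq_2)
    then have "LND M \<delta>" using LND_generators[OF \<delta>(1)] by blast
    moreover have Sk: "S k \<in> gens d" using k by (simp add: gens_S)
    then have "g (S k) \<in> A" "\<delta> (g (S k)) \<noteq> 0" using g_mem \<delta>(2)[OF Sk] by auto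
    ultimately have "nonzero_LND M \<delta>" unfolding nonzero_LND_def by auto
    then show ?thesis using \<delta>(2) Sk by (auto simp: gens_S)
  qed
  note ex = this
  obtain \<delta>1 where 1: "nonzero_LND M \<delta>1" "\<delta>1 (g (S 2)) = 0" using ex[of 1] assms by auto
  obtain \<delta>2 where 2: "nonzero_LND M \<delta>2" "\<delta>2 (g (S 2)) = 1" using ex[of 2] assms by auto
  have "{x \<in> A. \<delta>1 x = 0} = {x \<in> A. \<delta>2 x = 0}"
    using s 1(1) 2(1) unfolding semirigid_def equivalent_LND_def a_kernel_subalg_module by blast
  moreover have "g (S 2) \<in> {x \<in> A. \<delta>1 x = 0}" using 1(2) g_mem[of "S 2"] assms by (simp add: gens_S)
  ultimately show False using 2(2) by simp
qed

definition Tpart :: "(generator \<Rightarrow>\<^sub>0 nat) \<Rightarrow> generator \<Rightarrow>\<^sub>0 nat" where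
  "Tpart m = Poly_Mapping.mapp (\<lambda>w x. case w of T i j \<Rightarrow> x | S k \<Rightarrow> 0) m"

lemma lookup_Tpart: "lookup (Tpart m) w = (case w of T i j \<Rightarrow> lookup m w | S k \<Rightarrow> 0)"
  by (auto simp: Tpart_def lookup_mapp when_def in_keys_iff split: generator.split)

lemma mon_Tpart:
  "mon (\<lambda>w. case w of T i j \<Rightarrow> g (T i j) | S k \<Rightarrow> 1) m = mon g (Tpart m)"
proof -
  have "mon g (Tpart m) = (\<Prod>w\<in>keys m. g w ^ lookup (Tpart m) w)"
    by (rule mon_superset) (auto simp: in_keys_iff lookup_Tpart split: generator.splits)
  then show ?thesis unfolding mon_def[of _ m]
    by (simp only:) (auto simp: lookup_Tpart intro!: prod.cong split: generator.split)
qed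

context trinomial_domain
begin

lemma keys_Tpart: "keys m \<subseteq> gens d \<Longrightarrow> keys (Tpart m) \<subseteq> gens 0"
proof
  fix w assume m: "keys m \<subseteq> gens d" and w: "w \<in> keys (Tpart m)"
  show "w \<in> gens 0"
  proof (cases w)
    case (T i j)
    then have "w \<in> keys m" using w by (simp add: in_keys_iff lookup_Tpart)
    then have "w \<in> gens d" using m by blast
    then show ?thesis by (simp add: T gens_T)
  qed (use w in \<open>simp add: in_keys_iff lookup_Tpart\<close>)
qed

text \<open>The functional \<open>coe\<close> extracts the coefficient of a monomial in the free variables.\<close>

lemma extend_model:
  fixes c' :: "'k \<Rightarrow> 'e::comm_ring_1" and coe :: "'s \<Rightarrow> 'e \<Rightarrow> 'b"
  assumes c': "scalar_hom c'" and coe_add: "\<And>\<sigma> x y. coe \<sigma> (x + y) = coe \<sigma> x + coe \<sigma> y"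
    and coe_mon: "\<And>\<sigma> k m. keys m \<subseteq> gens d \<Longrightarrow>
      coe \<sigma> (c' k * mon g' m) = (if part m = \<sigma> then c k * mon g (Tpart m) else 0)"
    and inj: "\<And>m m'. keys m \<subseteq> gens d \<Longrightarrow> keys m' \<subseteq> gens d \<Longrightarrow>
      part m = part m' \<Longrightarrow> Tpart m = Tpart m' \<Longrightarrow> m = m'"
    and lin: "\<And>i. i \<le> r \<Longrightarrow> (\<Prod>j = 1..n i. g' (T i j) ^ l i j) = c' (a i $ 1) * u' + c' (a i $ 2) * v'"
  shows "trinomial_model r n l a c' d g' u' v'"
proof -
  interpret c': scalar_hom c' by fact
  show ?thesis
  proof
    fix p assume p: "p \<in> PV (gens d)" and std: "\<And>m. m \<in> keys p \<Longrightarrow> std m" and 0: "meval c' g' p = 0"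
    have kG: "keys m \<subseteq> gens d" if "m \<in> keys p" for m using p that by (simp add: PV_iff)
    show "p = 0"
    proof (rule ccontr)
      assume "p \<noteq> 0"
      then obtain m0 where m0: "m0 \<in> keys p" using keys_eq_empty by blast
      let ?\<sigma> = "part m0"
      define K where "K = {m \<in> keys p. part m = ?\<sigma>}"
      have "coe ?\<sigma> 0 = coe ?\<sigma> 0 + coe ?\<sigma> 0" using coe_add[of ?\<sigma> 0 0] by (simp only: add_0_right)
      then have coe0: "coe ?\<sigma> 0 = 0" by (metis add_cancel_right_right)
      have coe_sum: "coe ?\<sigma> (sum f W) = (\<Sum>x\<in>W. coe ?\<sigma> (f x))" for f and W :: "(generator \<Rightarrow>\<^sub>0 nat) set"
        by (induction W rule: infinite_finite_induct) (auto simp: coe0 coe_add)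
      define p' where "p' = (\<Sum>m\<in>K. single (Tpart m) (lookup p m))"
      have "0 = (\<Sum>m\<in>keys p. coe ?\<sigma> (c' (lookup p m) * mon g' m))"
        unfolding coe_sum[symmetric] meval_def[symmetric] 0 coe0 ..
      also have "\<dots> = (\<Sum>m\<in>keys p. if part m = ?\<sigma> then c (lookup p m) * mon g (Tpart m) else 0)"
        by (rule sum.cong[OF refl]) (rule coe_mon[OF kG])
      also have "\<dots> = (\<Sum>m\<in>K. c (lookup p m) * mon g (Tpart m))"
        unfolding K_def by (rule sum.inter_filter[symmetric]) simp
      also have "\<dots> = meval c g p'" unfolding p'_def meval_sum meval_single ..
      finally have z: "meval c g p' = 0" by (rule sym)
      have kp': "\<exists>m\<in>K. m' = Tpart m" if "m' \<in> keys p'" for m'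
      proof -
        have "m' \<in> (\<Union>m\<in>K. keys (single (Tpart m) (lookup p m)))"
          by (rule subsetD[OF keys_sum that[unfolded p'_def]])
        then show ?thesis by (auto split: if_splits)
      qed
      have "p' = 0"
      proof (rule indep[OF _ _ z])
        show "p' \<in> PV (gens 0)" unfolding PV_iff
        proof
          fix m' assume "m' \<in> keys p'"
          then obtain m where "m \<in> K" "m' = Tpart m" using kp' by blast
          then show "keys m' \<subseteq> gens 0" using keys_Tpart kG unfolding K_def by blast
        qed
        fix m' assume "m' \<in> keys p'"
        then obtain m where "m \<in> K" "m' = Tpart m" using kp' by blast
        then show "std m'" using std[of m] by (simp add: K_def std_def lookup_Tpart)
      qed
      have "lookup p' (Tpart m0) = (\<Sum>m\<in>K. if m = m0 then lookup p m0 else 0)"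
        unfolding p'_def lookup_sum
      proof (rule sum.cong[OF refl])
        fix m assume m: "m \<in> K"
        then have "Tpart m = Tpart m0 \<longleftrightarrow> m = m0" using inj[OF kG kG[OF m0], of m] unfolding K_def by blast
        then show "lookup (single (Tpart m) (lookup p m)) (Tpart m0) = (if m = m0 then lookup p m0 else 0)"
          by (auto simp: lookup_single when_def)
      qed
      also have "\<dots> = lookup p m0" using m0 by (simp add: K_def)
      finally show False using \<open>p' = 0\<close> m0 by (simp add: in_keys_iff)
    qed
  qed (rule lin)
qed

lemma several_free_variables:
  assumes "d \<ge> 2" shows "\<not> semirigid (trinomial_algebra r d n l a)"
proof -
  define c' :: "'k \<Rightarrow> (nat \<Rightarrow>\<^sub>0 nat) \<Rightarrow>\<^sub>0 'b" where "c' k = single 0 (c k)" for k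
  define wt where "wt w = (case w of T i j \<Rightarrow> 0 | S k \<Rightarrow> single k (1::nat))" for w
  define g' where "g' w = single (wt w) (case w of T i j \<Rightarrow> g (T i j) | S k \<Rightarrow> 1)" for w
  define part where "part m = (\<Sum>v\<in>keys m. \<Sum>x<lookup m v. wt v)" for m :: "generator \<Rightarrow>\<^sub>0 nat"
  have gm: "mon g' m = single (part m) (mon g (Tpart m))" for m
    unfolding part_def mon_Tpart[symmetric] using mon_single_weights by (simp only: g'_def[abs_def])
  have lp: "lookup (part m) k = lookup m (S k)" for m k
  proof -
    have "lookup (part m) k = (\<Sum>v\<in>keys m. lookup m v * lookup (wt v) k)"
      unfolding part_def by (simp only: lookup_sum) simp
    also have "\<dots> = (\<Sum>v\<in>keys m. if v = S k then lookup m (S k) else 0)"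
      by (rule sum.cong) (auto simp: wt_def lookup_single split: generator.split)
    finally show ?thesis by (simp add: in_keys_iff)
  qed
  have c'h: "scalar_hom c'"
    by unfold_locales (auto simp: c'_def c_add c_mult single_add mult_single)
  have "trinomial_model r n l a c' d g' (single 0 u) (single 0 v)"
  proof (rule extend_model[of c' "\<lambda>\<sigma> x. lookup x \<sigma>" d g' part])
    show "scalar_hom c'" by (rule c'h)
    show "lookup (x + y) \<sigma> = lookup x \<sigma> + lookup y \<sigma>" for \<sigma> and x y :: "(nat \<Rightarrow>\<^sub>0 nat) \<Rightarrow>\<^sub>0 'b" by (rule lookup_add)
    show "lookup (c' k * mon g' m) \<sigma> = (if part m = \<sigma> then c k * mon g (Tpart m) else 0)" for \<sigma> k m
      by (simp add: c'_def gm mult_single lookup_single when_def)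
    show "m = m'" if "part m = part m'" "Tpart m = Tpart m'" for m m'
    proof (rule poly_mapping_eqI)
      fix w show "lookup m w = lookup m' w"
        using lp[of m] lp[of m'] lookup_Tpart[of m w] lookup_Tpart[of m' w] that by (cases w) auto
    qed
    fix i assume i: "i \<le> r"
    have "Tpart (lmono i) = lmono i"
      by (rule poly_mapping_eqI) (auto simp: lookup_Tpart lookup_lmono_S split: generator.split)
    moreover have "part (lmono i) = 0" by (rule poly_mapping_eqI) (simp add: lp lookup_lmono_S)
    ultimately have "mon g' (lmono i) = single 0 (yy i)" by (simp add: gm yy_def)
    then show "(\<Prod>j = 1..n i. g' (T i j) ^ l i j) = c' (a i $ 1) * single 0 u + c' (a i $ 2) * single 0 v"
      unfolding mon_lmono yy_eq[OF i] lf_def by (simp add: c'_def mult_single single_add)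
  qed
  then interpret E: trinomial_model r n l a c' d g' "single 0 u" "single 0 v" .
  show ?thesis using E.algebra_iso E.not_semirigid_two_free[OF assms] semirigid_iso by blast
qed

lemma finite_gens: "finite (gens d)"
proof -
  have "gens d \<subseteq> (\<lambda>(i, j). T i j) ` (SIGMA i:{..r}. {1..n i}) \<union> S ` {1..d}"
    by (auto simp: generators_def)
  then show ?thesis by (rule finite_subset) auto
qed

lemma one_free_variable:
  "semirigid (trinomial_algebra r 1 n l a) \<longleftrightarrow> rigid (trinomial_algebra r 0 n l a)"
proof -
  interpret X: poly_extension c A ..
  define g' where "g' w = (case w of T i j \<Rightarrow> [:g (T i j):] | S k \<Rightarrow> X.X)" for w
  have gm: "mon g' m = monom (mon g (Tpart m)) (lookup m (S 1))" if m: "keys m \<subseteq> gens 1" for m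
  proof -
    have 1: "mon g' m = mon (\<lambda>w. [:case w of T i j \<Rightarrow> g (T i j) | S k \<Rightarrow> 1:] * (case w of T i j \<Rightarrow> 1 | S k \<Rightarrow> X.X)) m"
      by (rule arg_cong[of _ _ "\<lambda>g. mon g m"]) (auto simp: g'_def one_pCons split: generator.split)
    have 2: "mon (\<lambda>w. [:h w:]) m = [:mon h m:]" for h :: "generator \<Rightarrow> 'b" and m
    proof -
      have "(\<Prod>w\<in>W. [:h w:] ^ e w) = [:\<Prod>w\<in>W. h w ^ e w:]" for W e
        by (induction W rule: infinite_finite_induct) (auto simp: one_pCons poly_const_pow)
      then show ?thesis by (simp add: mon_def)
    qed
    have "mon (\<lambda>w. case w of T i j \<Rightarrow> 1 | S k \<Rightarrow> X.X) m = (\<Prod>w\<in>keys m \<union> {S 1}. (case w of T i j \<Rightarrow> 1 | S k \<Rightarrow> X.X) ^ lookup m w)"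
      by (rule mon_superset) auto
    also have "\<dots> = (\<Prod>w\<in>{S 1}. (case w of T i j \<Rightarrow> 1 | S k \<Rightarrow> X.X) ^ lookup m w)"
      using m by (intro prod.mono_neutral_right) (auto simp: generators_def split: generator.split)
    finally have 3: "mon (\<lambda>w. case w of T i j \<Rightarrow> 1 | S k \<Rightarrow> X.X) m = X.X ^ lookup m (S 1)" by simp
    show ?thesis unfolding 1 mon_mult 2 3 mon_Tpart X.monom_eq ..
  qed
  have c'h: "scalar_hom X.c'" ..
  have "trinomial_model r n l a X.c' 1 g' [:u:] [:v:]"
  proof (rule extend_model[of X.c' "\<lambda>\<sigma> x. coeff x \<sigma>" 1 g' "\<lambda>m. lookup m (S 1)"])
    show "scalar_hom X.c'" by (rule c'h)
    show "coeff (x + y) \<sigma> = coeff x \<sigma> + coeff y \<sigma>" for \<sigma> and x y :: "'b poly" by simp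
    show "coeff (X.c' k * mon g' m) \<sigma> = (if lookup m (S 1) = \<sigma> then c k * mon g (Tpart m) else 0)"
      if "keys m \<subseteq> gens 1" for \<sigma> k m
      unfolding gm[OF that] by (simp add: X.c'_def)
    show "m = m'" if "keys m \<subseteq> gens 1" "keys m' \<subseteq> gens 1"
      "lookup m (S 1) = lookup m' (S 1)" "Tpart m = Tpart m'" for m m'
    proof (rule poly_mapping_eqI)
      fix w show "lookup m w = lookup m' w"
      proof (cases w)
        case (T i j)
        then show ?thesis using lookup_Tpart[of m w] lookup_Tpart[of m' w] that(4) by simp
      next
        case (S k)
        show ?thesis
        proof (cases "k = 1")
          case False
          then have "S k \<notin> gens 1" by (simp add: gens_S)
          then have "S k \<notin> keys m" "S k \<notin> keys m'" using that(1,2) by blast+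
          then show ?thesis using S by (simp add: in_keys_iff)
        qed (use S that(3) in simp)
      qed
    qed
    fix i assume i: "i \<le> r"
    have "Tpart (lmono i) = lmono i"
      by (rule poly_mapping_eqI) (auto simp: lookup_Tpart lookup_lmono_S split: generator.split)
    then have "mon g' (lmono i) = [:yy i:]" using gm[OF keys_lmono[OF i]] by (simp add: yy_def lookup_lmono_S monom_0)
    then show "(\<Prod>j = 1..n i. g' (T i j) ^ l i j) = X.c' (a i $ 1) * [:u:] + X.c' (a i $ 2) * [:v:]"
      unfolding mon_lmono yy_eq[OF i] lf_def by (simp add: X.c'_def)
  qed
  then interpret E: trinomial_model r n l a X.c' 1 g' "[:u:]" "[:v:]" .
  have gA: "g' w \<in> E.A" if "w \<in> gens 1" for w using E.g_mem that by blast
  have "E.A = X.PA"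
  proof
    show "E.A \<subseteq> X.PA"
    proof (rule E.A_least[OF X.P.subalgebra_axioms])
      fix w assume "w \<in> gens 1"
      then show "g' w \<in> X.PA"
        by (cases w) (auto simp: g'_def X.PA_const X.X_PA gens_T intro!: g_mem)
    qed
    show "X.PA \<subseteq> E.A"
    proof (rule X.PA_least[OF E.A.subalgebra_axioms])
      have "subalgebra c {x. [:x:] \<in> E.A}"
      proof
        fix k show "c k \<in> {x. [:x:] \<in> E.A}" using E.A.c_mem[of k] by (simp add: X.c'_def)
      next
        fix x y assume "x \<in> {x. [:x:] \<in> E.A}" "y \<in> {x. [:x:] \<in> E.A}"
        then have xy: "[:x:] \<in> E.A" "[:y:] \<in> E.A" by auto
        show "x + y \<in> {x. [:x:] \<in> E.A}" using E.A.add_mem[OF xy] by simp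
        show "x * y \<in> {x. [:x:] \<in> E.A}" using E.A.mult_mem[OF xy] by (simp add: mult.commute)
      qed
      moreover have "g w \<in> {x. [:x:] \<in> E.A}" if w: "w \<in> gens 0" for w
      proof -
        obtain i j where ij: "w = T i j" "i \<le> r" "j \<in> {1..n i}" using G_cases w by blast
        then have "T i j \<in> gens 1" by (auto simp: gens_T)
        then show ?thesis using gA[of "T i j"] ij by (simp add: g'_def)
      qed
      ultimately have "A \<subseteq> {x. [:x:] \<in> E.A}" by (rule A_least)
      then show "[:x:] \<in> E.A" if "x \<in> A" for x using that by blast
      show "X.X \<in> E.A" using gA[of "S 1"] by (simp add: g'_def gens_S)
    qed
  qed
  then have "semirigid (trinomial_algebra r 1 n l a) \<longleftrightarrow> semirigid (subalg_module X.c' X.PA)"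
    using E.algebra_iso semirigid_iso by metis
  also have "\<dots> \<longleftrightarrow> rigid M"
  proof (rule X.semirigid_extension_iff)
    show "finite (g ` gens 0)" using finite_gens by simp
    show "g ` gens 0 \<subseteq> A" using g_mem by blast
    show "A \<subseteq> B" if "subalgebra c B" "g ` gens 0 \<subseteq> B" for B using A_least that by blast
  qed
  also have "\<dots> \<longleftrightarrow> rigid (trinomial_algebra r 0 n l a)"
    using algebra_iso rigid_iso by blast
  finally show ?thesis .
qed

lemma no_free_variable:
  "semirigid (trinomial_algebra r 0 n l a) \<Longrightarrow> rigid (trinomial_algebra r 0 n l a)"
  using algebra_iso semirigid_iso rigid_iso semirigid_imp_rigid by blast

end

lemma rigid_imp_semirigid: "rigid A \<Longrightarrow> semirigid A"
  by (simp add: rigid_def semirigid_def)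

lemma independent_pair_det:
  fixes x y :: "'k::field ^ 2"
  assumes "x \<noteq> y" "vec.independent {x, y}"
  shows "x $ 1 * y $ 2 - y $ 1 * x $ 2 \<noteq> 0"
proof
  assume 0: "x $ 1 * y $ 2 - y $ 1 * x $ 2 = 0"
  have "x \<noteq> 0" using assms vec.dependent_zero[of "{x, y}"] by auto
  then have "\<exists>t. y = t *s x"
  proof (cases "x $ 1 = 0")
    case True
    then have "x $ 2 \<noteq> 0" using \<open>x \<noteq> 0\<close> by (auto simp: vec_eq_iff forall_2)
    then show ?thesis using 0 True
      by (intro exI[of _ "y $ 2 / x $ 2"]) (simp add: vec_eq_iff forall_2)
  next
    case False
    then show ?thesis using 0
      by (intro exI[of _ "y $ 1 / x $ 1"]) (simp add: vec_eq_iff forall_2 field_simps)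
  qed
  then have "y \<in> vec.span ({x, y} - {y})" using assms(1) by (auto intro: vec.span_scale vec.span_base)
  then show False using assms(2) unfolding vec.dependent_def by blast
qed

theorem corollary4p2:
  fixes r d :: nat
    and n :: "nat \<Rightarrow> nat"
    and l :: "nat \<Rightarrow> nat \<Rightarrow> nat"
    and a :: "nat \<Rightarrow> ('k::{alg_closed_field, field_char_0}) ^ 2"
  assumes "r \<ge> 2"
    and "\<And>i. i \<le> r \<Longrightarrow> n i \<ge> 1"
    and "\<And>i j. i \<le> r \<Longrightarrow> 1 \<le> j \<Longrightarrow> j \<le> n i \<Longrightarrow> l i j \<ge> 1"
    and "\<And>i j. i \<le> r \<Longrightarrow> j \<le> r \<Longrightarrow> i \<noteq> j \<Longrightarrow> a i \<noteq> a j \<and> vec.independent {a i, a j}"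
  shows "semirigid (trinomial_algebra r d n l a) \<longleftrightarrow>
           rigid (trinomial_algebra r d n l a) \<or>
           (d = 1 \<and> rigid (trinomial_algebra r 0 n l a))"
proof -
  interpret trinomial_torus r n l a
  proof
    show "a i $ 1 * a j $ 2 - a j $ 1 * a i $ 2 \<noteq> 0" if "i \<le> r" "j \<le> r" "i \<noteq> j" for i j
      using assms(4)[OF that] independent_pair_det[of "a i" "a j"] by blast
  qed (use assms(1-3) in auto)
  obtain c :: "'k \<Rightarrow> (nat \<Rightarrow>\<^sub>0 int) \<Rightarrow>\<^sub>0 'k fps" and g u v where "trinomial_model r n l a c 0 g u v"
    using domain_model_exists by blast
  then interpret trinomial_domain r n l a c g u v by (simp add: trinomial_domain_def)
  consider "d = 0" | "d = 1" | "d \<ge> 2" by linarith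
  then show ?thesis
  proof cases
    case 1
    then show ?thesis using no_free_variable rigid_imp_semirigid by auto
  next
    case 2
    then show ?thesis using one_free_variable rigid_imp_semirigid by auto
  next
    case 3
    then show ?thesis using several_free_variables rigid_imp_semirigid by auto
  qed
qed

end
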